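(* Let $(\Sigma,\varphi)$ be a vanishing spinorial pair with reference metric $\hat\omega=i\hat g_{\bar z z}\,dz\wedge d\bar z$ of Gauss curvature $\kappa\le0$ (as in the context), and let $\alpha'>0$. Suppose $f$ is a smooth solution on $\Sigma\times[0,T)$, $0<T<\infty$, of $$\partial_t e^f=\hat g^{z\bar z}\partial_z\partial_{\bar z}\Big(e^f+\frac{\alpha'}{2}\kappa e^{-f}\Big)-\kappa\Big(e^f+\frac{\alpha'}{2}\kappa e^{-f}\Big).$$ Then for any $0<T_0<T$, $$\sup_{\Sigma\times[T_0,T)}e^f\le C(T_0,T)\,\max\Big\{1,\int_0^T\int_\Sigma e^f\,\hat\omega\,dt\Big\},$$ where $C(T_0,T)$ depends only on $T_0$, $T$, $(\Sigma,\hat\omega)$, $\kappa$ and $\alpha'$ (in particular not on the solution $f$ or its initial data).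
   Context: A vanishing spinorial pair $(\Sigma,\varphi)$ is a compact connected Riemann surface $\Sigma$ with a holomorphic map $\varphi:\Sigma\to\mathbb{CP}^1$ such that $\varphi^*\mathcal{O}(2)=K_\Sigma$ (an isomorphism being fixed). With the affine coordinate $\zeta=z_2/z_1$ on $\mathbb{CP}^1$, identify $\mathcal{O}(2)=T\mathbb{CP}^1$ and consider the sections $\phi_1=\zeta\frac{\partial}{\partial\zeta}$, $\phi_2=\frac12(\zeta^2-1)\frac{\partial}{\partial\zeta}$, $\phi_3=-\frac{i}{2}(\zeta^2+1)\frac{\partial}{\partial\zeta}$. Their pullbacks $\mu_k=\varphi^*\phi_k$ are holomorphic $1$-forms on $\Sigma$, and $\hat\omega=i(\mu_1\wedge\overline{\mu_1}+\mu_2\wedge\overline{\mu_2}+\mu_3\wedge\overline{\mu_3})$ is a Kähler metric on $\Sigma$, with scaling chosen so that $\int_\Sigma\hat\omega=1$. Write $\hat\omega=i\hat g_{\bar z z}\,dz\wedge d\bar z$, $\hat g^{z\bar z}=\hat g_{\bar z z}^{-1}$. The Gauss curvature of $\hat\omega$ is $\kappa=-\hat g^{z\bar z}\partial_z\partial_{\bar z}\log\hat g_{\bar z z}$, which satisfies $\kappa\,\hat\omega=-\varphi^*\omega_{FS}\le 0$ with $\omega_{FS}=\frac{2}{(1+|\zeta|^2)^2}\,i\,d\zeta\wedge d\bar\zeta$. *)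

theory Defs
  imports "HOL-Complex_Analysis.Complex_Analysis"
begin

section \<open>Riemann surfaces\<close>

text \<open>A coordinate chart is an open domain together with a complex coordinate on it.
  The coordinate is only meaningful on the domain.\<close>

type_synonym 'a chart = "'a set \<times> ('a \<Rightarrow> complex)"

abbreviation dom_of :: "'a chart \<Rightarrow> 'a set" where "dom_of c \<equiv> fst c"

abbreviation coord :: "'a chart \<Rightarrow> 'a \<Rightarrow> complex" where "coord c \<equiv> snd c"

definition inv_coord :: "'a chart \<Rightarrow> complex \<Rightarrow> 'a" where
  "inv_coord c = inv_into (dom_of c) (coord c)"

definition is_chart :: "'a::topological_space chart \<Rightarrow> bool" where
  "is_chart c \<longleftrightarrow> open (dom_of c) \<and> open (coord c ` dom_of c) \<and>
     homeomorphism (dom_of c) (coord c ` dom_of c) (coord c) (inv_coord c)"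

definition riemann_surface :: "'a::t2_space chart set \<Rightarrow> bool" where
  "riemann_surface A \<longleftrightarrow>
     connected (UNIV :: 'a set) \<and>
     (\<forall>c\<in>A. is_chart c) \<and>
     (\<Union>c\<in>A. dom_of c) = UNIV \<and>
     (\<forall>c\<in>A. \<forall>c'\<in>A.
        (coord c \<circ> inv_coord c') holomorphic_on (coord c' ` (dom_of c \<inter> dom_of c')))"

definition holomorphic_map ::
  "'a::topological_space chart set \<Rightarrow> 'b::topological_space chart set \<Rightarrow> ('a \<Rightarrow> 'b) \<Rightarrow> bool" where
  "holomorphic_map A B \<phi> \<longleftrightarrow>
     continuous_on UNIV \<phi> \<and>
     (\<forall>c\<in>A. \<forall>b\<in>B.
        (coord b \<circ> \<phi> \<circ> inv_coord c) holomorphic_on (coord c ` (dom_of c \<inter> \<phi> -` dom_of b)))"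

text \<open>The derivative \<open>dc / dc'\<close> of the coordinate of \<open>c\<close> with respect to that of \<open>c'\<close>.\<close>

definition coord_deriv :: "'a chart \<Rightarrow> 'a chart \<Rightarrow> 'a \<Rightarrow> complex" where
  "coord_deriv c c' x = deriv (coord c \<circ> inv_coord c') (coord c' x)"

text \<open>A holomorphic vector field is given by its components \<open>v c\<close>, standing for
  \<open>v c * \<partial>/\<partial>c\<close> on the domain of \<open>c\<close>; a holomorphic 1-form by its
  components \<open>\<mu> c\<close>, standing for \<open>\<mu> c * dc\<close>.\<close>

definition holomorphic_vector_field ::
  "'a::topological_space chart set \<Rightarrow> ('a chart \<Rightarrow> 'a \<Rightarrow> complex) \<Rightarrow> bool" where
  "holomorphic_vector_field A v \<longleftrightarrow>
     (\<forall>c\<in>A. (v c \<circ> inv_coord c) holomorphic_on (coord c ` dom_of c)) \<and>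
     (\<forall>c\<in>A. \<forall>c'\<in>A. \<forall>x \<in> dom_of c \<inter> dom_of c'. v c' x = coord_deriv c' c x * v c x)"

text \<open>A holomorphic line bundle isomorphism \<open>\<phi>\<^sup>* TY \<cong> K\<^sub>X\<close>, in the local frames
  \<open>\<partial>/\<partial>b\<close> of \<open>TY\<close> and \<open>dc\<close> of \<open>K\<^sub>X\<close>:
  the fibre map at \<open>x\<close> sends \<open>\<partial>/\<partial>b\<close> at \<open>\<phi> x\<close> to \<open>h c b x * dc\<close>.\<close>

definition tangent_pullback_iso_canonical ::
  "'a::topological_space chart set \<Rightarrow> 'b::topological_space chart set \<Rightarrow> ('a \<Rightarrow> 'b) \<Rightarrow>
     ('a chart \<Rightarrow> 'b chart \<Rightarrow> 'a \<Rightarrow> complex) \<Rightarrow> bool" where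
  "tangent_pullback_iso_canonical A B \<phi> h \<longleftrightarrow>
     (\<forall>c\<in>A. \<forall>b\<in>B.
        (h c b \<circ> inv_coord c) holomorphic_on (coord c ` (dom_of c \<inter> \<phi> -` dom_of b)) \<and>
        (\<forall>x \<in> dom_of c \<inter> \<phi> -` dom_of b. h c b x \<noteq> 0)) \<and>
     (\<forall>c\<in>A. \<forall>c'\<in>A. \<forall>b\<in>B. \<forall>b'\<in>B.
        \<forall>x \<in> dom_of c \<inter> dom_of c' \<inter> \<phi> -` (dom_of b \<inter> dom_of b').
          h c' b' x = h c b x * coord_deriv c c' x * coord_deriv b b' (\<phi> x))"

section \<open>The complex projective line\<close>

definition proportional :: "complex \<times> complex \<Rightarrow> complex \<times> complex \<Rightarrow> bool" where
  "proportional z w \<longleftrightarrow>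
     z \<noteq> 0 \<and> w \<noteq> 0 \<and> (\<exists>c. c \<noteq> 0 \<and> w = (c * fst z, c * snd z))"

quotient_type cp1 = "complex \<times> complex" / partial: proportional
proof (rule part_equivpI)
  show "\<exists>z. proportional z z"
    by (rule exI[of _ "(1, 0)"]) (auto simp: proportional_def zero_prod_def intro!: exI[of _ 1])
  show "symp proportional"
  proof (rule sympI)
    fix z w assume "proportional z w"
    then obtain c where "c \<noteq> 0" "w = (c * fst z, c * snd z)" "z \<noteq> 0" "w \<noteq> 0"
      by (auto simp: proportional_def)
    then show "proportional w z"
      unfolding proportional_def by (intro conjI exI[of _ "inverse c"]) (auto simp: prod_eq_iff)
  qed
  show "transp proportional"
  proof (rule transpI)
    fix z w u assume "proportional z w" "proportional w u"
    then obtain c d where "c \<noteq> 0" "w = (c * fst z, c * snd z)" "d \<noteq> 0"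
        "u = (d * fst w, d * snd w)" "z \<noteq> 0" "u \<noteq> 0"
      by (auto simp: proportional_def)
    then show "proportional z u"
      unfolding proportional_def by (intro conjI exI[of _ "d * c"]) auto
  qed
qed

instantiation cp1 :: topological_space
begin

definition open_cp1 :: "cp1 set \<Rightarrow> bool" where
  "open_cp1 U \<longleftrightarrow> open {z. z \<noteq> 0 \<and> abs_cp1 z \<in> U}"

instance
proof
  have "{z. z \<noteq> 0 \<and> abs_cp1 z \<in> UNIV} = - {0}" by auto
  then show "open (UNIV :: cp1 set)" by (simp add: open_cp1_def open_Compl)
next
  fix S T :: "cp1 set" assume "open S" "open T"
  moreover have "{z. z \<noteq> 0 \<and> abs_cp1 z \<in> S \<inter> T} =
      {z. z \<noteq> 0 \<and> abs_cp1 z \<in> S} \<inter> {z. z \<noteq> 0 \<and> abs_cp1 z \<in> T}" by auto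
  ultimately show "open (S \<inter> T)" by (simp add: open_cp1_def open_Int)
next
  fix K :: "cp1 set set" assume "\<forall>S\<in>K. open S"
  moreover have "{z. z \<noteq> 0 \<and> abs_cp1 z \<in> \<Union>K} = (\<Union>S\<in>K. {z. z \<noteq> 0 \<and> abs_cp1 z \<in> S})" by auto
  ultimately show "open (\<Union>K)" by (simp add: open_cp1_def open_UN)
qed

end

lift_definition cp1_zeta :: "cp1 \<Rightarrow> complex" is "\<lambda>z. snd z / fst z"
  by (auto simp: proportional_def)

lift_definition cp1_eta :: "cp1 \<Rightarrow> complex" is "\<lambda>z. fst z / snd z"
  by (auto simp: proportional_def)

lift_definition fst_nonzero :: "cp1 \<Rightarrow> bool" is "\<lambda>z. fst z \<noteq> 0"
  by (auto simp: proportional_def)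

lift_definition snd_nonzero :: "cp1 \<Rightarrow> bool" is "\<lambda>z. snd z \<noteq> 0"
  by (auto simp: proportional_def)

definition zeta_chart :: "cp1 chart" where
  "zeta_chart = ({p. fst_nonzero p}, cp1_zeta)"

definition eta_chart :: "cp1 chart" where
  "eta_chart = ({p. snd_nonzero p}, cp1_eta)"

definition cp1_atlas :: "cp1 chart set" where
  "cp1_atlas = {zeta_chart, eta_chart}"

lemma proportional_refl: "z \<noteq> 0 \<Longrightarrow> proportional z z"
  by (auto simp: proportional_def intro!: exI[of _ 1])

lemma cp1_cases: obtains a b where "(a, b) \<noteq> (0, 0)" "p = abs_cp1 (a, b)"
proof (rule that)
  have "proportional (rep_cp1 p) (rep_cp1 p)" by (rule Quotient3_rep_reflp[OF Quotient3_cp1])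
  then show "(fst (rep_cp1 p), snd (rep_cp1 p)) \<noteq> (0, 0)"
    by (simp add: proportional_def zero_prod_def)
  show "p = abs_cp1 (fst (rep_cp1 p), snd (rep_cp1 p))"
    by (simp add: Quotient3_abs_rep[OF Quotient3_cp1])
qed

lemma abs_cp1_simps:
  assumes "(a, b) \<noteq> (0, 0)"
  shows "cp1_zeta (abs_cp1 (a, b)) = b / a" "cp1_eta (abs_cp1 (a, b)) = a / b"
    "fst_nonzero (abs_cp1 (a, b)) \<longleftrightarrow> a \<noteq> 0" "snd_nonzero (abs_cp1 (a, b)) \<longleftrightarrow> b \<noteq> 0"
  using proportional_refl[of "(a, b)"] assms
  by (simp_all add: cp1_zeta.abs_eq cp1_eta.abs_eq fst_nonzero.abs_eq snd_nonzero.abs_eq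
      zero_prod_def)

lemma abs_cp1_simps':
  assumes "z \<noteq> 0"
  shows "cp1_zeta (abs_cp1 z) = snd z / fst z" "cp1_eta (abs_cp1 z) = fst z / snd z"
    "fst_nonzero (abs_cp1 z) \<longleftrightarrow> fst z \<noteq> 0" "snd_nonzero (abs_cp1 z) \<longleftrightarrow> snd z \<noteq> 0"
  using abs_cp1_simps[of "fst z" "snd z"] assms by (simp_all add: zero_prod_def)

lemma abs_cp1_eqI:
  assumes "(a, b) \<noteq> (0, 0)" "c \<noteq> 0" "a' = c * a" "b' = c * b"
  shows "abs_cp1 (a, b) = abs_cp1 (a', b')"
proof -
  have "proportional (a, b) (a', b')"
    unfolding proportional_def using assms by (auto simp: zero_prod_def)
  then show ?thesis by (rule Quotient3_rel_abs[OF Quotient3_cp1])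
qed

lemma inv_coord_eqI:
  assumes "\<And>w. w \<in> S \<Longrightarrow> j w \<in> dom_of c \<and> coord c (j w) = w"
    and "\<And>p. p \<in> dom_of c \<Longrightarrow> j (coord c p) = p" and "w \<in> S"
  shows "inv_coord c w = j w"
proof -
  have "inj_on (coord c) (dom_of c)" by (rule inj_on_inverseI[of _ j]) (rule assms)
  then show ?thesis unfolding inv_coord_def using assms(1)[OF assms(3)]
    by (metis inv_into_f_f)
qed

lemma zeta_chart_inverse:
  "abs_cp1 (1, w) \<in> dom_of zeta_chart" "coord zeta_chart (abs_cp1 (1, w)) = w"
  "p \<in> dom_of zeta_chart \<Longrightarrow> abs_cp1 (1, coord zeta_chart p) = p"
proof -
  show "abs_cp1 (1, w) \<in> dom_of zeta_chart" "coord zeta_chart (abs_cp1 (1, w)) = w"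
    by (simp_all add: zeta_chart_def abs_cp1_simps)
  assume "p \<in> dom_of zeta_chart"
  then show "abs_cp1 (1, coord zeta_chart p) = p"
    by (cases p rule: cp1_cases)
       (auto simp: zeta_chart_def abs_cp1_simps intro!: abs_cp1_eqI)
qed

lemma eta_chart_inverse:
  "abs_cp1 (w, 1) \<in> dom_of eta_chart" "coord eta_chart (abs_cp1 (w, 1)) = w"
  "p \<in> dom_of eta_chart \<Longrightarrow> abs_cp1 (coord eta_chart p, 1) = p"
proof -
  show "abs_cp1 (w, 1) \<in> dom_of eta_chart" "coord eta_chart (abs_cp1 (w, 1)) = w"
    by (simp_all add: eta_chart_def abs_cp1_simps)
  assume "p \<in> dom_of eta_chart"
  then show "abs_cp1 (coord eta_chart p, 1) = p"
    by (cases p rule: cp1_cases)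
       (auto simp: eta_chart_def abs_cp1_simps intro!: abs_cp1_eqI)
qed

lemma inv_coord_zeta: "inv_coord zeta_chart w = abs_cp1 (1, w)"
  by (rule inv_coord_eqI[of UNIV]) (auto simp: zeta_chart_inverse)

lemma inv_coord_eta: "inv_coord eta_chart w = abs_cp1 (w, 1)"
  by (rule inv_coord_eqI[of UNIV]) (auto simp: eta_chart_inverse)

lemma continuous_on_abs_cp1: "continuous_on (- {0}) abs_cp1"
proof -
  have "- {0} \<inter> abs_cp1 -` U = {z. z \<noteq> 0 \<and> abs_cp1 z \<in> U}" for U by auto
  then show ?thesis
    by (subst continuous_on_open_vimage) (auto simp: open_Compl open_cp1_def Int_commute)
qed

lemma open_fst_nonzero: "open {p. fst_nonzero p}"
proof -
  have "{z. z \<noteq> 0 \<and> abs_cp1 z \<in> {p. fst_nonzero p}} = {z. fst z \<noteq> 0}"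
    by (metis (mono_tags, lifting) Collect_cong abs_cp1_simps'(3) fst_zero mem_Collect_eq)
  then show ?thesis
    unfolding open_cp1_def by (simp add: open_Collect_neq continuous_on_fst)
qed

lemma open_snd_nonzero: "open {p. snd_nonzero p}"
proof -
  have "{z. z \<noteq> 0 \<and> abs_cp1 z \<in> {p. snd_nonzero p}} = {z. snd z \<noteq> 0}"
    by (metis (mono_tags, lifting) Collect_cong abs_cp1_simps'(4) snd_zero mem_Collect_eq)
  then show ?thesis
    unfolding open_cp1_def by (simp add: open_Collect_neq continuous_on_snd)
qed

lemma continuous_on_cp1I:
  fixes F :: "cp1 \<Rightarrow> 'b::topological_space"
  assumes D: "open D" and G: "continuous_on {z. z \<noteq> 0 \<and> abs_cp1 z \<in> D} G"
    and eq: "\<And>z. z \<noteq> 0 \<Longrightarrow> abs_cp1 z \<in> D \<Longrightarrow> F (abs_cp1 z) = G z"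
  shows "continuous_on D F"
proof (subst continuous_on_open_vimage[OF D], intro allI impI)
  fix B :: "'b set" assume "open B"
  moreover have "open {z. z \<noteq> 0 \<and> abs_cp1 z \<in> D}" using D by (simp add: open_cp1_def)
  ultimately have "open (G -` B \<inter> {z. z \<noteq> 0 \<and> abs_cp1 z \<in> D})"
    using G continuous_on_open_vimage by blast
  moreover have "{z. z \<noteq> 0 \<and> abs_cp1 z \<in> F -` B \<inter> D} = G -` B \<inter> {z. z \<noteq> 0 \<and> abs_cp1 z \<in> D}"
    using eq by auto
  ultimately show "open (F -` B \<inter> D)" by (simp add: open_cp1_def)
qed

lemma is_chart_zeta: "is_chart zeta_chart"
proof -
  have im: "coord zeta_chart ` dom_of zeta_chart = UNIV"
    using zeta_chart_inverse by (metis UNIV_eq_I image_eqI)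
  have "continuous_on (dom_of zeta_chart) (coord zeta_chart)"
  proof (rule continuous_on_cp1I)
    show "open (dom_of zeta_chart)" by (simp add: zeta_chart_def open_fst_nonzero)
    show "continuous_on {z. z \<noteq> 0 \<and> abs_cp1 z \<in> dom_of zeta_chart} (\<lambda>z. snd z / fst z)"
      by (intro continuous_intros) (auto simp: zeta_chart_def abs_cp1_simps zero_prod_def)
  qed (simp add: zeta_chart_def abs_cp1_simps')
  moreover have "continuous_on UNIV (\<lambda>w. abs_cp1 (1, w))"
    by (rule continuous_on_compose2[OF continuous_on_abs_cp1]) (auto intro!: continuous_intros simp: zero_prod_def)
  moreover have "range (\<lambda>w. abs_cp1 (1, w)) = dom_of zeta_chart"
    using zeta_chart_inverse(1) zeta_chart_inverse(3) by (metis (no_types, lifting) rangeE rangeI subsetI subset_antisym)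
  moreover have "open (dom_of zeta_chart)" by (simp add: zeta_chart_def open_fst_nonzero)
  ultimately show ?thesis
    unfolding is_chart_def im homeomorphism_def inv_coord_zeta
    by (simp add: zeta_chart_inverse)
qed

lemma is_chart_eta: "is_chart eta_chart"
proof -
  have im: "coord eta_chart ` dom_of eta_chart = UNIV"
    using eta_chart_inverse by (metis UNIV_eq_I image_eqI)
  have "continuous_on (dom_of eta_chart) (coord eta_chart)"
  proof (rule continuous_on_cp1I)
    show "open (dom_of eta_chart)" by (simp add: eta_chart_def open_snd_nonzero)
    show "continuous_on {z. z \<noteq> 0 \<and> abs_cp1 z \<in> dom_of eta_chart} (\<lambda>z. fst z / snd z)"
      by (intro continuous_intros) (auto simp: eta_chart_def abs_cp1_simps zero_prod_def)
  qed (simp add: eta_chart_def abs_cp1_simps')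
  moreover have "continuous_on UNIV (\<lambda>w. abs_cp1 (w, 1))"
    by (rule continuous_on_compose2[OF continuous_on_abs_cp1]) (auto intro!: continuous_intros simp: zero_prod_def)
  moreover have "range (\<lambda>w. abs_cp1 (w, 1)) = dom_of eta_chart"
    using eta_chart_inverse(1) eta_chart_inverse(3) by (metis (no_types, lifting) rangeE rangeI subsetI subset_antisym)
  moreover have "open (dom_of eta_chart)" by (simp add: eta_chart_def open_snd_nonzero)
  ultimately show ?thesis
    unfolding is_chart_def im homeomorphism_def inv_coord_eta
    by (simp add: eta_chart_inverse)
qed

instance cp1 :: t2_space
proof
  fix p q :: cp1 assume "p \<noteq> q"
  obtain a b where p: "(a, b) \<noteq> (0, 0)" "p = abs_cp1 (a, b)" by (rule cp1_cases)
  obtain c d where q: "(c, d) \<noteq> (0, 0)" "q = abs_cp1 (c, d)" by (rule cp1_cases)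
  have sep: "\<exists>U V. open U \<and> open V \<and> p \<in> U \<and> q \<in> V \<and> U \<inter> V = {}"
    if c: "is_chart c" "p \<in> dom_of c" "q \<in> dom_of c" for c
  proof -
    have c': "open (dom_of c)" "continuous_on (dom_of c) (coord c)"
        "\<And>x. x \<in> dom_of c \<Longrightarrow> inv_coord c (coord c x) = x"
      using c by (auto simp: is_chart_def homeomorphism_def)
    then have "coord c p \<noteq> coord c q" using c \<open>p \<noteq> q\<close> by metis
    then obtain U V where "open U" "open V" "coord c p \<in> U" "coord c q \<in> V" "U \<inter> V = {}"
      by (metis hausdorff)
    with c' c show ?thesis
      by (intro exI[of _ "coord c -` U \<inter> dom_of c"] exI[of _ "coord c -` V \<inter> dom_of c"])
         (auto simp: continuous_on_open_vimage)
  qed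
  have sep0: "\<exists>U V. open U \<and> open V \<and> abs_cp1 (1, 0) \<in> U \<and> abs_cp1 (0, 1) \<in> V \<and> U \<inter> V = {}"
  proof (intro exI conjI)
    let ?U = "{z :: complex \<times> complex. cmod (snd z) < cmod (fst z)}"
    let ?V = "{z :: complex \<times> complex. cmod (fst z) < cmod (snd z)}"
    let ?P = "{p. fst_nonzero p \<and> cmod (cp1_zeta p) < 1}"
    let ?Q = "{p. snd_nonzero p \<and> cmod (cp1_eta p) < 1}"
    have "(z \<noteq> 0 \<and> abs_cp1 z \<in> ?P) = (cmod (snd z) < cmod (fst z))" for z
      by (cases "z = 0") (auto simp: abs_cp1_simps' norm_divide divide_simps)
    moreover have "(z \<noteq> 0 \<and> abs_cp1 z \<in> ?Q) = (cmod (fst z) < cmod (snd z))" for z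
      by (cases "z = 0") (auto simp: abs_cp1_simps' norm_divide divide_simps)
    ultimately have "{z. z \<noteq> 0 \<and> abs_cp1 z \<in> ?P} = ?U" "{z. z \<noteq> 0 \<and> abs_cp1 z \<in> ?Q} = ?V"
      by presburger+
    moreover have "open ?U" "open ?V" by (auto intro!: open_Collect_less continuous_intros)
    ultimately show "open ?P" "open ?Q" by (simp_all add: open_cp1_def)
    show "?P \<inter> ?Q = {}"
    proof -
      have False if "r \<in> ?P" "r \<in> ?Q" for r
        using that by (cases r rule: cp1_cases)
          (auto simp: abs_cp1_simps norm_divide divide_simps split: if_splits)
      then show ?thesis by blast
    qed
  qed (auto simp: abs_cp1_simps)
  show "\<exists>U V. open U \<and> open V \<and> p \<in> U \<and> q \<in> V \<and> U \<inter> V = {}"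
  proof (cases "a \<noteq> 0 \<and> c \<noteq> 0 \<or> b \<noteq> 0 \<and> d \<noteq> 0")
    case True
    moreover have "p \<in> dom_of zeta_chart \<longleftrightarrow> a \<noteq> 0" "p \<in> dom_of eta_chart \<longleftrightarrow> b \<noteq> 0"
      unfolding p(2) using p(1) by (simp_all add: zeta_chart_def eta_chart_def abs_cp1_simps)
    moreover have "q \<in> dom_of zeta_chart \<longleftrightarrow> c \<noteq> 0" "q \<in> dom_of eta_chart \<longleftrightarrow> d \<noteq> 0"
      unfolding q(2) using q(1) by (simp_all add: zeta_chart_def eta_chart_def abs_cp1_simps)
    ultimately show ?thesis
      using sep[OF is_chart_zeta] sep[OF is_chart_eta] by blast
  next
    case False
    have norm: "abs_cp1 (u, 0) = abs_cp1 (1, 0)" "abs_cp1 (0, u) = abs_cp1 (0, 1)" if "u \<noteq> 0" for u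
      using that by (auto intro!: abs_cp1_eqI[where c = "inverse u"])
    from False p(1) q(1) consider "a \<noteq> 0" "b = 0" "c = 0" "d \<noteq> 0" | "a = 0" "b \<noteq> 0" "c \<noteq> 0" "d = 0"
      by auto
    then have "p = abs_cp1 (1, 0) \<and> q = abs_cp1 (0, 1) \<or> p = abs_cp1 (0, 1) \<and> q = abs_cp1 (1, 0)"
      by cases (metis norm p(2) q(2))+
    then show ?thesis
    proof
      assume "p = abs_cp1 (1, 0) \<and> q = abs_cp1 (0, 1)"
      then show ?thesis using sep0 by simp
    next
      assume *: "p = abs_cp1 (0, 1) \<and> q = abs_cp1 (1, 0)"
      obtain U V where "open U" "open V" "abs_cp1 (1, 0) \<in> U" "abs_cp1 (0, 1) \<in> V" "U \<inter> V = {}"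
        using sep0 by blast
      with * show ?thesis by (intro exI[of _ V] exI[of _ U]) (simp add: Int_commute)
    qed
  qed
qed

lemma cp1_overlap:
  "coord zeta_chart ` (dom_of zeta_chart \<inter> dom_of eta_chart) = - {0}"
  "coord eta_chart ` (dom_of zeta_chart \<inter> dom_of eta_chart) = - {0}"
proof -
  have "w \<in> coord zeta_chart ` (dom_of zeta_chart \<inter> dom_of eta_chart)" if "w \<noteq> 0" for w
    using that by (intro image_eqI[of _ _ "abs_cp1 (1, w)"])
      (auto simp: zeta_chart_def eta_chart_def abs_cp1_simps)
  moreover have "w \<in> coord eta_chart ` (dom_of zeta_chart \<inter> dom_of eta_chart)" if "w \<noteq> 0" for w
    using that by (intro image_eqI[of _ _ "abs_cp1 (w, 1)"])
      (auto simp: zeta_chart_def eta_chart_def abs_cp1_simps)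
  moreover have "cp1_zeta p \<noteq> 0 \<and> cp1_eta p \<noteq> 0" if "fst_nonzero p" "snd_nonzero p" for p
    using that by (cases p rule: cp1_cases) (auto simp: abs_cp1_simps)
  ultimately show "coord zeta_chart ` (dom_of zeta_chart \<inter> dom_of eta_chart) = - {0}"
    "coord eta_chart ` (dom_of zeta_chart \<inter> dom_of eta_chart) = - {0}"
    by (auto simp: zeta_chart_def eta_chart_def)
qed

lemma cp1_transition:
  "coord zeta_chart \<circ> inv_coord eta_chart = inverse"
  "coord eta_chart \<circ> inv_coord zeta_chart = inverse"
  "coord zeta_chart \<circ> inv_coord zeta_chart = (\<lambda>w. w)"
  "coord eta_chart \<circ> inv_coord eta_chart = (\<lambda>w. w)"
proof -
  have "coord zeta_chart p = cp1_zeta p" "coord eta_chart p = cp1_eta p" for p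
    by (simp_all add: zeta_chart_def eta_chart_def)
  then show
    "coord zeta_chart \<circ> inv_coord eta_chart = inverse"
    "coord eta_chart \<circ> inv_coord zeta_chart = inverse"
    "coord zeta_chart \<circ> inv_coord zeta_chart = (\<lambda>w. w)"
    "coord eta_chart \<circ> inv_coord eta_chart = (\<lambda>w. w)"
    by (simp_all add: fun_eq_iff inv_coord_zeta inv_coord_eta abs_cp1_simps divide_inverse)
qed

lemma cp1_cover: "dom_of zeta_chart \<union> dom_of eta_chart = UNIV"
proof -
  have "fst_nonzero p \<or> snd_nonzero p" for p
    by (cases p rule: cp1_cases) (auto simp: abs_cp1_simps)
  then show ?thesis by (auto simp: zeta_chart_def eta_chart_def)
qed

lemma riemann_surface_cp1: "riemann_surface cp1_atlas"
proof -
  have con: "connected (dom_of c)" if "is_chart c" "coord c ` dom_of c = UNIV" for c :: "cp1 chart"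
    using that unfolding is_chart_def homeomorphism_def
    by (metis connected_UNIV connected_continuous_image)
  have "coord zeta_chart ` dom_of zeta_chart = UNIV" "coord eta_chart ` dom_of eta_chart = UNIV"
    using zeta_chart_inverse eta_chart_inverse by (metis UNIV_eq_I image_eqI)+
  moreover have "abs_cp1 (1, 1) \<in> dom_of zeta_chart \<inter> dom_of eta_chart"
    by (simp add: zeta_chart_inverse eta_chart_inverse)
  ultimately have "connected (UNIV :: cp1 set)"
    using connected_Un[of "dom_of zeta_chart" "dom_of eta_chart"] con is_chart_zeta is_chart_eta
    by (metis cp1_cover empty_iff)
  moreover have "inverse holomorphic_on (- {0 :: complex})"
    by (intro holomorphic_intros) auto
  ultimately show ?thesis
    unfolding riemann_surface_def cp1_atlas_def
    using is_chart_zeta is_chart_eta cp1_cover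
    by (simp add: cp1_transition cp1_overlap Int_commute[of "dom_of eta_chart" "dom_of zeta_chart"])
qed

text \<open>\<open>cp1_field c0 c1 c2\<close> is the global section
  \<open>(c0 + c1 \<zeta> + c2 \<zeta>\<^sup>2) \<partial>/\<partial>\<zeta>\<close> of \<open>T\<complex>P\<^sup>1 = \<O>(2)\<close>.
  With \<open>\<eta> = 1 / \<zeta>\<close> one has \<open>\<partial>/\<partial>\<zeta> = - \<eta>\<^sup>2 \<partial>/\<partial>\<eta>\<close>,
  which gives the component in the other chart, including at \<open>\<zeta> = \<infinity>\<close>.\<close>

definition cp1_field ::
  "complex \<Rightarrow> complex \<Rightarrow> complex \<Rightarrow> cp1 chart \<Rightarrow> cp1 \<Rightarrow> complex" where
  "cp1_field c0 c1 c2 b p =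
     (if b = zeta_chart then c0 + c1 * cp1_zeta p + c2 * (cp1_zeta p)\<^sup>2
      else - (c0 * (cp1_eta p)\<^sup>2 + c1 * cp1_eta p + c2))"

lemma holomorphic_vector_field_cp1_field:
  "holomorphic_vector_field cp1_atlas (cp1_field c0 c1 c2)"
proof -
  have ne: "eta_chart \<noteq> zeta_chart"
  proof
    assume "eta_chart = zeta_chart"
    moreover have "abs_cp1 (1, 0) \<in> dom_of zeta_chart" by (rule zeta_chart_inverse)
    moreover have "abs_cp1 (1, 0) \<notin> dom_of eta_chart" by (simp add: eta_chart_def abs_cp1_simps)
    ultimately show False by simp
  qed
  have z: "cp1_field c0 c1 c2 zeta_chart \<circ> inv_coord zeta_chart = (\<lambda>w. c0 + c1 * w + c2 * w\<^sup>2)"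
    by (auto simp: cp1_field_def inv_coord_zeta abs_cp1_simps)
  have e: "cp1_field c0 c1 c2 eta_chart \<circ> inv_coord eta_chart = (\<lambda>w. - (c0 * w\<^sup>2 + c1 * w + c2))"
    by (auto simp: cp1_field_def inv_coord_eta abs_cp1_simps ne)
  have d: "coord_deriv zeta_chart eta_chart x = - ((inverse (cp1_eta x))\<^sup>2)"
      "coord_deriv eta_chart zeta_chart x = - ((inverse (cp1_zeta x))\<^sup>2)"
      "cp1_zeta x = inverse (cp1_eta x)" "cp1_eta x \<noteq> 0"
    if "x \<in> dom_of zeta_chart" "x \<in> dom_of eta_chart" for x
  proof -
    show "cp1_zeta x = inverse (cp1_eta x)" "cp1_eta x \<noteq> 0"
      using that by (cases x rule: cp1_cases; auto simp: zeta_chart_def eta_chart_def abs_cp1_simps)+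
    then show "coord_deriv zeta_chart eta_chart x = - ((inverse (cp1_eta x))\<^sup>2)"
      "coord_deriv eta_chart zeta_chart x = - ((inverse (cp1_zeta x))\<^sup>2)"
      unfolding coord_deriv_def cp1_transition
      by (simp_all add: zeta_chart_def eta_chart_def power2_eq_square inverse_eq_divide)
  qed
  show ?thesis
    unfolding holomorphic_vector_field_def cp1_atlas_def
  proof (intro conjI ballI)
    fix c assume "c \<in> {zeta_chart, eta_chart}"
    then show "(cp1_field c0 c1 c2 c \<circ> inv_coord c) holomorphic_on coord c ` dom_of c"
      by (auto simp: z e intro!: holomorphic_intros)
  next
    fix c c' x assume c: "c \<in> {zeta_chart, eta_chart}" "c' \<in> {zeta_chart, eta_chart}"
      "x \<in> dom_of c \<inter> dom_of c'"
    have [simp]: "coord_deriv zeta_chart zeta_chart x = 1" "coord_deriv eta_chart eta_chart x = 1"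
      by (auto simp: coord_deriv_def cp1_transition)
    have eq: "cp1_field c0 c1 c2 zeta_chart x = coord_deriv zeta_chart eta_chart x * cp1_field c0 c1 c2 eta_chart x"
        "cp1_field c0 c1 c2 eta_chart x = coord_deriv eta_chart zeta_chart x * cp1_field c0 c1 c2 zeta_chart x"
      if "x \<in> dom_of zeta_chart" "x \<in> dom_of eta_chart"
      using ne d(4)[OF that] unfolding d(1,2)[OF that] cp1_field_def d(3)[OF that]
      by (simp_all add: field_simps power2_eq_square)
    from c show "cp1_field c0 c1 c2 c' x = coord_deriv c' c x * cp1_field c0 c1 c2 c x"
      using eq by auto
  qed
qed

definition phi1 :: "cp1 chart \<Rightarrow> cp1 \<Rightarrow> complex" where
  "phi1 = cp1_field 0 1 0"

definition phi2 :: "cp1 chart \<Rightarrow> cp1 \<Rightarrow> complex" where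
  "phi2 = cp1_field (- 1 / 2) 0 (1 / 2)"

definition phi3 :: "cp1 chart \<Rightarrow> cp1 \<Rightarrow> complex" where
  "phi3 = cp1_field (- \<i> / 2) 0 (- \<i> / 2)"

section \<open>Vanishing spinorial pairs\<close>

text \<open>The isomorphism \<open>\<phi>\<^sup>* \<O>(2) = K\<close>, with \<open>\<O>(2)\<close> taken to be the
  tangent bundle of the projective line, is part of the data (\<open>h\<close>).\<close>

definition vanishing_spinorial_pair ::
  "'a::t2_space chart set \<Rightarrow> ('a \<Rightarrow> cp1) \<Rightarrow> ('a chart \<Rightarrow> cp1 chart \<Rightarrow> 'a \<Rightarrow> complex) \<Rightarrow> bool" where
  "vanishing_spinorial_pair A \<phi> h \<longleftrightarrow>
     riemann_surface A \<and> compact (UNIV :: 'a set) \<and>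
     holomorphic_map A cp1_atlas \<phi> \<and>
     tangent_pullback_iso_canonical A cp1_atlas \<phi> h"

text \<open>The component, in the chart \<open>c\<close>, of the 1-form on the surface that corresponds under
  \<open>h\<close> to the pullback of the vector field \<open>v\<close>. Where both charts of the
  projective line apply, they give the same value.\<close>

definition pullback_form ::
  "('a \<Rightarrow> cp1) \<Rightarrow> ('a chart \<Rightarrow> cp1 chart \<Rightarrow> 'a \<Rightarrow> complex) \<Rightarrow>
     (cp1 chart \<Rightarrow> cp1 \<Rightarrow> complex) \<Rightarrow> 'a chart \<Rightarrow> 'a \<Rightarrow> complex" where
  "pullback_form \<phi> h v c x =
     (let b = (if \<phi> x \<in> dom_of zeta_chart then zeta_chart else eta_chart)
      in h c b x * v b (\<phi> x))"

text \<open>A Hermitian metric \<open>i g dz \<and> cnj dz\<close> is given by its positive coefficient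
  \<open>g c\<close> in each chart. Since \<open>\<mu> = m dz\<close> gives
  \<open>i \<mu> \<and> cnj \<mu> = i |m|\<^sup>2 dz \<and> cnj dz\<close>, the reference metric is
  as follows.\<close>

definition spinorial_metric ::
  "('a \<Rightarrow> cp1) \<Rightarrow> ('a chart \<Rightarrow> cp1 chart \<Rightarrow> 'a \<Rightarrow> complex) \<Rightarrow> 'a chart \<Rightarrow> 'a \<Rightarrow> real" where
  "spinorial_metric \<phi> h c x =
     (cmod (pullback_form \<phi> h phi1 c x))\<^sup>2 +
     (cmod (pullback_form \<phi> h phi2 c x))\<^sup>2 +
     (cmod (pullback_form \<phi> h phi3 c x))\<^sup>2"

section \<open>Area measure, curvature and Laplacian of a metric\<close>

text \<open>The measure \<open>B \<mapsto> \<integral>\<^sub>B i g dz \<and> cnj dz\<close>. The factor 2 comes from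
  \<open>i dz \<and> cnj dz = 2 dx \<and> dy\<close>.\<close>

definition area_measure ::
  "'a::t2_space chart set \<Rightarrow> ('a chart \<Rightarrow> 'a \<Rightarrow> real) \<Rightarrow> 'a measure" where
  "area_measure A g = (THE M. sets M = sets borel \<and>
     (\<forall>c\<in>A. \<forall>B\<in>sets borel. B \<subseteq> dom_of c \<longrightarrow>
        emeasure M B =
          (\<integral>\<^sup>+ w \<in> coord c ` B. ennreal (2 * g c (inv_coord c w)) \<partial>lborel)))"

definition wirtinger_z :: "(complex \<Rightarrow> complex) \<Rightarrow> complex \<Rightarrow> complex" where
  "wirtinger_z F w =
     (frechet_derivative F (at w) 1 - \<i> * frechet_derivative F (at w) \<i>) / 2"

definition wirtinger_zbar :: "(complex \<Rightarrow> complex) \<Rightarrow> complex \<Rightarrow> complex" where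
  "wirtinger_zbar F w =
     (frechet_derivative F (at w) 1 + \<i> * frechet_derivative F (at w) \<i>) / 2"

text \<open>\<open>wirtinger_z\<close> after \<open>wirtinger_zbar\<close>, in the coordinate of \<open>c\<close>, of a
  real function \<open>u\<close>; the result is real, being a quarter of the Euclidean Laplacian.\<close>

definition ddbar :: "'a chart \<Rightarrow> ('a \<Rightarrow> real) \<Rightarrow> 'a \<Rightarrow> real" where
  "ddbar c u x =
     Re (wirtinger_z (wirtinger_zbar (\<lambda>w. complex_of_real (u (inv_coord c w)))) (coord c x))"

text \<open>Both of the following are independent of the chart around \<open>x\<close>.\<close>

definition laplacian :: "('a chart \<Rightarrow> 'a \<Rightarrow> real) \<Rightarrow> 'a chart \<Rightarrow> ('a \<Rightarrow> real) \<Rightarrow> 'a \<Rightarrow> real" where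
  "laplacian g c u x = inverse (g c x) * ddbar c u x"

definition gauss_curvature :: "('a chart \<Rightarrow> 'a \<Rightarrow> real) \<Rightarrow> 'a chart \<Rightarrow> 'a \<Rightarrow> real" where
  "gauss_curvature g c x = - inverse (g c x) * ddbar c (\<lambda>y. ln (g c y)) x"

section \<open>The flow\<close>

text \<open>Derivatives are taken within \<open>S\<close>, so for sets such as \<open>U \<times> {0..<T}\<close>
  with \<open>U\<close> open this means smoothness up to the boundary \<open>t = 0\<close>.\<close>

primrec Ck_on :: "nat \<Rightarrow> 'v::real_normed_vector set \<Rightarrow> ('v \<Rightarrow> 'w::real_normed_vector) \<Rightarrow> bool" where
  "Ck_on 0 S F \<longleftrightarrow> continuous_on S F"
| "Ck_on (Suc k) S F \<longleftrightarrow>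
     (\<exists>F'. (\<forall>x\<in>S. (F has_derivative F' x) (at x within S)) \<and>
           (\<forall>v. Ck_on k S (\<lambda>x. F' x v)))"

definition smooth_on :: "'v::real_normed_vector set \<Rightarrow> ('v \<Rightarrow> 'w::real_normed_vector) \<Rightarrow> bool" where
  "smooth_on S F \<longleftrightarrow> (\<forall>k. Ck_on k S F)"

definition smooth_on_spacetime ::
  "'a chart set \<Rightarrow> real \<Rightarrow> ('a \<Rightarrow> real \<Rightarrow> real) \<Rightarrow> bool" where
  "smooth_on_spacetime A T f \<longleftrightarrow>
     (\<forall>c\<in>A. smooth_on ((coord c ` dom_of c) \<times> {0..<T}) (\<lambda>(w, t). f (inv_coord c w) t))"

definition flow_equation ::
  "'a chart set \<Rightarrow> ('a chart \<Rightarrow> 'a \<Rightarrow> real) \<Rightarrow> real \<Rightarrow> real \<Rightarrow> ('a \<Rightarrow> real \<Rightarrow> real) \<Rightarrow> bool" where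
  "flow_equation A g \<alpha> T f \<longleftrightarrow>
     (\<forall>c\<in>A. \<forall>x\<in>dom_of c. \<forall>t\<in>{0..<T}.
        ((\<lambda>s. exp (f x s)) has_real_derivative
           laplacian g c
             (\<lambda>y. exp (f y t) + \<alpha> / 2 * gauss_curvature g c y * exp (- f y t)) x
           - gauss_curvature g c x *
             (exp (f x t) + \<alpha> / 2 * gauss_curvature g c x * exp (- f x t)))
        (at t within {0..<T}))"

end

theory Submission
  imports Defs
begin

text \<open>Write \<open>u = e\<^sup>f\<close>, \<open>k = - \<kappa> \<ge> 0\<close> and \<open>q = \<alpha> k / 2 \<ge> 0\<close>. The flow becomes
  \<open>\<partial>\<^sub>t u = \<Delta> v + k v\<close> with \<open>v = u - q / u\<close>. Since \<open>\<nabla>v = (1 + q / u\<^sup>2) \<nabla>u - \<nabla>q / u\<close>, the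
  singular term only improves the ellipticity, and for \<open>s \<ge> 5\<close> the error it causes when the equation
  is tested with \<open>u\<^bsup>s-1\<^esup>\<close> is bounded by \<open>1 + u\<^sup>s\<close>. Cover the surface by finitely many coordinate squares
  with cutoffs \<open>\<rho>\<^sub>i\<close> and put \<open>Y\<^sub>s = \<Sum>\<^sub>i \<integral> \<rho>\<^sub>i u\<^sup>s\<close>. The \<open>\<rho>\<^sub>i\<close> need not sum to one: the errors
  from differentiating them are integrals of \<open>u\<^sup>s\<close> over a square, and these are bounded by \<open>Y\<^sub>s\<close>
  because the half squares already cover the surface. With the Sobolev inequality
  \<open>\<integral> w\<^sup>2 \<le> \<integral> \<bar>w\<^sub>x\<bar> \<integral> \<bar>w\<^sub>y\<bar>\<close> for \<open>w = \<rho> u\<^bsup>3p\<^esup>\<close> the energy estimate for \<open>s = 5 p\<close> gives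
  \<open>Y\<^bsub>5p\<^esub>' \<le> - c p\<^bsup>-2\<^esup> (Y\<^bsub>5p\<^esub> / Y\<^sub>p)\<^bsup>5/4\<^esup> + C p\<^sup>2 (Y\<^bsub>5p\<^esub> + 1)\<close>. Solving this on time windows of length
  of order \<open>p\<^bsup>-2\<^esup>\<close> bounds \<open>Y\<^bsub>5p\<^esub>\<close> by the fifth power of a time integral of \<open>Y\<^sub>p\<close>, whatever the
  initial value; iterating over \<open>p = 5\<^sup>k\<close>, starting from the space-time integral of \<open>u\<close>, bounds
  \<open>u\<close> itself. The passage \<open>p \<rightarrow> 5 p\<close> keeps all exponents natural and avoids small \<open>s\<close>.\<close>

section \<open>Iteration of the differential inequality\<close>

text \<open>Cauchy-Schwarz splits the gradient of \<open>w\<close> by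
  \<open>2 * (3p - 1) = p + (5p - 2)\<close>, so the Sobolev inequality bounds the integral of
  \<open>u^(6p)\<close> by \<open>Y_p\<close> times the Dirichlet term of the energy estimate at
  exponent \<open>5p\<close>. The pointwise inequality \<open>X^5 <= l^4 * X + X^6 / l\<close> with
  \<open>X = u^p\<close> leads back from \<open>6p\<close> to \<open>5p\<close>. The free parameter
  \<open>l > 0\<close> keeps each of these estimates linear in the integrals of order
  \<open>5p\<close> and \<open>6p\<close>; only its final choice, \<open>l^4\<close> comparable to
  \<open>Y_(5p) / Y_p\<close>, produces the power 5/4. On the geometric side the data are given
  implicitly: the curvature by second derivatives of a metric, the area measure by a definite
  description. An explicit formula in holomorphic data shows that the curvature is smooth and
  nonpositive; the measure is constructed and shown to be unique. Independence of the solution is a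
  matter of quantifier order: the covering, the bounds on curvature and weights and all constants
  are fixed before \<open>f\<close> is introduced.\<close>

lemma powr_tangent:
  fixes F \<mu> :: real
  assumes "F > 0" "\<mu> > 0"
  shows "\<mu> powr (-5/4) * (9/4 - 5/4 * (F / \<mu>)) \<le> F powr (-5/4)"
proof -
  \<comment> \<open>In \<open>F / \<mu>\<close> this is the tangent at 1 of the convex function
    \<open>x powr (-5/4)\<close>; it follows from \<open>ln x \<le> x - 1\<close> and
    \<open>1 + z \<le> exp z\<close>.\<close>
  have "9/4 - 5/4 * (F/\<mu>) \<le> 1 + (-5/4) * ln (F/\<mu>)"
    using ln_le_minus_one[of "F/\<mu>"] assms by simp
  also have "\<dots> \<le> exp ((-5/4) * ln (F/\<mu>))" by (rule exp_ge_add_one_self)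
  also have "\<dots> = (F/\<mu>) powr (-5/4)" using assms by (simp add: powr_def)
  finally have "\<mu> powr (-5/4) * (9/4 - 5/4 * (F / \<mu>)) \<le> \<mu> powr (-5/4) * (F/\<mu>) powr (-5/4)"
    by (intro mult_left_mono) auto
  also have "\<dots> = F powr (-5/4)" using assms by (simp flip: powr_mult)
  finally show ?thesis .
qed

text \<open>The inequality holds for every \<open>l\<close>, so it may be optimised. The maximum of
  \<open>l * y - l^5 * F\<close> lies at \<open>l^4 = y / (5 * F)\<close>; the choice
  \<open>l^4 = y / (4 * F)\<close> is nearly as good and leaves exactly \<open>3/4 * l * y\<close>.
  Since \<open>F \<ge> 1\<close>, the lower order terms fit into \<open>k * y\<close>.\<close>

lemma nash_rate:
  fixes y F k :: real
  assumes y: "y \<ge> 1" and F: "F \<ge> 1" and k: "k \<ge> 1" and E: "0 < E" "E \<le> F"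
    and ineq: "\<And>l. l > 0 \<Longrightarrow> d \<le> - (l * (y - 1) - l^5 * E) / (k * E) + k * y"
  shows "d \<le> - (1 / (2 * k)) * (y powr (5/4) * F powr (-5/4)) + 2 * k * y"
proof -
  define l where "l = (y / (4 * F)) powr (1/4)"
  have lpos: "l > 0" using y F by (simp add: l_def)
  have l4: "l^4 = y / (4 * F)"
    using y F unfolding l_def by (simp add: powr_power)
  \<comment> \<open>Serves to absorb the stray term \<open>l / F\<close> that arises because the
    hypothesis contains \<open>y - 1\<close> instead of \<open>y\<close>.\<close>
  have ly: "l \<le> y"
  proof (rule power_le_imp_le_base[of _ 3])
    have "y / (4*F) \<le> y" using y F by (simp add: field_simps)
    also have "y \<le> y^4" using y self_le_power[of y 4] by simp
    finally show "l ^ Suc 3 \<le> y ^ Suc 3" using l4 by simp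
  qed (use y in simp)
  have l5: "l^5 = l * (y / (4*F))" using l4 by (metis mult.commute power_Suc numeral_eq_Suc pred_numeral_simps(3) power_Suc2 eval_nat_numeral(3) semiring_norm(28) numeral_plus_one Suc_eq_plus1)
  have "d \<le> - (l * (y - 1) - l^5 * E) / (k * E) + k * y" by (rule ineq[OF lpos])
  also have "- (l * (y - 1) - l^5 * E) / (k * E) = (l^5 - l * (y - 1) / E) / k"
    using E k by (simp add: field_simps)
  also have "\<dots> \<le> (l^5 - l * (y - 1) / F) / k"
    using E k y F lpos by (intro divide_right_mono diff_left_mono divide_left_mono) auto
  also have "l^5 - l * (y - 1) / F = l / F - (3/4) * (l * y / F)"
    using F by (simp add: l5 field_simps)
  also have "(l / F - (3/4) * (l * y / F)) / k + k * y \<le> (y - (3/4) * (l * y / F)) / k + k * y"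
  proof -
    have "l / F \<le> l / 1" using F lpos by (intro divide_left_mono) auto
    then have "l / F \<le> y" using ly by simp
    then show ?thesis using k by (intro add_right_mono divide_right_mono) auto
  qed
  also have "\<dots> \<le> - (3/4) * (l * y / F) / k + 2 * k * y"
  proof -
    have "y / k \<le> y / 1" using k y by (intro divide_left_mono) auto
    also have "y / 1 \<le> k * y" using k y by simp
    finally show ?thesis by (simp add: diff_divide_distrib)
  qed
  also have "- (3/4) * (l * y / F) / k \<le> - (1 / (2 * k)) * (y powr (5/4) * F powr (-5/4))"
  proof -
    have "l = (y / F) powr (1/4) * (1/4) powr (1/4)"
      using y F unfolding l_def by (simp add: mult.commute flip: powr_mult)
    \<comment> \<open>The rational bound 2/3 turns the coefficient 3/4 into 1/2.\<close>
    moreover have "(1/4) powr (1/4) \<ge> (2/3::real)"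
    proof -
      have "(2/3::real) = ((2/3)^4) powr (1/4)" by (simp add: powr_powr flip: powr_numeral)
      also have "\<dots> \<le> (1/4) powr (1/4)" by (intro powr_mono2) (auto simp: power4_eq_xxxx)
      finally show ?thesis .
    qed
    ultimately have "l \<ge> (y / F) powr (1/4) * (2/3)" by (metis mult_left_mono powr_ge_zero)
    then have "(3/4) * (l * y / F) \<ge> (3/4) * ((y / F) powr (1/4) * (2/3) * y / F)"
      using y F by (intro mult_left_mono divide_right_mono mult_right_mono) auto
    also have "(3/4) * ((y / F) powr (1/4) * (2/3) * y / F) = 1/2 * ((y / F) powr (1/4) * (y / F) powr 1)"
      using y F by simp
    also have "(y / F) powr (1/4) * (y / F) powr 1 = (y/F) powr (5/4)"
      by (simp only: powr_add[symmetric]) simp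
    also have "(y/F) powr (5/4) = y powr (5/4) * F powr (-5/4)"
      using y F by (simp add: powr_divide powr_minus_divide)
    finally show ?thesis using k by (simp add: field_simps)
  qed
  finally show ?thesis by simp
qed

text \<open>No initial value enters: \<open>(Y + 1)\<^bsup>-1/4\<^esup>\<close> grows at least like \<open>F\<^bsup>-5/4\<^esup>\<close> with \<open>F = E + 1\<close>, and the
  tangent to \<open>F\<^bsup>-5/4\<^esup>\<close> at the mean value of \<open>F\<close> reduces this to the integral of \<open>F\<close>.\<close>

lemma nash_ode:
  fixes Y Y' E :: "real \<Rightarrow> real"
  assumes l: "0 < l" and k: "k \<ge> 1" and B: "B > 0"
    and dY: "\<And>t. t \<in> {a..a+l} \<Longrightarrow> (Y has_real_derivative Y' t) (at t within {a..a+l})"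
    and Y: "\<And>t. t \<in> {a..a+l} \<Longrightarrow> Y t \<ge> 0"
    and E: "\<And>t. t \<in> {a..a+l} \<Longrightarrow> E t > 0"
    and contE: "continuous_on {a..a+l} E"
    and ineq: "\<And>t c. t \<in> {a..a+l} \<Longrightarrow> c > 0 \<Longrightarrow>
       Y' t \<le> - (c * Y t - c^5 * E t) / (k * E t) + k * (Y t + 1)"
    and int: "integral {a..a+l} (\<lambda>t. E t + 1) \<le> B"
  shows "Y (a+l) + 1 \<le> exp (2*k*l) * (8*k)^4 * B^5 / l^9"
proof -
  \<comment> \<open>An upper bound for the mean of \<open>F\<close> over the window; the tangent to
    \<open>F powr (-5/4)\<close> is taken at this value.\<close>
  define m where "m = B / l"
  have m: "m > 0" using B l by (simp add: m_def)
  define y where "y = (\<lambda>t. Y t + 1)"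
  define F where "F = (\<lambda>t. E t + 1)"
  have y1: "y t \<ge> 1" if "t \<in> {a..a+l}" for t using Y[OF that] by (simp add: y_def)
  have F1: "F t \<ge> 1" if "t \<in> {a..a+l}" for t using E[OF that] by (simp add: F_def)
  have contF: "continuous_on {a..a+l} F" unfolding F_def by (intro continuous_intros contE)
  define Z where "Z = (\<lambda>t. y t powr (-1/4))"
  \<comment> \<open>The exponential is the integrating factor for the growth term
    \<open>2 * k * y\<close>, which costs the derivative of \<open>Z\<close> an amount
    \<open>k / 2 * Z\<close>. The subtracted part is the integral of the tangent lower bound for
    \<open>1 / (8 * k) * F powr (-5/4)\<close>.\<close>
  define W where "W = (\<lambda>t. exp (k/2 * (t - a)) * Z t
      - 1/(8*k) * m powr (-5/4) * (9/4 * (t - a) - 5/4 * (integral {a..t} F / m)))"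
  have dZ: "(Z has_real_derivative (-1/4 * y t powr (-5/4) * Y' t)) (at t within {a..a+l})"
    if t: "t \<in> {a..a+l}" for t
  proof -
    have "(y has_real_derivative Y' t) (at t within {a..a+l})"
      unfolding y_def by (auto intro!: derivative_eq_intros dY t)
    moreover have "((\<lambda>x. x powr (-1/4)) has_real_derivative (-1/4) * y t powr (-1/4 - 1)) (at (y t))"
      using y1[OF t] by (intro has_real_derivative_powr) auto
    ultimately have "((\<lambda>t. (y t) powr (-1/4)) has_real_derivative (-1/4) * y t powr (-1/4 - 1) * Y' t) (at t within {a..a+l})"
      by (rule DERIV_chain2[rotated])
    then show ?thesis unfolding Z_def by simp
  qed
  have dF: "((\<lambda>t. integral {a..t} F) has_real_derivative F t) (at t within {a..a+l})" if "t \<in> {a..a+l}" for t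
    using integral_has_real_derivative[OF contF that] .
  have dW: "(W has_real_derivative (exp (k/2 * (t - a)) * (k/2 * Z t - 1/4 * y t powr (-5/4) * Y' t)
      - 1/(8*k) * m powr (-5/4) * (9/4 - 5/4 * (F t / m)))) (at t within {a..a+l})"
    if t: "t \<in> {a..a+l}" for t
    unfolding W_def using m k by (auto intro!: derivative_eq_intros dZ dF t simp: algebra_simps)
  have nonneg: "exp (k/2 * (t - a)) * (k/2 * Z t - 1/4 * y t powr (-5/4) * Y' t)
      - 1/(8*k) * m powr (-5/4) * (9/4 - 5/4 * (F t / m)) \<ge> 0" if t: "t \<in> {a..a+l}" for t
  proof -
    have Yt: "Y' t \<le> - (1 / (2 * k)) * (y t powr (5/4) * F t powr (-5/4)) + 2 * k * y t"
      using ineq[OF t] by (intro nash_rate[OF y1[OF t] F1[OF t] k E[OF t]]) (auto simp: F_def y_def)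
    have "y t powr (-5/4) * Y' t \<le> y t powr (-5/4) * (- (1 / (2 * k)) * (y t powr (5/4) * F t powr (-5/4)) + 2 * k * y t)"
      by (intro mult_left_mono Yt) auto
    also have "\<dots> = - (1/(2*k)) * F t powr (-5/4) * (y t powr (-5/4) * y t powr (5/4)) + 2*k * (y t powr (-5/4) * y t powr 1)"
      using y1[OF t] by (simp add: algebra_simps)
    also have "\<dots> = - (1/(2*k)) * F t powr (-5/4) + 2 * k * Z t"
      using y1[OF t] unfolding powr_add[symmetric] Z_def by simp
    finally have "k/2 * Z t - 1/4 * y t powr (-5/4) * Y' t \<ge> 1/(8*k) * F t powr (-5/4)" by simp
    moreover have "exp (k/2 * (t - a)) \<ge> 1" using k t by simp
    moreover have p: "1/(8*k) * F t powr (-5/4) \<ge> 0" using k by simp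
    ultimately have "exp (k/2 * (t - a)) * (k/2 * Z t - 1/4 * y t powr (-5/4) * Y' t) \<ge> 1 * (1/(8*k) * F t powr (-5/4))"
      by (intro mult_mono) auto
    moreover have "1/(8*k) * (m powr (-5/4) * (9/4 - 5/4 * (F t / m))) \<le> 1/(8*k) * F t powr (-5/4)"
      using k m F1[OF t] by (intro mult_left_mono powr_tangent) auto
    ultimately show ?thesis by simp
  qed
  have "W a \<le> W (a+l)"
  proof (rule DERIV_nonneg_imp_increasing_open[of a "a + l" W])
    show "a \<le> a + l" using l by simp
    fix t assume t: "a < t" "t < a + l"
    then have t': "t \<in> {a..a+l}" by simp
    show "\<exists>y. DERIV W t :> y \<and> y \<ge> 0"
      using dW[OF t'] nonneg[OF t'] at_within_Icc_at[of a t "a+l"] t by metis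
  next
    show "continuous_on {a..a+l} W"
      by (rule DERIV_continuous_on) (rule dW)
  qed
  \<comment> \<open>Here the initial value disappears: \<open>Z a\<close> is nonnegative however
    large \<open>Y a\<close> is.\<close>
  moreover have "W a \<ge> 0" by (simp add: W_def Z_def)
  ultimately have "exp (k/2 * l) * Z (a+l) \<ge> 1/(8*k) * m powr (-5/4) * (9/4 * l - 5/4 * (integral {a..a+l} F / m))"
    by (simp add: W_def)
  moreover have "integral {a..a+l} F / m \<le> l"
    using int B l by (simp add: m_def F_def field_simps)
  then have "1/(8*k) * m powr (-5/4) * (9/4 * l - 5/4 * (integral {a..a+l} F / m)) \<ge> 1/(8*k) * m powr (-5/4) * l"
    using k by (intro mult_left_mono) auto
  ultimately have "1/(8*k) * m powr (-5/4) * l \<le> exp (k/2 * l) * Z (a+l)" by linarith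
  then have "(1/(8*k) * m powr (-5/4) * l)^4 \<le> (exp (k/2 * l) * Z (a+l))^4"
    using k l by (intro power_mono) auto
  moreover have "(Z (a+l))^4 = 1 / y (a+l)"
    using y1[of "a+l"] l unfolding Z_def by (simp add: powr_power powr_minus_divide power_divide)
  moreover have "(m powr (-5/4))^4 = l^5 / B^5"
  proof -
    have "(m powr (-5/4))^4 = m powr (-5)" using m by (simp add: powr_power)
    also have "\<dots> = 1 / m^5" using m by (simp add: powr_minus_divide)
    finally show ?thesis by (simp add: m_def power_divide)
  qed
  moreover have "exp (k/2 * l)^4 = exp (2*k*l)" by (simp flip: exp_of_nat_mult)
  ultimately have "(1/(8*k))^4 * (l^5 / B^5) * l^4 \<le> exp (2*k*l) / y (a+l)"
    by (simp only: power_mult_distrib times_divide_eq_right mult_1_right)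
  then have "y (a+l) \<le> exp (2*k*l) / ((1/(8*k))^4 * (l^5 / B^5) * l^4)"
    using y1[of "a+l"] l k B by (simp add: field_simps)
  also have "\<dots> = exp (2*k*l) * (8*k)^4 * B^5 / l^9"
  proof -
    have "l^9 = l^5*l^4" by (simp flip: power_add)
    then show ?thesis using k l B by (simp add: field_simps)
  qed
  finally show ?thesis by (simp add: y_def)
qed


text \<open>Each use of \<open>nash_ode\<close>, at \<open>p = 5^k\<close>, takes the fifth power of
  the previous bound and multiplies it by a factor growing geometrically in \<open>k\<close>. After
  roots of order \<open>5^k\<close> the product of these factors converges, so one base
  \<open>L\<close>, linear in \<open>B\<close>, serves all \<open>k\<close>.\<close>

lemma moser_iteration:
  fixes Y Y' :: "nat \<Rightarrow> real \<Rightarrow> real"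
  assumes T: "0 < T0" and K: "K \<ge> 1" and B: "B \<ge> 1"
    and dY: "\<And>m t. m \<ge> 1 \<Longrightarrow> t \<in> {0..<T} \<Longrightarrow> (Y m has_real_derivative Y' m t) (at t within {0..<T})"
    and pos: "\<And>m t. t \<in> {0..<T} \<Longrightarrow> Y m t > 0"
    and ineq: "\<And>p t c. p \<ge> 1 \<Longrightarrow> t \<in> {0..<T} \<Longrightarrow> c > 0 \<Longrightarrow>
       Y' (5*p) t \<le> - (c * Y (5*p) t - c^5 * Y p t) / (K * (real p)^2 * Y p t) + K * (real p)^2 * (Y (5*p) t + 1)"
    and init: "\<And>t. t \<in> {0..<T} \<Longrightarrow> integral {0..t} (\<lambda>s. Y 1 s + 1) \<le> B"
    and L: "L = 25 * (1 + exp (K * T0) * (8*K)^4 * (2/T0)^9 * (1 + T0)) * B"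
    and t: "T0 \<le> t" "t < T"
  shows "Y (5 ^ Suc k) t \<le> L ^ (5 ^ Suc k)"
proof -
  define C0 where "C0 = exp (K * T0) * (8*K)^4 * (2/T0)^9"
  \<comment> \<open>Dominates both \<open>C0\<close>, the factor of the pointwise bound, and
    \<open>T0 * C0\<close>, the factor after integration over a window of length at most
    \<open>T0\<close>.\<close>
  define c where "c = 1 + C0 * (1 + T0)"
  have C0: "C0 > 0" using T K by (simp add: C0_def)
  have c1: "c \<ge> 1" using C0 T by (simp add: c_def)
  have c4: "c \<le> c^4" using c1 self_le_power[of c 4] by simp
  have cC: "C0 \<le> c^4" "T0 * C0 \<le> c^4"
  proof -
    have "C0 \<le> c" "T0 * C0 \<le> c" using C0 T by (auto simp: c_def algebra_simps)
    then show "C0 \<le> c^4" "T0 * C0 \<le> c^4" using c4 by auto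
  qed
  have Lc: "L = 25 * c * B" by (simp add: L c_def C0_def)
  have L1: "L \<ge> 1"
    using mult_mono[of 1 c 1 B] c1 B by (simp add: Lc)
  \<comment> \<open>On windows of length \<open>l k\<close> the rate \<open>K p\<^sup>2\<close> with \<open>p = 5\<^sup>k\<close> contributes the constant factor
    \<open>exp (K * T0)\<close>; the bounds \<open>b k\<close> solve \<open>b (Suc k) = c^4 * 25^(16*k) * b k ^ 5\<close>.\<close>
  define l where "l = (\<lambda>k::nat. T0 / 2 / 25^k)"
  define b where "b = (\<lambda>k::nat. L ^ (5^k) / (c * 25^(4*k+1)))"
  define s where "s = (\<lambda>k::nat. \<Sum>j<k. l j)"
  have l: "l k > 0" "l k \<le> T0" for k
  proof -
    show "l k > 0" using T by (simp add: l_def)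
    have "(1::real) \<le> 25^k" by simp
    then have "1 \<le> 2 * (25::real)^k" by linarith
    then have "T0 * 1 \<le> T0 * (2 * 25^k)" using T by (intro mult_left_mono) auto
    then show "l k \<le> T0" by (simp add: l_def field_simps)
  qed
  have s0: "s k \<ge> 0" for k unfolding s_def using l by (intro sum_nonneg) (auto intro: less_imp_le)
  have sS: "s (Suc k) = s k + l k" for k by (simp add: s_def)
  \<comment> \<open>Geometric series: all windows together use less than \<open>25/48 * T0\<close>
    of the time, so every stage is complete at time \<open>T0\<close>.\<close>
  have s: "s k \<le> T0" for k
  proof -
    have "s k = T0 / 2 * (25/24) * (1 - 1/25^k)"
    proof (induction k)
      case (Suc k)
      have "s (Suc k) = T0 / 2 * (25/24) * (1 - 1/25^k) + T0 / 2 / 25^k"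
        using Suc by (simp only: sS) (simp add: l_def)
      then show ?case by (simp add: field_simps)
    qed (simp add: s_def)
    also have "\<dots> \<le> T0 / 2 * (25/24) * 1" using T by (intro mult_left_mono) auto
    also have "\<dots> \<le> T0" using T by simp
    finally show ?thesis .
  qed
  have b0: "b k > 0" for k using L1 c1 by (simp add: b_def)
  have bS: "c^4 * 25^(13*k) * b k ^ 5 \<le> b (Suc k)" for k
  proof -
    have b5: "b k ^ 5 = L ^ (5 ^ Suc k) / (c^5 * 25^(20*k+5))"
    proof -
      have "20*k+5 = (4*k+1)*5" by simp
      then have "(25::real)^(20*k+5) = (25^(4*k+1))^5" by (simp only: power_mult)
      moreover have "L ^ (5 ^ Suc k) = (L ^ (5^k))^5" by (simp add: mult.commute flip: power_mult)
      ultimately show ?thesis by (simp only: b_def power_divide power_mult_distrib)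
    qed
    \<comment> \<open>The window estimate yields \<open>25^(13*k)\<close>; enlarging it to
      \<open>25^(16*k)\<close> gives the recursion that \<open>b\<close> solves exactly.\<close>
    have "c^4 * 25^(13*k) * b k ^ 5 \<le> c^4 * 25^(16*k) * b k ^ 5"
      using c1 b0[of k] by (intro mult_right_mono mult_left_mono power_increasing) auto
    also have "c^4 * 25^(16*k) * b k ^ 5 = c^4 * 25^(16*k) * (L ^ (5 ^ Suc k) / (c^5 * 25^(20*k+5)))"
      by (simp only: b5)
    also have "c^4 * 25^(16*k) * (L ^ (5 ^ Suc k) / (c^5 * 25^(20*k+5))) = L ^ (5 ^ Suc k) / (c * 25 ^(4*k+5))"
    proof -
      have "c^5 * (25::real)^(20*k+5) = (c^4 * 25^(16*k)) * (c * 25^(4*k+5))"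
        by (simp add: power_add[symmetric] numeral_eq_Suc)
      moreover have "X * (Z / (X * Y)) = Z / Y" if "X \<noteq> 0" for X Y Z :: real using that by simp
      moreover have "c^4 * (25::real)^(16*k) \<noteq> 0" using c1 by simp
      ultimately show ?thesis by metis
    qed
    also have "\<dots> = b (Suc k)"
    proof -
      have "4 * Suc k + 1 = 4*k+5" by simp
      then show ?thesis by (simp only: b_def)
    qed
    finally show ?thesis .
  qed
  have contY: "continuous_on {0..<T} (Y m)" if "m \<ge> 1" for m
    by (rule DERIV_continuous_on) (rule dY[OF that])
  have step: "Y (5 ^ Suc k) t + 1 \<le> C0 * 25^(13*k) * b k ^ 5"
    if IH: "\<And>t. s k + l k \<le> t \<Longrightarrow> t < T \<Longrightarrow> integral {t - l k..t} (\<lambda>t. Y (5^k) t + 1) \<le> b k"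
      and t: "s (Suc k) \<le> t" "t < T" for k t
  proof -
    have sub: "{t - l k..t} \<subseteq> {0..<T}" using s0[of k] t sS[of k] by auto
    define p where "p = (5::nat)^k"
    have p: "p \<ge> 1" by (simp add: p_def)
    define q where "q = K * (real p)^2"
    have p25: "(real p)^2 = 25^k" by (simp add: p_def power2_eq_square flip: power_mult_distrib)
    have q: "q \<ge> 1" using mult_mono[of 1 K 1 "(25::real)^k"] K by (simp add: q_def p25)
    have "Y (5*p) ((t - l k) + l k) + 1 \<le> exp (2*q*l k) * (8*q)^4 * b k^5 / l k^9"
    proof (rule nash_ode[where Y' = "Y' (5*p)" and E = "Y p"])
      fix r assume r: "r \<in> {t - l k..t - l k + l k}"
      then have r': "r \<in> {0..<T}" using sub by auto
      show "(Y (5*p) has_real_derivative Y' (5*p) r) (at r within {t - l k..t - l k + l k})"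
        by (rule DERIV_subset[OF dY[OF _ r']]) (use p sub in auto)
      show "Y (5*p) r \<ge> 0" "Y p r > 0" using pos[OF r', of p] pos[OF r', of "5*p"] by auto
      fix d :: real assume "d > 0"
      then show "Y' (5*p) r \<le> - (d * Y (5*p) r - d^5 * Y p r) / (q * Y p r) + q * (Y (5*p) r + 1)"
        using ineq[OF p r'] by (simp add: q_def)
    next
      show "continuous_on {t - l k..t - l k + l k} (Y p)"
        using continuous_on_subset[OF contY[OF p] sub] by simp
      show "integral {t - l k..t - l k + l k} (\<lambda>t. Y p t + 1) \<le> b k"
        using IH[of t] t sS[of k] by (simp add: p_def)
    qed (use l q b0 in auto)
    also have "exp (2*q*l k) * (8*q)^4 * b k^5 / l k^9 = C0 * 25^(13*k) * b k ^ 5"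
    proof -
      have "2*q*l k = K * T0" by (simp add: q_def p25 l_def)
      \<comment> \<open>13 = 4 + 9: the rate enters through \<open>(8*q)^4\<close> and the window
        length through \<open>l k^9\<close> in the denominator.\<close>
      moreover have "(25::real)^(13*k) = (25^k)^4 * (25^k)^9" by (simp flip: power_mult power_add)
      ultimately show ?thesis using T by (simp add: C0_def q_def p25 l_def field_simps)
    qed
    finally show ?thesis by (simp add: p_def)
  qed
  have main: "integral {t - l k..t} (\<lambda>t. Y (5^k) t + 1) \<le> b k" if "s k + l k \<le> t" "t < T" for k t
    using that
  proof (induction k arbitrary: t)
    case 0
    have t0: "0 \<le> t - l 0" "t \<in> {0..<T}" using 0 l[of 0] by (auto simp: s_def)
    have ct: "continuous_on {0..t} (\<lambda>s. Y 1 s + 1)"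
      using t0 by (intro continuous_intros continuous_on_subset[OF contY]) auto
    have nn: "0 \<le> Y 1 x + 1" if "x \<in> {0..t}" for x
      using pos[of x 1] t0 that by simp
    have "integral {t - l 0..t} (\<lambda>s. Y 1 s + 1) \<le> integral {0..t} (\<lambda>s. Y 1 s + 1)"
    proof (rule integral_subset_le)
      show "(\<lambda>s. Y 1 s + 1) integrable_on {t - l 0..t}"
        using t0 by (intro integrable_continuous_real continuous_on_subset[OF ct]) auto
      show "(\<lambda>s. Y 1 s + 1) integrable_on {0..t}"
        by (intro integrable_continuous_real ct)
    qed (use t0 nn in auto)
    also have "\<dots> \<le> B" using init t0 by blast
    also have "B = b 0" using c1 by (simp add: b_def Lc)
    finally show ?case by simp
  next
    case (Suc k)
    have "integral {t - l (Suc k)..t} (\<lambda>t. Y (5^Suc k) t + 1) \<le> integral {t - l (Suc k)..t} (\<lambda>_. C0 * 25^(13*k) * b k ^ 5)"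
    proof (rule integral_le)
      show "(\<lambda>t. Y (5^Suc k) t + 1) integrable_on {t - l (Suc k)..t}"
        using Suc.prems s0[of "Suc k"]
        by (intro integrable_continuous_real continuous_intros continuous_on_subset[OF contY]) auto
      show "Y (5^Suc k) r + 1 \<le> C0 * 25^(13*k) * b k ^ 5" if "r \<in> {t - l (Suc k)..t}" for r
        using Suc that by (intro step) auto
    qed auto
    also have "\<dots> = l (Suc k) * (C0 * 25^(13*k) * b k ^ 5)" using l[of "Suc k"] by simp
    also have "\<dots> \<le> T0 * (C0 * 25^(13*k) * b k ^ 5)"
      using l C0 b0[of k] by (intro mult_right_mono) auto
    also have "\<dots> = (T0 * C0) * 25^(13*k) * b k ^ 5" by simp
    also have "\<dots> \<le> c^4 * 25^(13*k) * b k ^ 5" using cC b0[of k] by (intro mult_right_mono) auto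
    also have "\<dots> \<le> b (Suc k)" by (rule bS)
    finally show ?case .
  qed
  have "Y (5 ^ Suc k) t + 1 \<le> C0 * 25^(13*k) * b k ^ 5"
    by (intro step main) (use t s[of "Suc k"] in auto)
  also have "\<dots> \<le> c^4 * 25^(13*k) * b k ^ 5" using cC b0[of k] by (intro mult_right_mono) auto
  also have "\<dots> \<le> b (Suc k)" by (rule bS)
  also have "\<dots> \<le> L ^ (5 ^ Suc k) / 1"
    unfolding b_def using L1 c1 mult_mono[of 1 c 1 "25^(4 * Suc k + 1)::real"] by (intro divide_left_mono) auto
  finally show ?thesis by simp
qed

section \<open>Energy and Sobolev estimates on a square\<close>

definition unit_square :: "(real \<times> real) set" where
  "unit_square = cbox (-1, -1) (1, 1)"

lemma has_integral_unit_square: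
  fixes F :: "real \<times> real \<Rightarrow> real"
  assumes "continuous_on unit_square F"
  shows "(F has_integral integral unit_square F) unit_square"
  using assms by (simp add: unit_square_def integrable_integral integrable_continuous)

lemma integrable_unit_square:
  fixes F :: "real \<times> real \<Rightarrow> real"
  assumes "continuous_on unit_square F"
  shows "F integrable_on unit_square"
  using has_integral_unit_square[OF assms] by (rule has_integral_integrable)

lemma has_integral_unit_square_const:
  "((\<lambda>_. c) has_integral 4 * c) unit_square" for c :: real
  using has_integral_const[of c "(-1, -1)" "(1, 1) :: real \<times> real"]
  by (simp add: unit_square_def content_Pair)

lemmas has_integral_unit_square_intros =
  has_integral_add has_integral_diff has_integral_neg has_integral_mult_right
  has_integral_unit_square_const has_integral_unit_square

text \<open>A relation between a function and its derivative in one direction, both continuous up to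
  the edges: this is the form in which Fubini and the fundamental theorem are applied. Second
  derivatives are expressed by iterating it, as in \<open>partial_x vx vxx\<close>.\<close>

definition partial_x :: "(real \<times> real \<Rightarrow> real) \<Rightarrow> (real \<times> real \<Rightarrow> real) \<Rightarrow> bool" where
  "partial_x F Fx \<longleftrightarrow> continuous_on unit_square F \<and> continuous_on unit_square Fx \<and>
     (\<forall>x\<in>{-1..1}. \<forall>y\<in>{-1..1}. ((\<lambda>s. F (s, y)) has_real_derivative Fx (x, y)) (at x within {-1..1}))"

definition partial_y :: "(real \<times> real \<Rightarrow> real) \<Rightarrow> (real \<times> real \<Rightarrow> real) \<Rightarrow> bool" where
  "partial_y F Fy \<longleftrightarrow> continuous_on unit_square F \<and> continuous_on unit_square Fy \<and>
     (\<forall>x\<in>{-1..1}. \<forall>y\<in>{-1..1}. ((\<lambda>s. F (x, s)) has_real_derivative Fy (x, y)) (at y within {-1..1}))"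

definition vanishes_on_boundary :: "(real \<times> real \<Rightarrow> real) \<Rightarrow> bool" where
  "vanishes_on_boundary F \<longleftrightarrow>
     (\<forall>s\<in>{-1..1}. F (-1, s) = 0 \<and> F (1, s) = 0 \<and> F (s, -1) = 0 \<and> F (s, 1) = 0)"

lemma unit_square_iff: "(x, y) \<in> unit_square \<longleftrightarrow> x \<in> {-1..1} \<and> y \<in> {-1..1}"
  by (auto simp: unit_square_def cbox_Pair_iff cbox_interval)

lemma integral_unit_square:
  fixes F :: "real \<times> real \<Rightarrow> real"
  assumes "continuous_on unit_square F"
  shows "integral unit_square F = integral {-1..1} (\<lambda>x. integral {-1..1} (\<lambda>y. F (x, y)))"
    "integral unit_square F = integral {-1..1} (\<lambda>y. integral {-1..1} (\<lambda>x. F (x, y)))"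
proof -
  show 1: "integral unit_square F = integral {-1..1} (\<lambda>x. integral {-1..1} (\<lambda>y. F (x, y)))"
    using integral_prod_continuous[of "-1" "-1" 1 1 F] assms
    by (simp add: unit_square_def cbox_interval)
  then show "integral unit_square F = integral {-1..1} (\<lambda>y. integral {-1..1} (\<lambda>x. F (x, y)))"
    using integral_swap_continuous[of "-1" "-1" 1 1 "\<lambda>x y. F (x, y)"] assms
    by (simp add: unit_square_def cbox_interval)
qed

lemma continuous_on_slice:
  assumes "continuous_on unit_square F"
  shows "y \<in> {-1..1} \<Longrightarrow> continuous_on {-1..1} (\<lambda>x. F (x, y))"
    "x \<in> {-1..1} \<Longrightarrow> continuous_on {-1..1} (\<lambda>y. F (x, y))"
  by (rule continuous_on_compose2[OF assms]; auto intro!: continuous_intros simp: unit_square_iff)+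

section \<open>Vanishing boundary terms and the planar Sobolev inequality\<close>

lemma integral_partial_x_eq_0:
  assumes F: "partial_x F Fx" and "vanishes_on_boundary F"
  shows "integral unit_square Fx = 0"
proof -
  have cont: "continuous_on unit_square Fx"
    using F by (auto simp: partial_x_def)
  have "integral {-1..1} (\<lambda>x. Fx (x, y)) = 0" if y: "y \<in> {-1..1}" for y
  proof -
    have "((\<lambda>x. Fx (x, y)) has_integral F (1, y) - F (-1, y)) {-1..1}"
      using F y by (intro fundamental_theorem_of_calculus)
        (auto simp: partial_x_def has_real_derivative_iff_has_vector_derivative)
    then show ?thesis using assms(2) y by (simp add: vanishes_on_boundary_def integral_unique)
  qed
  then have "integral {-1..1} (\<lambda>y. integral {-1..1} (\<lambda>x. Fx (x, y))) = integral {-1..1} (\<lambda>y::real. 0)"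
    by (intro integral_cong) auto
  then show ?thesis using integral_unit_square(2)[OF cont] by simp
qed

lemma integral_partial_y_eq_0:
  assumes F: "partial_y F Fy" and "vanishes_on_boundary F"
  shows "integral unit_square Fy = 0"
proof -
  have cont: "continuous_on unit_square Fy"
    using F by (auto simp: partial_y_def)
  have "integral {-1..1} (\<lambda>y. Fy (x, y)) = 0" if x: "x \<in> {-1..1}" for x
  proof -
    have "((\<lambda>y. Fy (x, y)) has_integral F (x, 1) - F (x, -1)) {-1..1}"
      using F x by (intro fundamental_theorem_of_calculus)
        (auto simp: partial_y_def has_real_derivative_iff_has_vector_derivative)
    then show ?thesis using assms(2) x by (simp add: vanishes_on_boundary_def integral_unique)
  qed
  then have "integral {-1..1} (\<lambda>x. integral {-1..1} (\<lambda>y. Fy (x, y))) = integral {-1..1} (\<lambda>x::real. 0)"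
    by (intro integral_cong) auto
  then show ?thesis using integral_unit_square(1)[OF cont] by simp
qed

lemma abs_le_integral_deriv:
  fixes f f' :: "real \<Rightarrow> real"
  assumes "\<And>x. x \<in> {-1..1} \<Longrightarrow> (f has_real_derivative f' x) (at x within {-1..1})"
    and cont: "continuous_on {-1..1} f'" and "f (-1) = 0" and x: "x \<in> {-1..1}"
  shows "\<bar>f x\<bar> \<le> integral {-1..1} (\<lambda>s. \<bar>f' s\<bar>)"
proof -
  have "(f' has_integral f x - f (-1)) {-1..x}"
    using x by (intro fundamental_theorem_of_calculus)
      (auto simp: has_real_derivative_iff_has_vector_derivative[symmetric] intro!: DERIV_subset[OF assms(1)])
  then have "f x = integral {-1..x} f'" using assms(3) by (simp add: integral_unique)
  also have "\<bar>\<dots>\<bar> \<le> integral {-1..x} (\<lambda>s. \<bar>f' s\<bar>)"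
    unfolding real_norm_def[symmetric]
    using x by (intro integral_norm_bound_integral integrable_continuous_real continuous_intros
        continuous_on_subset[OF cont]) auto
  also have "\<dots> \<le> integral {-1..1} (\<lambda>s. \<bar>f' s\<bar>)"
    using x by (intro integral_subset_le integrable_continuous_real continuous_intros
        continuous_on_subset[OF cont]) auto
  finally show ?thesis .
qed

text \<open>The Gagliardo-Nirenberg argument: \<open>F (x, y)\<close> is bounded by the integral of
  \<open>|Fx|\<close> along its row and by that of \<open>|Fy|\<close> along its column. The product
  of the two bounds separates the variables, so its integral factors.\<close>

lemma sobolev_unit_square:
  assumes F: "partial_x F Fx" "partial_y F Fy" and "vanishes_on_boundary F"
  shows "integral unit_square (\<lambda>p. (F p)\<^sup>2) \<le>
     integral unit_square (\<lambda>p. \<bar>Fx p\<bar>) * integral unit_square (\<lambda>p. \<bar>Fy p\<bar>)"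
proof -
  have cont: "continuous_on unit_square F" "continuous_on unit_square Fx" "continuous_on unit_square Fy"
    using F by (auto simp: partial_x_def partial_y_def)
  define a where "a = (\<lambda>y. integral {-1..1} (\<lambda>s. \<bar>Fx (s, y)\<bar>))"
  define b where "b = (\<lambda>x. integral {-1..1} (\<lambda>s. \<bar>Fy (x, s)\<bar>))"
  have a0: "a y \<ge> 0" if "y \<in> {-1..1}" for y
    unfolding a_def using that by (intro integral_nonneg integrable_continuous_real continuous_intros continuous_on_slice cont) auto
  have b0: "b y \<ge> 0" if "y \<in> {-1..1}" for y
    unfolding b_def using that by (intro integral_nonneg integrable_continuous_real continuous_intros continuous_on_slice cont) auto
  have "continuous_on {-1..1} (\<lambda>y. integral (cbox (-1) 1) (\<lambda>s. \<bar>Fx (s, y)\<bar>))"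
  proof (rule integral_continuous_on_param)
    show "continuous_on ({-1..1} \<times> cbox (-1) 1) (\<lambda>(y, s). \<bar>Fx (s, y)\<bar>)"
      unfolding case_prod_beta
      by (intro continuous_intros continuous_on_compose2[OF cont(2)]) (auto simp: unit_square_iff)
  qed
  then have ca: "continuous_on {-1..1} a" by (simp add: a_def cbox_interval)
  have "continuous_on {-1..1} (\<lambda>y. integral (cbox (-1) 1) (\<lambda>s. \<bar>Fy (y, s)\<bar>))"
  proof (rule integral_continuous_on_param)
    show "continuous_on ({-1..1} \<times> cbox (-1) 1) (\<lambda>(y, s). \<bar>Fy (y, s)\<bar>)"
      unfolding case_prod_beta
      by (intro continuous_intros continuous_on_compose2[OF cont(3)]) (auto simp: unit_square_iff)
  qed
  then have cb: "continuous_on {-1..1} b" by (simp add: b_def cbox_interval)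
  have cab: "continuous_on unit_square (\<lambda>p. b (fst p) * a (snd p))"
    by (intro continuous_intros continuous_on_compose2[OF ca] continuous_on_compose2[OF cb])
       (auto simp: unit_square_iff)
  have le: "(F (x, y))\<^sup>2 \<le> b x * a y" if "(x, y) \<in> unit_square" for x y
  proof -
    have xy: "x \<in> {-1..1}" "y \<in> {-1..1}" using that by (auto simp: unit_square_iff)
    have 1: "\<bar>F (x, y)\<bar> \<le> a y" unfolding a_def
      using F xy assms(3) by (intro abs_le_integral_deriv[where f = "\<lambda>s. F (s, y)"] continuous_on_slice cont)
        (auto simp: partial_x_def partial_y_def vanishes_on_boundary_def)
    have 2: "\<bar>F (x, y)\<bar> \<le> b x" unfolding b_def
      using F xy assms(3) by (intro abs_le_integral_deriv[where f = "\<lambda>s. F (x, s)"] continuous_on_slice cont)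
        (auto simp: partial_x_def partial_y_def vanishes_on_boundary_def)
    have "(F (x, y))\<^sup>2 = \<bar>F (x, y)\<bar> * \<bar>F (x, y)\<bar>" by (simp add: power2_eq_square)
    also have "\<dots> \<le> b x * a y" using 1 2 b0[OF xy(1)] by (intro mult_mono) auto
    finally show ?thesis .
  qed
  have "integral unit_square (\<lambda>p. (F p)\<^sup>2) \<le> integral unit_square (\<lambda>p. b (fst p) * a (snd p))"
    by (intro integral_le integrable_unit_square continuous_intros cont cab) (use le in force)
  also have "\<dots> = integral {-1..1} (\<lambda>x. integral {-1..1} (\<lambda>y. b x * a y))"
    by (subst integral_unit_square(1)[OF cab]) simp
  also have "\<dots> = integral {-1..1} b * integral {-1..1} a" by simp
  also have "integral {-1..1} b = integral unit_square (\<lambda>p. \<bar>Fy p\<bar>)"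
    unfolding b_def by (subst integral_unit_square(1)) (auto intro!: continuous_intros cont)
  also have "integral {-1..1} a = integral unit_square (\<lambda>p. \<bar>Fx p\<bar>)"
    unfolding a_def by (subst integral_unit_square(2)) (auto intro!: continuous_intros cont)
  finally show ?thesis by (simp add: mult.commute)
qed

section \<open>Product rules and the polynomial cutoff\<close>

lemma partial_mult:
  "partial_x F Fx \<Longrightarrow> partial_x G Gx \<Longrightarrow> partial_x (\<lambda>p. F p * G p) (\<lambda>p. F p * Gx p + Fx p * G p)"
  "partial_y F Fy \<Longrightarrow> partial_y G Gy \<Longrightarrow> partial_y (\<lambda>p. F p * G p) (\<lambda>p. F p * Gy p + Fy p * G p)"
  unfolding partial_x_def partial_y_def
  by (auto intro!: continuous_intros derivative_eq_intros)

lemma partial_power: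
  "partial_x F Fx \<Longrightarrow> partial_x (\<lambda>p. F p ^ n) (\<lambda>p. real n * F p ^ (n - 1) * Fx p)"
  "partial_y F Fy \<Longrightarrow> partial_y (\<lambda>p. F p ^ n) (\<lambda>p. real n * F p ^ (n - 1) * Fy p)"
  unfolding partial_x_def partial_y_def
  by (auto intro!: continuous_intros derivative_eq_intros)

text \<open>The outer square makes the derivative vanish together with the function at the ends:
  \<open>(bump' s)^2 = 16 * s^2 * bump s\<close>. This is the origin of the constant 16 in
  \<open>cutoff_bounds\<close>.\<close>

definition bump :: "real \<Rightarrow> real" where "bump s = (1 - s\<^sup>2)\<^sup>2"
definition bump' :: "real \<Rightarrow> real" where "bump' s = - 4 * s * (1 - s\<^sup>2)"

definition cutoff :: "real \<times> real \<Rightarrow> real" where "cutoff p = bump (fst p) * bump (snd p)"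
definition cutoff_x :: "real \<times> real \<Rightarrow> real" where "cutoff_x p = bump' (fst p) * bump (snd p)"
definition cutoff_y :: "real \<times> real \<Rightarrow> real" where "cutoff_y p = bump (fst p) * bump' (snd p)"

lemma partial_cutoff: "partial_x cutoff cutoff_x" "partial_y cutoff cutoff_y"
  unfolding partial_x_def partial_y_def cutoff_def cutoff_x_def cutoff_y_def bump_def bump'_def
  by (auto intro!: continuous_intros derivative_eq_intros simp: algebra_simps power2_eq_square)

lemma bump_bounds:
  assumes "s \<in> {-1..1}"
  shows "0 \<le> bump s" "bump s \<le> 1" "(bump' s)\<^sup>2 \<le> 16 * bump s"
proof -
  have s: "s\<^sup>2 \<le> 1" using assms by (simp add: abs_square_le_1 abs_le_iff)
  show "0 \<le> bump s" by (simp add: bump_def)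
  show "bump s \<le> 1" unfolding bump_def using s by (intro power_le_one) auto
  have "(bump' s)\<^sup>2 = 16 * (s\<^sup>2 * bump s)" by (simp add: bump_def bump'_def power_mult_distrib)
  also have "\<dots> \<le> 16 * (1 * bump s)" using s by (intro mult_left_mono mult_right_mono) (auto simp: bump_def)
  finally show "(bump' s)\<^sup>2 \<le> 16 * bump s" by simp
qed

lemma cutoff_bounds:
  assumes "p \<in> unit_square"
  shows "0 \<le> cutoff p" "cutoff p \<le> 1" "(cutoff_x p)\<^sup>2 \<le> 16 * cutoff p" "(cutoff_y p)\<^sup>2 \<le> 16 * cutoff p"
proof -
  obtain x y where p: "p = (x, y)" by (cases p)
  then have xy: "x \<in> {-1..1}" "y \<in> {-1..1}" using assms by (auto simp: unit_square_iff)
  note bx = bump_bounds[OF xy(1)] and by' = bump_bounds[OF xy(2)]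
  show "0 \<le> cutoff p" "cutoff p \<le> 1" using bx by' by (auto simp: cutoff_def p intro: mult_le_one)
  have sq: "(bump s)\<^sup>2 \<le> bump s" if "s \<in> {-1..1}" for s
    using bump_bounds[OF that] by (simp add: power2_eq_square mult_left_le_one_le)
  have "(bump' x)\<^sup>2 * (bump y)\<^sup>2 \<le> (16 * bump x) * bump y"
    using bx by' sq[OF xy(2)] by (intro mult_mono) auto
  then show "(cutoff_x p)\<^sup>2 \<le> 16 * cutoff p" by (simp add: cutoff_x_def cutoff_def p power_mult_distrib)
  have "(bump x)\<^sup>2 * (bump' y)\<^sup>2 \<le> bump x * (16 * bump y)"
    using bx by' sq[OF xy(1)] by (intro mult_mono) auto
  then show "(cutoff_y p)\<^sup>2 \<le> 16 * cutoff p" by (simp add: cutoff_y_def cutoff_def p power_mult_distrib)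
qed

lemma vanishes_cutoff: "vanishes_on_boundary (\<lambda>p. cutoff p * F p)"
  by (simp add: vanishes_on_boundary_def cutoff_def bump_def)

text \<open>The factor \<open>real n\<close> in front of the square of the gradient leaves room to absorb both the cross
  term with the gradient of \<open>q\<close> and the cutoff error, the latter because \<open>rx\<^sup>2 \<le> 16 * r\<close>.\<close>

lemma energy_integrand_le:
  fixes u ux q qx r rx q0 :: real
  assumes u: "u > 0" and q: "0 \<le> q" "q \<le> q0" and qx: "\<bar>qx\<bar> \<le> q0"
    and r: "0 \<le> r" "r \<le> 1" "rx\<^sup>2 \<le> 16 * r" and n: "n \<ge> 4" and q0: "q0 \<ge> 1"
  shows "- (rx * u^n + r * (real n * u^(n-1) * ux)) * ((1 + q / u\<^sup>2) * ux - qx / u)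
     \<le> - (r * u^(n-1) * ux\<^sup>2) + 22 * real n * q0\<^sup>2 * (1 + u^(n+1))"
proof -
  \<comment> \<open>With \<open>w = u^(n-4)\<close> all error terms take the form
    \<open>w * u^j\<close> with natural \<open>j \<le> 5\<close>, and these lie below
    \<open>1 + u^(n+1)\<close>.\<close>
  obtain m where m: "n = m + 4" using n by (metis le_add_diff_inverse2)
  define w where "w = u^m"
  have w: "w > 0" using u by (simp add: w_def)
  have pw: "u^n = w*u^4" "u^(n-1) = w*u^3" "u^(n+1) = w*u^5" "u^(n-3) = w*u"
    by (simp_all add: m w_def power_add numeral_eq_Suc)
  have small: "w * u^j \<le> 1 + u^(n+1)" if "j \<le> 5" for j
  proof (cases "u \<le> 1")
    case True
    then have "w * u^j \<le> 1 * 1" unfolding w_def using u by (intro mult_mono power_le_one) auto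
    then show ?thesis using u by (simp add: add_increasing2)
  next
    case False
    then have "w * u^j \<le> w * u^5" using that w by (intro mult_left_mono power_increasing) auto
    then show ?thesis unfolding pw by simp
  qed
  \<comment> \<open>Young's inequality after division by \<open>r\<close>; where \<open>r\<close>
    vanishes, \<open>rx\<close> vanishes too.\<close>
  have t1: "\<bar>rx * ux\<bar> * u \<le> (r * ux\<^sup>2 + 16 * u\<^sup>2) / 2"
  proof -
    have "2 * (\<bar>rx * ux\<bar> * u) \<le> r * ux\<^sup>2 + 16 * u\<^sup>2"
    proof (cases "r = 0")
      case True then have "rx = 0" using r by simp
      then show ?thesis using True by simp
    next
      case False
      then have "r > 0" using r by simp
      have "0 \<le> (r * \<bar>ux\<bar> - \<bar>rx\<bar> * u)\<^sup>2" by simp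
      then have "2 * r * (\<bar>rx * ux\<bar> * u) \<le> r\<^sup>2 * ux\<^sup>2 + rx\<^sup>2 * u\<^sup>2"
        by (simp add: power2_diff power_mult_distrib abs_mult algebra_simps)
      also have "\<dots> \<le> r\<^sup>2 * ux\<^sup>2 + (16 * r) * u\<^sup>2" using r by (intro add_left_mono mult_right_mono) auto
      also have "\<dots> = r * (r * ux\<^sup>2 + 16 * u\<^sup>2)" by (simp add: power2_eq_square algebra_simps)
      finally have "r * (2 * (\<bar>rx * ux\<bar> * u)) \<le> r * (r * ux\<^sup>2 + 16 * u\<^sup>2)" by simp
      then show ?thesis using \<open>r > 0\<close> by simp
    qed
    then show ?thesis by simp
  qed
  have A: "- (rx * u^n * ((1 + q / u\<^sup>2) * ux)) \<le> (1 + q / u\<^sup>2) * (w * u^3) * ((r * ux\<^sup>2 + 16 * u\<^sup>2) / 2)"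
  proof -
    have "- (rx * u^n * ((1 + q / u\<^sup>2) * ux)) = (1 + q / u\<^sup>2) * (w * u^3) * (- (rx * ux) * u)"
      by (simp add: pw algebra_simps numeral_eq_Suc)
    also have "\<dots> \<le> (1 + q / u\<^sup>2) * (w * u^3) * ((r * ux\<^sup>2 + 16 * u\<^sup>2) / 2)"
    proof (rule mult_left_mono)
      have "- (rx * ux) * u \<le> \<bar>rx * ux\<bar> * u" using u by (intro mult_right_mono) auto
      then show "- (rx * ux) * u \<le> (r * ux\<^sup>2 + 16 * u\<^sup>2) / 2" using t1 by linarith
    qed (use q u w in auto)
    finally show ?thesis .
  qed
  \<comment> \<open>Young's inequality again, weighted so that the gradient part takes only
    \<open>n / 4\<close> of the available coefficient \<open>n\<close>.\<close>
  have Bt: "r * (real n * u^(n-1) * ux) * (qx / u) \<le> real n * (w * u * r * (u\<^sup>2 * ux\<^sup>2 / 4 + q0\<^sup>2))"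
  proof -
    have "0 \<le> (u * ux / 2 - qx)\<^sup>2" by simp
    then have "u * ux * qx \<le> u\<^sup>2 * ux\<^sup>2 / 4 + qx\<^sup>2"
      by (simp add: power2_diff power_mult_distrib power_divide algebra_simps)
    also have "qx\<^sup>2 \<le> q0\<^sup>2" using qx by (metis abs_ge_zero power2_abs power_mono)
    finally have "real n * (w * u * r * (u * ux * qx)) \<le> real n * (w * u * r * (u\<^sup>2 * ux\<^sup>2 / 4 + q0\<^sup>2))"
      using w u r by (intro mult_left_mono) auto
    moreover have "r * (real n * u^(n-1) * ux) * (qx / u) = real n * (w * u * r * (u * ux * qx))"
      unfolding pw using u by (simp add: field_simps numeral_eq_Suc)
    ultimately show ?thesis by simp
  qed
  have Ct: "rx * u^n * (qx / u) \<le> 4 * q0 * (w * u^3)"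
  proof -
    have "rx\<^sup>2 \<le> 4\<^sup>2" using r by simp
    then have "\<bar>rx\<bar> \<le> 4" using abs_le_square_iff[of rx 4] by simp
    then have "\<bar>rx\<bar> * \<bar>qx\<bar> \<le> 4 * q0" using qx by (intro mult_mono) auto
    then have "rx * qx \<le> 4 * q0" by (metis abs_ge_self abs_mult order_trans)
    then have "(rx * qx) * (w * u^3) \<le> (4 * q0) * (w * u^3)" using u w by (intro mult_right_mono) auto
    moreover have "rx * u^n * (qx / u) = (rx * qx) * (w * u^3)" using u by (simp add: pw numeral_eq_Suc)
    ultimately show ?thesis by simp
  qed
  have id: "- (rx * u^n + r * (real n * u^(n-1) * ux)) * ((1 + q / u\<^sup>2) * ux - qx / u)
    = - (rx * u^n * ((1 + q / u\<^sup>2) * ux)) + rx * u^n * (qx / u)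
      - real n * (1 + q / u\<^sup>2) * (w * u^3) * r * ux\<^sup>2 + r * (real n * u^(n-1) * ux) * (qx / u)"
    unfolding pw by (simp add: algebra_simps power2_eq_square)
  have "- (rx * u^n + r * (real n * u^(n-1) * ux)) * ((1 + q / u\<^sup>2) * ux - qx / u)
    \<le> (1 + q / u\<^sup>2) * (w * u^3) * ((r * ux\<^sup>2 + 16 * u\<^sup>2) / 2) + 4 * q0 * (w * u^3)
      - real n * (1 + q / u\<^sup>2) * (w * u^3) * r * ux\<^sup>2 + real n * (w * u * r * (u\<^sup>2 * ux\<^sup>2 / 4 + q0\<^sup>2))"
    unfolding id using A Bt Ct by linarith
  also have "\<dots> = - (real n - 1/2) * (1 + q / u\<^sup>2) * (w * u^3 * r * ux\<^sup>2)
      + real n / 4 * (w * u^3 * r * ux\<^sup>2)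
      + (8 * (w * u^5) + 8 * q * (w * u^3) + 4 * q0 * (w * u^3) + real n * q0\<^sup>2 * (r * (w * u^1)))"
    using u by (simp add: field_simps power2_eq_square numeral_eq_Suc)
  \<comment> \<open>The singular factor \<open>1 + q / u^2\<close> stands with a negative
    coefficient and is at least 1 because \<open>q \<ge> 0\<close>, so it may be replaced by
    1.\<close>
  also have "- (real n - 1/2) * (1 + q / u\<^sup>2) * (w * u^3 * r * ux\<^sup>2) \<le> - (real n - 1/2) * 1 * (w * u^3 * r * ux\<^sup>2)"
  proof -
    have "(real n - 1/2) * 1 * (w * u^3 * r * ux\<^sup>2) \<le> (real n - 1/2) * (1 + q / u\<^sup>2) * (w * u^3 * r * ux\<^sup>2)"
      using n w u r q by (intro mult_right_mono mult_left_mono) auto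
    then show ?thesis by (simp only: mult_minus_left neg_le_iff_le)
  qed
  also have "- (real n - 1/2) * 1 * (w * u^3 * r * ux\<^sup>2) + real n / 4 * (w * u^3 * r * ux\<^sup>2)
     \<le> - 1 * (w * u^3 * r * ux\<^sup>2)"
  proof -
    have "(1 - real n + 1/2 + real n / 4) * (w * u^3 * r * ux\<^sup>2) \<le> 0"
      using n w u r by (intro mult_nonpos_nonneg) auto
    then show ?thesis by (simp add: algebra_simps)
  qed
  \<comment> \<open>The four terms contribute 8 + 8 + 4 + 1 = 21, rounded up to 22.\<close>
  also have "8 * (w * u^5) + 8 * q * (w * u^3) + 4 * q0 * (w * u^3) + real n * q0\<^sup>2 * (r * (w * u^1))
     \<le> 22 * real n * q0\<^sup>2 * (1 + u^(n+1))"
  proof -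
    define S where "S = 1 + u^(n+1)"
    have S: "S \<ge> 0" using u by (simp add: S_def)
    have q02: "1 \<le> q0\<^sup>2" "q0 \<le> q0\<^sup>2" using q0 by (auto simp: self_le_power)
    have nq: "q0\<^sup>2 \<le> real n * q0\<^sup>2"
      using mult_right_mono[of 1 "real n" "q0\<^sup>2"] n by simp
    have qn: "q0 \<le> real n * q0\<^sup>2" using nq q02 by linarith
    have "8 * (w * u^5) \<le> 8 * (real n * q0\<^sup>2) * S"
      using small[of 5] q02 nq S by (simp add: S_def) (smt (verit) mult_right_mono mult_cancel_right1)
    moreover have "8 * q * (w * u^3) \<le> 8 * (real n * q0\<^sup>2) * S"
      using small[of 3] q q02 nq u w unfolding S_def by (intro mult_mono) auto
    moreover have "4 * q0 * (w * u^3) \<le> 4 * (real n * q0\<^sup>2) * S"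
      using small[of 3] qn u w q0 unfolding S_def by (intro mult_mono) auto
    moreover have "real n * q0\<^sup>2 * (r * (w * u^1)) \<le> real n * q0\<^sup>2 * S"
    proof (rule mult_left_mono)
      have "r * (w * u^1) \<le> w * u^1" using r w u by (intro mult_left_le_one_le) auto
      then show "r * (w * u^1) \<le> S" using small[of 1] by (simp add: S_def)
    qed auto
    moreover have "0 \<le> real n * q0\<^sup>2 * S" using S by simp
    ultimately show ?thesis unfolding S_def[symmetric] by linarith
  qed
  finally show ?thesis unfolding pw by (simp add: mult_ac)
qed

text \<open>Cauchy-Schwarz by integrating the pointwise bound
  \<open>2 * f \<le> l * g + h / l\<close>, valid for every \<open>l > 0\<close>, and choosing
  \<open>l\<close> afterwards.\<close>

lemma integral_square_le:
  fixes f g h :: "real \<times> real \<Rightarrow> real"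
  assumes cont: "continuous_on unit_square f" "continuous_on unit_square g" "continuous_on unit_square h"
    and pos: "\<And>p. p \<in> unit_square \<Longrightarrow> 0 \<le> f p" "\<And>p. p \<in> unit_square \<Longrightarrow> 0 < g p" "\<And>p. p \<in> unit_square \<Longrightarrow> 0 \<le> h p"
    and le: "\<And>p. p \<in> unit_square \<Longrightarrow> (f p)\<^sup>2 \<le> g p * h p"
  shows "(integral unit_square f)\<^sup>2 \<le> integral unit_square g * integral unit_square h"
proof -
  define X where "X = integral unit_square f"
  define G where "G = integral unit_square g"
  define H where "H = integral unit_square h"
  have X0: "X \<ge> 0" and G0: "G \<ge> 0" and H0: "H \<ge> 0"
    unfolding X_def G_def H_def using pos(1,3) less_imp_le[OF pos(2)]
    by (auto intro!: integral_nonneg integrable_unit_square cont)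
  have bound: "X \<le> (l * G + H / l) / 2" if "l > 0" for l
  proof -
    have "X \<le> integral unit_square (\<lambda>p. (l * g p + h p / l) / 2)"
      unfolding X_def
    proof (intro integral_le integrable_unit_square continuous_intros cont)
      fix p assume p: "p \<in> unit_square"
      have "(2 * f p)\<^sup>2 \<le> 4 * (g p * h p)" using le[OF p] by simp
      also have "\<dots> \<le> (l * g p + h p / l)\<^sup>2"
      proof -
        have "0 \<le> (l * g p - h p / l)\<^sup>2" by simp
        then show ?thesis using that by (simp add: power2_diff power2_sum)
      qed
      finally have "2 * f p \<le> l * g p + h p / l"
        using pos[OF p] that by (intro power2_le_imp_le[of "2 * f p"]) (auto intro: less_imp_le)
      then show "f p \<le> (l * g p + h p / l) / 2" by simp
    qed (use that in auto)
    also have "\<dots> = (l * G + H / l) / 2"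
      unfolding G_def H_def
      by (rule integral_unique) (intro has_integral_unit_square_intros has_integral_divide cont)
    finally show ?thesis .
  qed
  show ?thesis
  proof (cases "X = 0 \<or> G = 0")
    case True
    \<comment> \<open>If \<open>G = 0\<close>, large \<open>l\<close> makes the bound arbitrarily
      small; \<open>l = (H + 1) / X\<close> is already large enough to contradict
      \<open>X > 0\<close>.\<close>
    have "X = 0"
    proof (rule ccontr)
      assume "X \<noteq> 0"
      then have "G = 0" "X > 0" using True X0 by auto
      then have "X \<le> H / ((H+1)/X) / 2" using bound[of "(H+1)/X"] H0 by simp
      also have "\<dots> = X * (H / (H+1)) / 2" by simp
      also have "\<dots> \<le> X * 1 / 2" using H0 \<open>X > 0\<close> by (intro divide_right_mono mult_left_mono) auto
      finally show False using \<open>X > 0\<close> by simp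
    qed
    then show ?thesis using G0 H0 by (simp add: X_def G_def H_def)
  next
    case False
    then have "X > 0" "G > 0" using X0 G0 by auto
    then have "X \<le> (X + H * G / X) / 2" using bound[of "X / G"] by simp
    then have "X \<le> H * G / X" by simp
    then have "X * X \<le> H * G" using \<open>X > 0\<close> by (simp add: field_simps)
    then show ?thesis by (simp add: X_def G_def H_def power2_eq_square mult.commute)
  qed
qed

text \<open>Integration by parts enters as the hypothesis \<open>parts\<close>, so that one proof
  serves both coordinate directions. The remaining integrand is estimated pointwise by
  \<open>energy_integrand_le\<close>; the summand 4 is the area of the square.\<close>

lemma energy_estimate_direction:
  assumes u: "\<And>p. p \<in> unit_square \<Longrightarrow> u p > 0" and contu: "continuous_on unit_square u"
    and contux: "continuous_on unit_square ux" and contvx: "continuous_on unit_square vx"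
    and contvxx: "continuous_on unit_square vxx" and contr: "continuous_on unit_square rx"
    and r: "\<And>p. p \<in> unit_square \<Longrightarrow> (rx p)\<^sup>2 \<le> 16 * cutoff p"
    and q: "\<And>p. p \<in> unit_square \<Longrightarrow> 0 \<le> q p \<and> q p \<le> q0"
    and qx: "\<And>p. p \<in> unit_square \<Longrightarrow> \<bar>qx p\<bar> \<le> q0" and q0: "q0 \<ge> 1" and n: "n \<ge> 4"
    and vx: "\<And>p. p \<in> unit_square \<Longrightarrow> vx p = (1 + q p / (u p)\<^sup>2) * ux p - qx p / u p"
    and parts: "integral unit_square (\<lambda>p. cutoff p * u p ^ n * vxx p
        + (cutoff p * (real n * u p ^ (n-1) * ux p) + rx p * u p ^ n) * vx p) = 0"
  shows "integral unit_square (\<lambda>p. cutoff p * u p ^ n * vxx p)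
     \<le> - integral unit_square (\<lambda>p. cutoff p * u p ^ (n - 1) * (ux p)\<^sup>2)
       + 22 * real n * q0\<^sup>2 * (4 + integral unit_square (\<lambda>p. u p ^ (n+1)))"
proof -
  have [continuous_intros]: "continuous_on unit_square cutoff"
    using partial_cutoff by (simp add: partial_x_def)
  note [continuous_intros] = contu contux contvx contvxx contr
  have "integral unit_square (\<lambda>p. cutoff p * u p ^ n * vxx p)
     = integral unit_square (\<lambda>p. - (rx p * u p ^ n + cutoff p * (real n * u p ^ (n-1) * ux p)) * vx p)"
  proof -
    have "integral unit_square (\<lambda>p. cutoff p * u p ^ n * vxx p
        + (cutoff p * (real n * u p ^ (n-1) * ux p) + rx p * u p ^ n) * vx p)
      = integral unit_square (\<lambda>p. cutoff p * u p ^ n * vxx p)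
        - integral unit_square (\<lambda>p. - (rx p * u p ^ n + cutoff p * (real n * u p ^ (n-1) * ux p)) * vx p)"
      by (subst integral_diff[symmetric])
         (auto intro!: integrable_unit_square continuous_intros integral_cong simp: algebra_simps)
    then show ?thesis using parts by simp
  qed
  also have "\<dots> \<le> integral unit_square (\<lambda>p. - (cutoff p * u p ^ (n - 1) * (ux p)\<^sup>2)
       + 22 * real n * q0\<^sup>2 * (1 + u p ^ (n+1)))"
  proof (intro integral_le integrable_unit_square continuous_intros)
    fix p assume p: "p \<in> unit_square"
    then show "- (rx p * u p ^ n + cutoff p * (real n * u p ^ (n-1) * ux p)) * vx p
      \<le> - (cutoff p * u p ^ (n - 1) * (ux p)\<^sup>2) + 22 * real n * q0\<^sup>2 * (1 + u p ^ (n+1))"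
      using u q qx r cutoff_bounds[OF p] n q0 by (subst vx[OF p], intro energy_integrand_le) auto
  qed
  also have "\<dots> = - integral unit_square (\<lambda>p. cutoff p * u p ^ (n - 1) * (ux p)\<^sup>2)
       + 22 * real n * q0\<^sup>2 * (4 + integral unit_square (\<lambda>p. u p ^ (n+1)))"
    by (rule integral_unique)
       (use has_integral_unit_square_const[of 1] in \<open>auto intro!: has_integral_unit_square_intros continuous_intros\<close>)
  finally show ?thesis .
qed

text \<open>The equation is tested with \<open>(n + 1) * cutoff * u^n\<close>, which makes the left
  side the time derivative of the weighted integral of \<open>u^(n+1)\<close>. Since
  \<open>q\<close> and \<open>k\<close> are nonnegative, the zero order term is at most
  \<open>k * u\<close>. The constant 45 collects 22 from each direction and 1 from that
  term.\<close>

lemma energy_estimate: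
  assumes u: "\<And>p. p \<in> unit_square \<Longrightarrow> u p > 0"
    and ux: "partial_x u ux" and uy: "partial_y u uy"
    and vxx: "partial_x vx vxx" and vyy: "partial_y vy vyy"
    and q: "\<And>p. p \<in> unit_square \<Longrightarrow> 0 \<le> q p \<and> q p \<le> q0"
    and qx: "\<And>p. p \<in> unit_square \<Longrightarrow> \<bar>qx p\<bar> \<le> q0" "\<And>p. p \<in> unit_square \<Longrightarrow> \<bar>qy p\<bar> \<le> q0"
    and q0: "q0 \<ge> 1" and n: "n \<ge> 4"
    and vx: "\<And>p. p \<in> unit_square \<Longrightarrow> vx p = (1 + q p / (u p)\<^sup>2) * ux p - qx p / u p"
    and vy: "\<And>p. p \<in> unit_square \<Longrightarrow> vy p = (1 + q p / (u p)\<^sup>2) * uy p - qy p / u p"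
    and contG: "continuous_on unit_square G" and contut: "continuous_on unit_square ut"
    and G: "\<And>p. p \<in> unit_square \<Longrightarrow> 0 < G p \<and> G p \<le> q0"
    and k: "\<And>p. p \<in> unit_square \<Longrightarrow> 0 \<le> k p \<and> k p \<le> q0"
    and pde: "\<And>p. p \<in> unit_square \<Longrightarrow> G p * ut p = vxx p + vyy p + G p * k p * (u p - q p / u p)"
  shows "integral unit_square (\<lambda>p. cutoff p * G p * (real (n+1) * u p ^ n * ut p))
     \<le> - integral unit_square (\<lambda>p. cutoff p * u p ^ (n - 1) * ((ux p)\<^sup>2 + (uy p)\<^sup>2))
       + 45 * (real (n+1))\<^sup>2 * q0\<^sup>2 * (4 + integral unit_square (\<lambda>p. u p ^ (n+1)))"
proof -
  have cu: "continuous_on unit_square u" and cux: "continuous_on unit_square ux"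
    and cuy: "continuous_on unit_square uy" and cvx: "continuous_on unit_square vx"
    and cvy: "continuous_on unit_square vy" and cvxx: "continuous_on unit_square vxx"
    and cvyy: "continuous_on unit_square vyy"
    and cc: "continuous_on unit_square cutoff" "continuous_on unit_square cutoff_x" "continuous_on unit_square cutoff_y"
    using ux uy vxx vyy partial_cutoff by (auto simp: partial_x_def partial_y_def)
  note [continuous_intros] = cu cux cuy cvx cvy cvxx cvyy cc contG contut
  define S where "S = 4 + integral unit_square (\<lambda>p. u p ^ (n+1))"
  define Dx where "Dx = integral unit_square (\<lambda>p. cutoff p * u p ^ (n - 1) * (ux p)\<^sup>2)"
  define Dy where "Dy = integral unit_square (\<lambda>p. cutoff p * u p ^ (n - 1) * (uy p)\<^sup>2)"
  have van: "vanishes_on_boundary (\<lambda>p. cutoff p * u p ^ n * w p)" for w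
    using vanishes_cutoff[of "\<lambda>p. u p ^ n * w p"] by (simp add: mult.assoc)
  have X: "integral unit_square (\<lambda>p. cutoff p * u p ^ n * vxx p) \<le> - Dx + 22 * real n * q0\<^sup>2 * S"
    unfolding Dx_def S_def
  proof (rule energy_estimate_direction[where q = q and qx = qx])
    show "integral unit_square (\<lambda>p. cutoff p * u p ^ n * vxx p
        + (cutoff p * (real n * u p ^ (n-1) * ux p) + cutoff_x p * u p ^ n) * vx p) = 0"
      by (rule integral_partial_x_eq_0[OF partial_mult(1)[OF partial_mult(1)[OF partial_cutoff(1) partial_power(1)[OF ux]] vxx] van])
  qed (simp_all add: u q qx q0 n cutoff_bounds cu cux cvx cvxx cc, simp add: vx)
  have Y: "integral unit_square (\<lambda>p. cutoff p * u p ^ n * vyy p) \<le> - Dy + 22 * real n * q0\<^sup>2 * S"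
    unfolding Dy_def S_def
  proof (rule energy_estimate_direction[where q = q and qx = qy])
    show "integral unit_square (\<lambda>p. cutoff p * u p ^ n * vyy p
        + (cutoff p * (real n * u p ^ (n-1) * uy p) + cutoff_y p * u p ^ n) * vy p) = 0"
      by (rule integral_partial_y_eq_0[OF partial_mult(2)[OF partial_mult(2)[OF partial_cutoff(2) partial_power(2)[OF uy]] vyy] van])
  qed (simp_all add: u q qx q0 n cutoff_bounds cu cuy cvy cvyy cc, simp add: vy)
  have D0: "Dx \<ge> 0" "Dy \<ge> 0" unfolding Dx_def Dy_def
    by (intro integral_nonneg integrable_unit_square continuous_intros; simp add: cutoff_bounds u less_imp_le)+
  have U0: "integral unit_square (\<lambda>p. u p ^ (n+1)) \<ge> 0"
    by (intro integral_nonneg integrable_unit_square continuous_intros) (simp add: u less_imp_le)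
  define m where "m = real (n+1)"
  have m: "m \<ge> 1" "real n \<le> m" by (auto simp: m_def)
  have "integral unit_square (\<lambda>p. cutoff p * G p * (m * u p ^ n * ut p))
     \<le> integral unit_square (\<lambda>p. m * (cutoff p * u p ^ n * vxx p + cutoff p * u p ^ n * vyy p + q0\<^sup>2 * u p ^ (n+1)))"
  proof (intro integral_le integrable_unit_square continuous_intros)
    fix p assume p: "p \<in> unit_square"
    have "cutoff p * G p * (m * u p ^ n * ut p) = m * (cutoff p * u p ^ n) * (G p * ut p)" by simp
    also have "\<dots> = m * (cutoff p * u p ^ n * vxx p + cutoff p * u p ^ n * vyy p
        + cutoff p * (G p * k p) * (u p ^ n * (u p - q p / u p)))"
      by (subst pde[OF p]) (simp add: algebra_simps)
    also have "\<dots> \<le> m * (cutoff p * u p ^ n * vxx p + cutoff p * u p ^ n * vyy p + q0\<^sup>2 * u p ^ (n+1))"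
    proof (intro mult_left_mono add_left_mono)
      have "u p ^ n * (u p - q p / u p) \<le> u p ^ n * u p"
        using u[OF p] q[OF p] by (intro mult_left_mono) auto
      moreover have "G p * k p \<le> q0 * q0" using G[OF p] k[OF p] q0 by (intro mult_mono) auto
      then have "cutoff p * (G p * k p) \<le> 1 * (q0 * q0)"
        using cutoff_bounds[OF p] G[OF p] k[OF p] by (intro mult_mono) auto
      moreover have "0 \<le> cutoff p * (G p * k p)" using cutoff_bounds[OF p] G[OF p] k[OF p] by simp
      ultimately have "cutoff p * (G p * k p) * (u p ^ n * (u p - q p / u p)) \<le> cutoff p * (G p * k p) * (u p ^ n * u p)"
          "cutoff p * (G p * k p) * (u p ^ n * u p) \<le> (1 * (q0 * q0)) * (u p ^ n * u p)"
        using u[OF p] by (auto intro!: mult_left_mono mult_right_mono)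
      then show "cutoff p * (G p * k p) * (u p ^ n * (u p - q p / u p)) \<le> q0\<^sup>2 * u p ^ (n+1)"
        by (simp add: power2_eq_square mult.commute)
    qed (use m in auto)
    finally show "cutoff p * G p * (m * u p ^ n * ut p)
      \<le> m * (cutoff p * u p ^ n * vxx p + cutoff p * u p ^ n * vyy p + q0\<^sup>2 * u p ^ (n+1))" .
  qed
  also have "\<dots> = m * (integral unit_square (\<lambda>p. cutoff p * u p ^ n * vxx p)
      + integral unit_square (\<lambda>p. cutoff p * u p ^ n * vyy p) + q0\<^sup>2 * integral unit_square (\<lambda>p. u p ^ (n+1)))"
    by (rule integral_unique) (intro has_integral_unit_square_intros continuous_intros)
  also have "\<dots> \<le> m * ((- Dx + 22 * real n * q0\<^sup>2 * S) + (- Dy + 22 * real n * q0\<^sup>2 * S) + q0\<^sup>2 * S)"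
    using X Y m U0 by (intro mult_left_mono add_mono) (auto simp: S_def)
  also have "\<dots> = - (m * (Dx + Dy)) + m * q0\<^sup>2 * S * (44 * real n + 1)" by (simp add: algebra_simps)
  also have "\<dots> \<le> - (1 * (Dx + Dy)) + m * q0\<^sup>2 * S * (45 * m)"
    using m D0 U0 by (intro add_mono le_imp_neg_le mult_right_mono mult_left_mono) (auto simp: S_def)
  also have "Dx + Dy = integral unit_square (\<lambda>p. cutoff p * u p ^ (n - 1) * ((ux p)\<^sup>2 + (uy p)\<^sup>2))"
    unfolding Dx_def Dy_def
    by (subst integral_add[symmetric]) (auto intro!: integrable_unit_square continuous_intros integral_cong simp: algebra_simps)
  finally show ?thesis by (simp add: m_def S_def power2_eq_square mult_ac)
qed

text \<open>Cauchy-Schwarz for a derivative of \<open>cutoff * u^(3*m)\<close>. The powers split by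
  \<open>2 * (3*m - 1) = m + (5*m - 2)\<close> in the gradient part and by
  \<open>6*m = m + 5*m\<close> in the part from the cutoff, so \<open>u^m\<close> is a common
  factor.\<close>

lemma sobolev_power_direction:
  assumes u: "\<And>p. p \<in> unit_square \<Longrightarrow> u p > 0"
    and contu: "continuous_on unit_square u" and contux: "continuous_on unit_square ux"
    and contr: "continuous_on unit_square rx"
    and r: "\<And>p. p \<in> unit_square \<Longrightarrow> (rx p)\<^sup>2 \<le> 16 * cutoff p"
    and m: "m \<ge> 1"
  shows "(integral unit_square (\<lambda>p. \<bar>cutoff p * (real (3*m) * u p ^ (3*m-1) * ux p) + rx p * u p ^ (3*m)\<bar>))\<^sup>2
     \<le> integral unit_square (\<lambda>p. u p ^ m) * (32 * (real m)\<^sup>2 *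
         (integral unit_square (\<lambda>p. cutoff p * u p ^ (5*m - 2) * (ux p)\<^sup>2) + integral unit_square (\<lambda>p. u p ^ (5*m))))"
proof -
  have [continuous_intros]: "continuous_on unit_square cutoff"
    using partial_cutoff by (simp add: partial_x_def)
  note [continuous_intros] = contu contux contr
  have "(integral unit_square (\<lambda>p. \<bar>cutoff p * (real (3*m) * u p ^ (3*m-1) * ux p) + rx p * u p ^ (3*m)\<bar>))\<^sup>2
     \<le> integral unit_square (\<lambda>p. u p ^ m) * integral unit_square (\<lambda>p. 32 * (real m)\<^sup>2 *
         (cutoff p * u p ^ (5*m - 2) * (ux p)\<^sup>2 + u p ^ (5*m)))"
  proof (rule integral_square_le)
    fix p assume p: "p \<in> unit_square"
    note c = cutoff_bounds[OF p]
    show "u p ^ m > 0" using u[OF p] by simp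
    show "0 \<le> 32 * (real m)\<^sup>2 * (cutoff p * u p ^ (5*m - 2) * (ux p)\<^sup>2 + u p ^ (5*m))"
      using u[OF p] c by simp
    define A where "A = cutoff p * (real (3*m) * u p ^ (3*m-1) * ux p)"
    define B where "B = rx p * u p ^ (3*m)"
    have "0 \<le> (A - B)\<^sup>2" by simp
    then have "(A + B)\<^sup>2 \<le> 2 * A\<^sup>2 + 2 * B\<^sup>2" by (simp add: power2_diff power2_sum)
    also have "A\<^sup>2 \<le> 9 * (real m)\<^sup>2 * (u p ^ m * (cutoff p * u p ^ (5*m - 2) * (ux p)\<^sup>2))"
    proof -
      have e: "(u p ^ (3*m-1))\<^sup>2 = u p ^ m * u p ^ (5*m-2)"
      proof -
        have "(3*m-1)*2 = m + (5*m-2)" using m by simp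
        then show ?thesis by (simp only: power_mult[symmetric] power_add[symmetric])
      qed
      have "A\<^sup>2 = (cutoff p)\<^sup>2 * (9 * (real m)\<^sup>2 * (u p ^ m * (u p ^ (5*m - 2) * (ux p)\<^sup>2)))"
        unfolding A_def power_mult_distrib e by simp
      also have "\<dots> \<le> cutoff p * (9 * (real m)\<^sup>2 * (u p ^ m * (u p ^ (5*m - 2) * (ux p)\<^sup>2)))"
        using c u[OF p] by (intro mult_right_mono) (auto simp: power2_eq_square mult_left_le_one_le)
      finally show ?thesis by (simp add: mult_ac)
    qed
    also have "B\<^sup>2 \<le> 16 * (real m)\<^sup>2 * (u p ^ m * u p ^ (5*m))"
    proof -
      have e: "(u p ^ (3*m))\<^sup>2 = u p ^ m * u p ^ (5*m)" by (simp flip: power_mult power_add)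
      have "(rx p)\<^sup>2 \<le> 16 * 1" using r[OF p] c by linarith
      moreover have "(1::real) \<le> (real m)\<^sup>2" using m by simp
      ultimately have "(rx p)\<^sup>2 \<le> 16 * (real m)\<^sup>2" by linarith
      then show ?thesis unfolding B_def power_mult_distrib e using u[OF p] by (intro mult_right_mono) auto
    qed
    also have "2 * (9 * (real m)\<^sup>2 * (u p ^ m * (cutoff p * u p ^ (5*m - 2) * (ux p)\<^sup>2)))
        + 2 * (16 * (real m)\<^sup>2 * (u p ^ m * u p ^ (5*m)))
      \<le> u p ^ m * (32 * (real m)\<^sup>2 * (cutoff p * u p ^ (5*m - 2) * (ux p)\<^sup>2 + u p ^ (5*m)))"
    proof -
      have "0 \<le> (real m)\<^sup>2 * (u p ^ m * (cutoff p * u p ^ (5*m - 2) * (ux p)\<^sup>2))"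
        using c u[OF p] by simp
      then show ?thesis by (simp add: algebra_simps)
    qed
    finally show "\<bar>cutoff p * (real (3*m) * u p ^ (3*m-1) * ux p) + rx p * u p ^ (3*m)\<bar>\<^sup>2
       \<le> u p ^ m * (32 * (real m)\<^sup>2 * (cutoff p * u p ^ (5*m - 2) * (ux p)\<^sup>2 + u p ^ (5*m)))"
      by (simp add: A_def B_def)
  qed (auto intro!: continuous_intros)
  also have "integral unit_square (\<lambda>p. 32 * (real m)\<^sup>2 * (cutoff p * u p ^ (5*m - 2) * (ux p)\<^sup>2 + u p ^ (5*m)))
     = 32 * (real m)\<^sup>2 * (integral unit_square (\<lambda>p. cutoff p * u p ^ (5*m - 2) * (ux p)\<^sup>2) + integral unit_square (\<lambda>p. u p ^ (5*m)))"
    by (rule integral_unique) (intro has_integral_unit_square_intros continuous_intros)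
  finally show ?thesis .
qed

text \<open>\<open>sobolev_unit_square\<close> for \<open>cutoff * u^(3*m)\<close>. Squaring this
  function is what brings in \<open>(cutoff p)^2\<close>, and later comparisons use this weight for
  that reason.\<close>

lemma sobolev_power:
  assumes u: "\<And>p. p \<in> unit_square \<Longrightarrow> u p > 0"
    and ux: "partial_x u ux" and uy: "partial_y u uy" and m: "m \<ge> 1"
  shows "integral unit_square (\<lambda>p. (cutoff p)\<^sup>2 * u p ^ (6*m))
     \<le> 32 * (real m)\<^sup>2 * integral unit_square (\<lambda>p. u p ^ m) *
        (integral unit_square (\<lambda>p. cutoff p * u p ^ (5*m - 2) * ((ux p)\<^sup>2 + (uy p)\<^sup>2))
          + integral unit_square (\<lambda>p. u p ^ (5*m)))"
proof -
  have cu: "continuous_on unit_square u" and cux: "continuous_on unit_square ux"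
    and cuy: "continuous_on unit_square uy"
    and cc: "continuous_on unit_square cutoff" "continuous_on unit_square cutoff_x" "continuous_on unit_square cutoff_y"
    using ux uy partial_cutoff by (auto simp: partial_x_def partial_y_def)
  note [continuous_intros] = cu cux cuy cc
  define a where "a = integral unit_square (\<lambda>p. u p ^ m)"
  define b where "b = integral unit_square (\<lambda>p. u p ^ (5*m))"
  define Dx where "Dx = integral unit_square (\<lambda>p. cutoff p * u p ^ (5*m - 2) * (ux p)\<^sup>2)"
  define Dy where "Dy = integral unit_square (\<lambda>p. cutoff p * u p ^ (5*m - 2) * (uy p)\<^sup>2)"
  define X where "X = integral unit_square (\<lambda>p. \<bar>cutoff p * (real (3*m) * u p ^ (3*m-1) * ux p) + cutoff_x p * u p ^ (3*m)\<bar>)"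
  define Y where "Y = integral unit_square (\<lambda>p. \<bar>cutoff p * (real (3*m) * u p ^ (3*m-1) * uy p) + cutoff_y p * u p ^ (3*m)\<bar>)"
  have D0: "Dx \<ge> 0" "Dy \<ge> 0" unfolding Dx_def Dy_def
    by (intro integral_nonneg integrable_unit_square continuous_intros; simp add: cutoff_bounds u less_imp_le)+
  have U0: "a \<ge> 0" "b \<ge> 0" unfolding a_def b_def
    by (intro integral_nonneg integrable_unit_square continuous_intros; simp add: u less_imp_le)+
  have X: "X\<^sup>2 \<le> a * (32 * (real m)\<^sup>2 * (Dx + b))" unfolding X_def a_def Dx_def b_def
    by (rule sobolev_power_direction) (use m in \<open>simp_all add: u cutoff_bounds cu cux cc\<close>)
  have Y: "Y\<^sup>2 \<le> a * (32 * (real m)\<^sup>2 * (Dy + b))" unfolding Y_def a_def Dy_def b_def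
    by (rule sobolev_power_direction) (use m in \<open>simp_all add: u cutoff_bounds cu cuy cc\<close>)
  have "integral unit_square (\<lambda>p. (cutoff p)\<^sup>2 * u p ^ (6*m)) = integral unit_square (\<lambda>p. (cutoff p * u p ^ (3*m))\<^sup>2)"
    by (simp add: power_mult_distrib flip: power_mult)
  also have "\<dots> \<le> X * Y" unfolding X_def Y_def
    by (rule sobolev_unit_square[OF partial_mult(1)[OF partial_cutoff(1) partial_power(1)[OF ux]]
          partial_mult(2)[OF partial_cutoff(2) partial_power(2)[OF uy]] vanishes_cutoff])
  also have "\<dots> \<le> (X\<^sup>2 + Y\<^sup>2) / 2"
    using sum_squares_bound[of X Y] by (simp add: field_simps)
  also have "\<dots> \<le> (a * (32 * (real m)\<^sup>2 * (Dx + b)) + a * (32 * (real m)\<^sup>2 * (Dy + b))) / 2"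
    using X Y by simp
  also have "\<dots> \<le> 32 * (real m)\<^sup>2 * a * ((Dx + Dy) + b)"
  proof -
    have "0 \<le> (real m)\<^sup>2 * a * (Dx + Dy)" using D0 U0 by simp
    then show ?thesis by (simp add: algebra_simps)
  qed
  also have "Dx + Dy = integral unit_square (\<lambda>p. cutoff p * u p ^ (5*m - 2) * ((ux p)\<^sup>2 + (uy p)\<^sup>2))"
    unfolding Dx_def Dy_def
    by (subst integral_add[symmetric]) (auto intro!: integrable_unit_square continuous_intros integral_cong simp: algebra_simps)
  finally show ?thesis by (simp add: a_def b_def)
qed

section \<open>Differentiability in coordinates\<close>

lemma Ck_on_imp_continuous_on: "Ck_on k S F \<Longrightarrow> continuous_on S F"
  by (cases k) (auto intro: has_derivative_continuous_on)

lemma Ck_on_SucI: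
  assumes "\<And>x. x \<in> S \<Longrightarrow> (F has_derivative F' x) (at x within S)" "\<And>v. Ck_on k S (\<lambda>x. F' x v)"
  shows "Ck_on (Suc k) S F"
  unfolding Ck_on.simps using assms by blast

lemma Ck_on_SucE:
  assumes "Ck_on (Suc k) S F"
  obtains F' where "\<And>x. x \<in> S \<Longrightarrow> (F has_derivative F' x) (at x within S)" "\<And>v. Ck_on k S (\<lambda>x. F' x v)"
  using assms unfolding Ck_on.simps by blast

lemma Ck_on_Suc_imp: "Ck_on (Suc k) S F \<Longrightarrow> Ck_on k S F"
proof (induction k arbitrary: F)
  case 0
  then show ?case using Ck_on_imp_continuous_on[of "Suc 0"] by simp
next
  case (Suc k)
  then obtain F' where F': "\<forall>x\<in>S. (F has_derivative F' x) (at x within S)" "\<forall>v. Ck_on (Suc k) S (\<lambda>x. F' x v)"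
    unfolding Ck_on.simps(2)[of "Suc k"] by blast
  then have "\<forall>v. Ck_on k S (\<lambda>x. F' x v)" using Suc.IH by blast
  with F'(1) show ?case unfolding Ck_on.simps(2)[of k] by blast
qed

lemma Ck_on_cong:
  assumes "\<And>x. x \<in> S \<Longrightarrow> F x = G x"
  shows "Ck_on k S F \<longleftrightarrow> Ck_on k S G"
proof -
  have "(F has_derivative D) (at x within S) = (G has_derivative D) (at x within S)" if "x \<in> S" for x D
    using that assms has_derivative_transform[of x S F G D] has_derivative_transform[of x S G F D] by metis
  moreover have "continuous_on S F \<longleftrightarrow> continuous_on S G" using assms by (rule continuous_on_cong[OF refl])
  ultimately show ?thesis by (cases k) auto
qed

lemma Ck_on_const: "Ck_on k S (\<lambda>_. c)"
  by (induction k arbitrary: c) (auto intro!: exI[of _ "\<lambda>_ _. 0"])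

text \<open>With \<open>L w = (w, 0)\<close> and \<open>a = (0, t)\<close> this restricts a function
  on space-time to the slice at time \<open>t\<close>.\<close>

lemma Ck_on_compose_affine:
  assumes "Ck_on k S F" "bounded_linear L" "\<And>x. x \<in> S' \<Longrightarrow> a + L x \<in> S"
  shows "Ck_on k S' (\<lambda>x. F (a + L x))"
  using assms(1)
proof (induction k arbitrary: F)
  case 0
  then show ?case using assms(3) linear_continuous_on[OF assms(2)]
    by (auto intro!: continuous_on_compose2[of S F] continuous_intros)
next
  case (Suc k)
  then obtain F' where F': "\<And>x. x \<in> S \<Longrightarrow> (F has_derivative F' x) (at x within S)"
    "\<And>v. Ck_on k S (\<lambda>x. F' x v)" by auto
  have "((\<lambda>x. F (a + L x)) has_derivative (\<lambda>v. F' (a + L x) (L v))) (at x within S')" if "x \<in> S'" for x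
  proof (rule has_derivative_in_compose2[where g = F and t = S and g' = F' and f = "\<lambda>x. a + L x"])
    show "((\<lambda>x. a + L x) has_derivative L) (at x within S')"
      using bounded_linear_imp_has_derivative[OF assms(2)] by (auto intro!: derivative_eq_intros)
  qed (use assms(3) that F' in auto)
  then show ?case using Suc.IH[OF F'(2)]
    by (auto intro!: exI[of _ "\<lambda>x v. F' (a + L x) (L v)"])
qed

lemma Ck_on_bounded_linear:
  assumes "Ck_on k S F" "bounded_linear L"
  shows "Ck_on k S (\<lambda>x. L (F x))"
  using assms(1)
proof (induction k arbitrary: F)
  case 0
  then show ?case by (simp add: bounded_linear.continuous_on[OF assms(2)])
next
  case (Suc k)
  from Suc.prems obtain F' where F': "\<And>x. x \<in> S \<Longrightarrow> (F has_derivative F' x) (at x within S)"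
    "\<And>v. Ck_on k S (\<lambda>x. F' x v)" by (rule Ck_on_SucE) blast
  show ?case
    by (rule Ck_on_SucI[OF bounded_linear.has_derivative[OF assms(2) F'(1)] Suc.IH[OF F'(2)]])
qed

lemma Ck_on_add:
  assumes "Ck_on k S F" "Ck_on k S G"
  shows "Ck_on k S (\<lambda>x. F x + G x)"
  using assms
proof (induction k arbitrary: F G)
  case (Suc k)
  from Suc.prems(1) obtain F' where F': "\<And>x. x \<in> S \<Longrightarrow> (F has_derivative F' x) (at x within S)"
    "\<And>v. Ck_on k S (\<lambda>x. F' x v)" by (rule Ck_on_SucE) blast
  from Suc.prems(2) obtain G' where G': "\<And>x. x \<in> S \<Longrightarrow> (G has_derivative G' x) (at x within S)"
    "\<And>v. Ck_on k S (\<lambda>x. G' x v)" by (rule Ck_on_SucE) blast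
  show ?case
    by (rule Ck_on_SucI[OF has_derivative_add[OF F'(1) G'(1)] Suc.IH[OF F'(2) G'(2)]])
qed (auto intro!: continuous_intros)

lemma Ck_on_mult:
  fixes F G :: "_ \<Rightarrow> 'b::real_normed_algebra"
  assumes "Ck_on k S F" "Ck_on k S G"
  shows "Ck_on k S (\<lambda>x. F x * G x)"
  using assms
proof (induction k arbitrary: F G)
  case (Suc k)
  from Suc.prems(1) obtain F' where F': "\<And>x. x \<in> S \<Longrightarrow> (F has_derivative F' x) (at x within S)"
    "\<And>v. Ck_on k S (\<lambda>x. F' x v)" by (rule Ck_on_SucE) blast
  from Suc.prems(2) obtain G' where G': "\<And>x. x \<in> S \<Longrightarrow> (G has_derivative G' x) (at x within S)"
    "\<And>v. Ck_on k S (\<lambda>x. G' x v)" by (rule Ck_on_SucE) blast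
  note low = Ck_on_Suc_imp[OF Suc.prems(1)] Ck_on_Suc_imp[OF Suc.prems(2)]
  show ?case
    by (rule Ck_on_SucI[OF has_derivative_mult[OF F'(1) G'(1)]
          Ck_on_add[OF Suc.IH[OF low(1) G'(2)] Suc.IH[OF F'(2) low(2)]]])
qed (auto intro!: continuous_intros)

lemma Ck_on_exp:
  fixes F :: "_ \<Rightarrow> real"
  assumes "Ck_on k S F"
  shows "Ck_on k S (\<lambda>x. exp (F x))"
  using assms
proof (induction k arbitrary: F)
  case (Suc k)
  from Suc.prems obtain F' where F': "\<And>x. x \<in> S \<Longrightarrow> (F has_derivative F' x) (at x within S)"
    "\<And>v. Ck_on k S (\<lambda>x. F' x v)" by (rule Ck_on_SucE) blast
  have D: "((\<lambda>x. exp (F x)) has_derivative (\<lambda>v. exp (F x) * F' x v)) (at x within S)" if "x \<in> S" for x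
    using F'(1)[OF that] by (auto intro!: derivative_eq_intros)
  show ?case
    by (rule Ck_on_SucI[OF D], assumption) (intro Ck_on_mult Suc.IH Ck_on_Suc_imp[OF Suc.prems] F'(2))
qed (auto intro!: continuous_intros)

lemma Ck_on_inverse:
  fixes F :: "_ \<Rightarrow> real"
  assumes "Ck_on k S F" "\<And>x. x \<in> S \<Longrightarrow> F x \<noteq> 0"
  shows "Ck_on k S (\<lambda>x. inverse (F x))"
  using assms(1)
proof (induction k)
  case (Suc k)
  from Suc.prems obtain F' where F': "\<And>x. x \<in> S \<Longrightarrow> (F has_derivative F' x) (at x within S)"
    "\<And>v. Ck_on k S (\<lambda>x. F' x v)" by (rule Ck_on_SucE) blast
  have i: "Ck_on k S (\<lambda>x. inverse (F x))" by (intro Suc.IH Ck_on_Suc_imp[OF Suc.prems])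
  have D: "((\<lambda>x. inverse (F x)) has_derivative (\<lambda>v. - (inverse (F x) * F' x v * inverse (F x)))) (at x within S)"
    if "x \<in> S" for x
    using F'(1)[OF that] assms(2)[OF that] by (auto intro!: derivative_eq_intros)
  show ?case
    by (rule Ck_on_SucI[OF D], assumption)
       (intro Ck_on_bounded_linear[OF _ bounded_linear_minus[OF bounded_linear_ident]] Ck_on_mult i F'(2))
qed (use assms(2) in \<open>auto intro!: continuous_intros\<close>)

lemma Ck_on_holomorphic:
  assumes "F holomorphic_on S" "open S"
  shows "Ck_on k S F"
  using assms(1)
proof (induction k arbitrary: F)
  case 0
  then show ?case by (simp add: holomorphic_on_imp_continuous_on)
next
  case (Suc k)
  have "Ck_on k S (deriv F)" using Suc assms(2) by (intro Suc.IH holomorphic_deriv)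
  then have "Ck_on k S (\<lambda>x. deriv F x * v)" for v by (intro Ck_on_mult Ck_on_const)
  moreover have "(F has_derivative (\<lambda>v. deriv F x * v)) (at x within S)" if "x \<in> S" for x
    using has_field_derivative_at_within[OF holomorphic_derivI[OF Suc.prems assms(2) that]]
    by (simp add: has_field_derivative_def)
  ultimately show ?case by (intro Ck_on_SucI)
qed

section \<open>From coordinate domains to the unit square\<close>

definition square_map :: "complex \<Rightarrow> real \<Rightarrow> real \<times> real \<Rightarrow> complex" where
  "square_map z0 r p = z0 + of_real r * Complex (fst p) (snd p)"

lemma bounded_linear_Complex: "bounded_linear (\<lambda>p. of_real r * Complex (fst p) (snd p))"
proof -
  have "(\<lambda>p. of_real r * Complex (fst p) (snd p)) = (\<lambda>p. of_real r * (of_real (fst p) + \<i> * of_real (snd p)))"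
    by (simp add: complex_eq_iff fun_eq_iff)
  moreover have "bounded_linear \<dots>"
    by (intro bounded_linear_compose[OF bounded_linear_mult_right] bounded_linear_add
        bounded_linear_compose[OF bounded_linear_of_real] bounded_linear_fst bounded_linear_snd)
  ultimately show ?thesis by simp
qed

lemma continuous_on_square_map [continuous_intros]: "continuous_on S (square_map z0 r)"
  unfolding square_map_def
  by (intro continuous_intros linear_continuous_on bounded_linear_Complex)

lemma square_map_partials:
  fixes F :: "complex \<Rightarrow> real"
  assumes D: "open D" "square_map z0 r ` unit_square \<subseteq> D"
    and F: "\<And>w. w \<in> D \<Longrightarrow> (F has_derivative F' w) (at w within D)"
    and c: "continuous_on D F" "\<And>v. continuous_on D (\<lambda>w. F' w v)"
  shows "partial_x (\<lambda>p. F (square_map z0 r p)) (\<lambda>p. r * F' (square_map z0 r p) 1)"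
    "partial_y (\<lambda>p. F (square_map z0 r p)) (\<lambda>p. r * F' (square_map z0 r p) \<i>)"
proof -
  have cc: "continuous_on unit_square (\<lambda>p. G (square_map z0 r p))" if "continuous_on D G" for G :: "complex \<Rightarrow> real"
    using D(2) by (intro continuous_on_compose2[OF that] continuous_intros)
  have lin: "F' w (of_real r * z) = r * F' w z" if "w \<in> D" for r w z
    using linear_cmul[OF has_derivative_linear[OF F[OF that]], of r z]
    by (simp only: scaleR_conv_of_real of_real_eq_id id_apply)
  have at: "(F has_derivative F' w) (at w)" if "w \<in> D" for w
    using F[OF that] by (simp only: at_within_open[OF that D(1)])
  have dx: "((\<lambda>s. F (square_map z0 r (s, y))) has_real_derivative r * F' (square_map z0 r (x, y)) 1) (at x within {-1..1})"
    and dy: "((\<lambda>s. F (square_map z0 r (x, s))) has_real_derivative r * F' (square_map z0 r (x, y)) \<i>) (at y within {-1..1})"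
    if "x \<in> {-1..1}" "y \<in> {-1..1}" for x y
  proof -
    have w: "square_map z0 r (x, y) \<in> D" using D(2) that unit_square_iff by blast
    have l1: "F' (square_map z0 r (x, y)) (of_real s) = s * F' (square_map z0 r (x, y)) 1" for s
      using lin[OF w, of s 1] by (simp only: mult_1_right)
    have "((\<lambda>s. square_map z0 r (s, y)) has_derivative (\<lambda>s. of_real r * of_real s)) (at x within {-1..1})"
      unfolding square_map_def Complex_eq fst_conv snd_conv
      by (rule has_derivative_eq_rhs, (rule derivative_intros)+) simp
    from has_derivative_compose[OF this at[OF w]]
    have "((\<lambda>s. F (square_map z0 r (s, y))) has_derivative (\<lambda>s. F' (square_map z0 r (x, y)) (of_real r * of_real s))) (at x within {-1..1})" .
    moreover have "F' (square_map z0 r (x, y)) (of_real r * of_real s) = r * F' (square_map z0 r (x, y)) 1 * s" for s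
      by (simp only: lin[OF w] l1 mult_ac)
    ultimately show "((\<lambda>s. F (square_map z0 r (s, y))) has_real_derivative r * F' (square_map z0 r (x, y)) 1) (at x within {-1..1})"
      by (simp add: has_field_derivative_def)
    have "((\<lambda>s. square_map z0 r (x, s)) has_derivative (\<lambda>s. of_real r * (of_real s * \<i>))) (at y within {-1..1})"
      unfolding square_map_def Complex_eq fst_conv snd_conv
      by (rule has_derivative_eq_rhs, (rule derivative_intros)+) (simp add: mult.commute)
    from has_derivative_compose[OF this at[OF w]]
    have "((\<lambda>s. F (square_map z0 r (x, s))) has_derivative (\<lambda>s. F' (square_map z0 r (x, y)) (of_real r * (of_real s * \<i>)))) (at y within {-1..1})" .
    moreover have "F' (square_map z0 r (x, y)) (of_real r * (of_real s * \<i>)) = r * F' (square_map z0 r (x, y)) \<i> * s" for s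
      unfolding lin[OF w] by (simp only: mult_ac)
    ultimately show "((\<lambda>s. F (square_map z0 r (x, s))) has_real_derivative r * F' (square_map z0 r (x, y)) \<i>) (at y within {-1..1})"
      by (simp add: has_field_derivative_def)
  qed
  show "partial_x (\<lambda>p. F (square_map z0 r p)) (\<lambda>p. r * F' (square_map z0 r p) 1)"
    unfolding partial_x_def using dx cc[OF c(1)] cc[OF c(2)] by (auto intro!: continuous_intros)
  show "partial_y (\<lambda>p. F (square_map z0 r p)) (\<lambda>p. r * F' (square_map z0 r p) \<i>)"
    unfolding partial_y_def using dy cc[OF c(1)] cc[OF c(2)] by (auto intro!: continuous_intros)
qed

text \<open>The Euclidean Laplacian is the real part of
  \<open>4 * wirtinger_z (wirtinger_zbar V)\<close>, the mixed derivatives contributing only to the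
  imaginary part. The factor \<open>r^2\<close> comes from the scaling of the square.\<close>

lemma partial_laplacian:
  fixes V :: "complex \<Rightarrow> real"
  assumes D: "open D" "square_map z0 r ` unit_square \<subseteq> D" and V: "Ck_on 2 D V"
  obtains Vx Vy Vxx Vyy where
    "partial_x (\<lambda>p. V (square_map z0 r p)) Vx" "partial_y (\<lambda>p. V (square_map z0 r p)) Vy"
    "partial_x Vx Vxx" "partial_y Vy Vyy"
    "\<And>p. p \<in> unit_square \<Longrightarrow> Vxx p + Vyy p
       = 4 * r\<^sup>2 * Re (wirtinger_z (wirtinger_zbar (\<lambda>w. complex_of_real (V w))) (square_map z0 r p))"
proof -
  from V have "Ck_on (Suc 1) D V" by (simp only: numeral_2_eq_2 One_nat_def)
  then obtain V' where V': "\<And>w. w \<in> D \<Longrightarrow> (V has_derivative V' w) (at w within D)" "\<And>v. Ck_on 1 D (\<lambda>w. V' w v)"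
    by (rule Ck_on_SucE) blast
  have "\<exists>W. (\<forall>x\<in>D. ((\<lambda>w. V' w v) has_derivative W x) (at x within D)) \<and> (\<forall>z. continuous_on D (\<lambda>x. W x z))" for v
  proof -
    from V'(2)[of v] have "Ck_on (Suc 0) D (\<lambda>w. V' w v)" by (simp only: One_nat_def)
    then show ?thesis by (rule Ck_on_SucE) (auto simp: Ck_on.simps(1))
  qed
  then have "\<forall>v. \<exists>W. (\<forall>x\<in>D. ((\<lambda>w. V' w v) has_derivative W x) (at x within D)) \<and> (\<forall>z. continuous_on D (\<lambda>x. W x z))"
    by blast
  \<comment> \<open>\<open>Ck_on\<close> provides a second derivative for each direction
    \<open>v\<close> separately; choice joins them into one function.\<close>
  from choice[OF this] obtain W where W: "\<And>v x. x \<in> D \<Longrightarrow> ((\<lambda>w. V' w v) has_derivative W v x) (at x within D)"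
      "\<And>v z. continuous_on D (\<lambda>x. W v x z)"
    by blast
  have c: "continuous_on D V" "\<And>v. continuous_on D (\<lambda>w. V' w v)"
    using Ck_on_imp_continuous_on[OF V] Ck_on_imp_continuous_on[OF V'(2)] by blast+
  have cm: "continuous_on D (\<lambda>w. r * V' w v)" "continuous_on D (\<lambda>x. r * W v x z)" for v z
    by (intro continuous_intros c W)+
  have dm: "((\<lambda>w. r * V' w v) has_derivative (\<lambda>z. r * W v x z)) (at x within D)" if "x \<in> D" for v x
    by (intro has_derivative_mult_right W(1) that)
  have P: "partial_x (\<lambda>p. V (square_map z0 r p)) (\<lambda>p. r * V' (square_map z0 r p) 1)"
    "partial_y (\<lambda>p. V (square_map z0 r p)) (\<lambda>p. r * V' (square_map z0 r p) \<i>)"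
    by (rule square_map_partials[OF D V'(1) c]; assumption)+
  have PP: "partial_x (\<lambda>p. r * V' (square_map z0 r p) 1) (\<lambda>p. r * (r * W 1 (square_map z0 r p) 1))"
    by (rule square_map_partials(1)[where F = "\<lambda>w. r * V' w 1" and F' = "\<lambda>w z. r * W 1 w z", OF D dm cm]; assumption)
  have PP2: "partial_y (\<lambda>p. r * V' (square_map z0 r p) \<i>) (\<lambda>p. r * (r * W \<i> (square_map z0 r p) \<i>))"
    by (rule square_map_partials(2)[where F = "\<lambda>w. r * V' w \<i>" and F' = "\<lambda>w z. r * W \<i> w z", OF D dm cm]; assumption)
  show ?thesis
  proof (rule that[OF P PP PP2])
    fix p assume "p \<in> unit_square"
    define w where "w = square_map z0 r p"
    have w: "w \<in> D" unfolding w_def using D(2) \<open>p \<in> unit_square\<close> by blast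
    have "wirtinger_zbar (\<lambda>w. complex_of_real (V w)) x = (of_real (V' x 1) + \<i> * of_real (V' x \<i>)) / 2" if "x \<in> D" for x
    proof -
      have "(V has_derivative V' x) (at x)"
        using V'(1)[OF that] by (simp only: at_within_open[OF that D(1)])
      then have "((\<lambda>w. complex_of_real (V w)) has_derivative (\<lambda>d. of_real (V' x d))) (at x)"
        by (rule has_derivative_of_real)
      from frechet_derivative_at[OF this, symmetric] show ?thesis
        by (simp only: wirtinger_zbar_def)
    qed
    note eq = this
    have at: "((\<lambda>x. V' x v) has_derivative W v w) (at w)" for v
      using W(1)[OF w] by (simp only: at_within_open[OF w D(1)])
    have "((\<lambda>x. (complex_of_real (V' x 1) + \<i> * of_real (V' x \<i>)) / 2) has_derivative
        (\<lambda>d. (of_real (W 1 w d) + \<i> * of_real (W \<i> w d)) / 2)) (at w)"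
      using has_derivative_of_real[OF at[of 1]] has_derivative_of_real[OF at[of \<i>]]
      unfolding divide_inverse by (intro has_derivative_mult_left has_derivative_add has_derivative_mult_right)
    then have "(wirtinger_zbar (\<lambda>w. complex_of_real (V w)) has_derivative
        (\<lambda>d. (of_real (W 1 w d) + \<i> * of_real (W \<i> w d)) / 2)) (at w)"
      by (rule has_derivative_transform_within_open[OF _ D(1) w]) (simp add: eq)
    note fd = frechet_derivative_at[OF this, symmetric]
    have "Re (wirtinger_z (wirtinger_zbar (\<lambda>w. complex_of_real (V w))) w) = (W 1 w 1 + W \<i> w \<i>) / 4"
      unfolding wirtinger_z_def fd by (simp add: field_simps)
    then show "r * (r * W 1 (square_map z0 r p) 1) + r * (r * W \<i> (square_map z0 r p) \<i>) =
       4 * r\<^sup>2 * Re (wirtinger_z (wirtinger_zbar (\<lambda>w. complex_of_real (V w))) (square_map z0 r p))"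
      by (simp add: w_def power2_eq_square algebra_simps)
  qed
qed

section \<open>The metric and its curvature\<close>

lemma chart_simps:
  assumes "is_chart c"
  shows "open (dom_of c)" "open (coord c ` dom_of c)" "continuous_on (dom_of c) (coord c)"
    "continuous_on (coord c ` dom_of c) (inv_coord c)"
    "x \<in> dom_of c \<Longrightarrow> inv_coord c (coord c x) = x"
    "w \<in> coord c ` dom_of c \<Longrightarrow> coord c (inv_coord c w) = w"
    "w \<in> coord c ` dom_of c \<Longrightarrow> inv_coord c w \<in> dom_of c"
  using assms unfolding is_chart_def homeomorphism_def by auto

lemma chart_image:
  assumes "is_chart c" "U \<subseteq> dom_of c"
  shows "coord c ` U = coord c ` dom_of c \<inter> inv_coord c -` U"
  using chart_simps[OF assms(1)] assms(2) by force

lemma open_chart_image: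
  assumes "is_chart c" "open U" "U \<subseteq> dom_of c"
  shows "open (coord c ` U)"
  unfolding chart_image[OF assms(1,3)]
  using chart_simps(4)[OF assms(1)] assms(2)
  unfolding continuous_on_open_vimage[OF chart_simps(2)[OF assms(1)]]
  by (simp add: Int_commute)

lemma coord_deriv_self:
  assumes "is_chart c" "x \<in> dom_of c"
  shows "coord_deriv c c x = 1"
proof -
  have "((coord c \<circ> inv_coord c) has_field_derivative 1) (at (coord c x))"
  proof (rule has_field_derivative_transform_within_open[where f = "\<lambda>w. w"])
    show "open (coord c ` dom_of c)" using chart_simps[OF assms(1)] by blast
  qed (use assms chart_simps[OF assms(1)] in auto)
  then show ?thesis by (simp add: coord_deriv_def DERIV_imp_deriv)
qed

lemma chart_cp1: "b \<in> cp1_atlas \<Longrightarrow> is_chart b"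
  using riemann_surface_cp1 by (auto simp: riemann_surface_def)

text \<open>The parallelogram law for \<open>z^2\<close> and 1. The same expression arises in the
  \<open>zeta\<close> and in the \<open>eta\<close> coordinate, which makes the formula for the
  metric uniform over both charts.\<close>

lemma sections_norm:
  "(cmod z)\<^sup>2 + (cmod (- 1 / 2 + 1 / 2 * z\<^sup>2))\<^sup>2 + (cmod (- \<i> / 2 + - \<i> / 2 * z\<^sup>2))\<^sup>2 = (1 + (cmod z)\<^sup>2)\<^sup>2 / 2"
proof -
  obtain a b where z: "z = Complex a b" by (cases z)
  show ?thesis unfolding cmod_power2 z by (simp add: power2_eq_square) (simp add: field_simps)
qed

section \<open>The reference metric and its curvature in local holomorphic data\<close>

locale spinorial_pair =
  fixes A :: "'a::t2_space chart set" and \<phi> :: "'a \<Rightarrow> cp1"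
    and h :: "'a chart \<Rightarrow> cp1 chart \<Rightarrow> 'a \<Rightarrow> complex"
  assumes pair: "vanishing_spinorial_pair A \<phi> h"
begin

abbreviation "g \<equiv> spinorial_metric \<phi> h"

text \<open>On \<open>W c b\<close> a chart of the surface and one of the projective line are both
  fixed. Metric and curvature are there explicit in two holomorphic functions: \<open>H\<close>, the
  coefficient of the bundle isomorphism, and \<open>Z\<close>, the map in coordinates.\<close>

definition W :: "'a chart \<Rightarrow> cp1 chart \<Rightarrow> complex set" where
  "W c b = coord c ` (dom_of c \<inter> \<phi> -` dom_of b)"

definition H :: "'a chart \<Rightarrow> cp1 chart \<Rightarrow> complex \<Rightarrow> complex" where
  "H c b = h c b \<circ> inv_coord c"

definition Z :: "'a chart \<Rightarrow> cp1 chart \<Rightarrow> complex \<Rightarrow> complex" where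
  "Z c b = coord b \<circ> \<phi> \<circ> inv_coord c"

lemma chart: "c \<in> A \<Longrightarrow> is_chart c"
  and cover: "(\<Union>c\<in>A. dom_of c) = UNIV"
  and compact: "compact (UNIV :: 'a set)"
  and continuous_phi: "continuous_on UNIV \<phi>"
  using pair by (auto simp: vanishing_spinorial_pair_def riemann_surface_def holomorphic_map_def)

text \<open>\<open>pullback_form\<close> prefers the \<open>zeta\<close> chart. The transition
  factors of \<open>h\<close> and of the vector field agree, so any admissible chart gives the same
  value.\<close>

lemma pullback_form_eq:
  assumes c: "c \<in> A" and b: "b \<in> cp1_atlas" and x: "x \<in> dom_of c" "\<phi> x \<in> dom_of b"
    and v: "holomorphic_vector_field cp1_atlas v"
  shows "pullback_form \<phi> h v c x = h c b x * v b (\<phi> x)"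
proof -
  define b0 where "b0 = (if \<phi> x \<in> dom_of zeta_chart then zeta_chart else eta_chart)"
  have b0: "b0 \<in> cp1_atlas" "\<phi> x \<in> dom_of b0"
    using cp1_cover by (auto simp: b0_def cp1_atlas_def)
  have "h c b0 x = h c b x * coord_deriv c c x * coord_deriv b b0 (\<phi> x)"
    using pair c b b0 x unfolding vanishing_spinorial_pair_def tangent_pullback_iso_canonical_def by blast
  then have "h c b0 x = h c b x * coord_deriv b b0 (\<phi> x)"
    using coord_deriv_self[OF chart[OF c] x(1)] by simp
  moreover have "v b (\<phi> x) = coord_deriv b b0 (\<phi> x) * v b0 (\<phi> x)"
    using v b b0 x unfolding holomorphic_vector_field_def by blast
  ultimately show ?thesis by (simp add: pullback_form_def b0_def[symmetric] Let_def)
qed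

lemma spinorial_metric_eq:
  assumes "c \<in> A" "b \<in> cp1_atlas" "x \<in> dom_of c" "\<phi> x \<in> dom_of b"
  shows "g c x = (cmod (h c b x))\<^sup>2 * (1 + (cmod (coord b (\<phi> x)))\<^sup>2)\<^sup>2 / 2"
proof -
  define z where "z = coord b (\<phi> x)"
  have "(cmod (phi1 b (\<phi> x)))\<^sup>2 + (cmod (phi2 b (\<phi> x)))\<^sup>2 + (cmod (phi3 b (\<phi> x)))\<^sup>2 = (1 + (cmod z)\<^sup>2)\<^sup>2 / 2"
  proof (cases "b = zeta_chart")
    case True
    then have "z = cp1_zeta (\<phi> x)" by (simp add: z_def zeta_chart_def)
    then show ?thesis using sections_norm[of z] True
      by (simp add: phi1_def phi2_def phi3_def cp1_field_def)
  next
    case False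
    then have "b = eta_chart" using assms(2) by (auto simp: cp1_atlas_def)
    then have z: "z = cp1_eta (\<phi> x)" by (simp add: z_def eta_chart_def)
    have "cmod (phi2 b (\<phi> x)) = cmod (- 1 / 2 + 1 / 2 * z\<^sup>2)"
      using norm_minus_commute[of "z\<^sup>2 / 2" "1 / 2"] False by (simp add: phi2_def cp1_field_def z)
    moreover have "cmod (phi3 b (\<phi> x)) = cmod (- \<i> / 2 + - \<i> / 2 * z\<^sup>2)"
      using False norm_minus_cancel[of "- \<i> / 2 * z\<^sup>2 + - \<i> / 2"] by (simp add: phi3_def cp1_field_def z add.commute)
    moreover have "cmod (phi1 b (\<phi> x)) = cmod z"
      using False by (simp add: phi1_def cp1_field_def z)
    ultimately show ?thesis using sections_norm[of z] by simp
  qed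
  moreover have "g c x = (cmod (h c b x))\<^sup>2 * ((cmod (phi1 b (\<phi> x)))\<^sup>2 + (cmod (phi2 b (\<phi> x)))\<^sup>2 + (cmod (phi3 b (\<phi> x)))\<^sup>2)"
    unfolding spinorial_metric_def phi1_def phi2_def phi3_def
    using pullback_form_eq[OF assms holomorphic_vector_field_cp1_field]
    by (simp add: norm_mult power_mult_distrib algebra_simps)
  ultimately show ?thesis by (simp add: z_def)
qed

lemma cp1_chart_exists: "\<exists>b\<in>cp1_atlas. \<phi> x \<in> dom_of b"
  using cp1_cover by (auto simp: cp1_atlas_def)

lemma h_nonzero:
  assumes "c \<in> A" "b \<in> cp1_atlas" "x \<in> dom_of c" "\<phi> x \<in> dom_of b"
  shows "h c b x \<noteq> 0"
  using pair assms unfolding vanishing_spinorial_pair_def tangent_pullback_iso_canonical_def by blast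

text \<open>Positivity is where the bundle map being an isomorphism enters: \<open>h\<close> has no
  zeros.\<close>

lemma metric_pos: "c \<in> A \<Longrightarrow> x \<in> dom_of c \<Longrightarrow> g c x > 0"
proof -
  assume c: "c \<in> A" "x \<in> dom_of c"
  obtain b where b: "b \<in> cp1_atlas" "\<phi> x \<in> dom_of b" using cp1_chart_exists by blast
  have "0 < 1 + (cmod (coord b (\<phi> x)))\<^sup>2" by (smt (verit) zero_le_power2)
  then show "g c x > 0" unfolding spinorial_metric_eq[OF c(1) b(1) c(2) b(2)] using h_nonzero[OF c(1) b(1) c(2) b(2)] by simp
qed

lemma metric_transform:
  assumes "c \<in> A" "c' \<in> A" "x \<in> dom_of c" "x \<in> dom_of c'"
  shows "g c' x = (cmod (coord_deriv c c' x))\<^sup>2 * g c x"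
proof -
  obtain b where b: "b \<in> cp1_atlas" "\<phi> x \<in> dom_of b" using cp1_chart_exists by blast
  have "h c' b x = h c b x * coord_deriv c c' x * coord_deriv b b (\<phi> x)"
    using pair assms b unfolding vanishing_spinorial_pair_def tangent_pullback_iso_canonical_def by blast
  then have "h c' b x = h c b x * coord_deriv c c' x"
    using coord_deriv_self[OF chart_cp1[OF b(1)] b(2)] by simp
  then show ?thesis
    unfolding spinorial_metric_eq[OF assms(1) b(1) assms(3) b(2)] spinorial_metric_eq[OF assms(2) b(1) assms(4) b(2)]
    by (simp add: norm_mult power_mult_distrib)
qed

context
  fixes c b assumes c: "c \<in> A" and b: "b \<in> cp1_atlas"
begin

lemma open_W: "open (W c b)"
  unfolding W_def
  using open_Int[OF chart_simps(1)[OF chart[OF c]]] open_vimage[OF chart_simps(1)[OF chart_cp1[OF b]] continuous_phi]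
  by (intro open_chart_image[OF chart[OF c]]) auto

lemma W_D: "w \<in> W c b \<Longrightarrow> inv_coord c w \<in> dom_of c" "w \<in> W c b \<Longrightarrow> \<phi> (inv_coord c w) \<in> dom_of b"
  "w \<in> W c b \<Longrightarrow> coord c (inv_coord c w) = w" "W c b \<subseteq> coord c ` dom_of c"
  using chart_simps[OF chart[OF c]] by (auto simp: W_def)

lemma holomorphic_HZ: "H c b holomorphic_on W c b" "Z c b holomorphic_on W c b"
  using pair c b
  unfolding vanishing_spinorial_pair_def tangent_pullback_iso_canonical_def holomorphic_map_def H_def Z_def W_def
  by blast+

lemma H_nonzero: "w \<in> W c b \<Longrightarrow> H c b w \<noteq> 0"
  using h_nonzero[OF c b] W_D by (simp add: H_def)

lemma metric_W:
  "w \<in> W c b \<Longrightarrow> g c (inv_coord c w) = (cmod (H c b w))\<^sup>2 * (1 + (cmod (Z c b w))\<^sup>2)\<^sup>2 / 2"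
  using spinorial_metric_eq[OF c b] W_D by (simp add: H_def Z_def)

text \<open>\<open>ln g = ln |H|^2 + 2 * ln (1 + |Z|^2) - ln 2\<close>. The first summand is
  harmonic because \<open>H\<close> is holomorphic without zeros; the second gives
  \<open>2 * |Z'|^2 / (1 + |Z|^2)^2\<close>, the pulled back Fubini-Study density. The result is
  smooth and nonpositive, also at zeros of \<open>Z'\<close>.\<close>

lemma curvature_W:
  assumes w: "w \<in> W c b"
  shows "gauss_curvature g c (inv_coord c w) =
     - (4 * (cmod (deriv (Z c b) w))\<^sup>2 / ((cmod (H c b w))\<^sup>2 * (1 + (cmod (Z c b w))\<^sup>2) ^ 4))"
proof -
  define Hf where "Hf = H c b"
  define Zf where "Zf = Z c b"
  \<comment> \<open>The logarithmic derivative of \<open>H\<close> takes the place of a local branch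
    of its logarithm.\<close>
  define L where "L = (\<lambda>w. deriv Hf w / Hf w)"
  define P where "P = (\<lambda>w. 1 + Zf w * cnj (Zf w))"
  have hol: "Hf holomorphic_on W c b" "Zf holomorphic_on W c b"
    using holomorphic_HZ by (auto simp: Hf_def Zf_def)
  have Hn: "Hf x \<noteq> 0" if "x \<in> W c b" for x using H_nonzero[OF that] by (simp add: Hf_def)
  have P: "P x = of_real (1 + (cmod (Zf x))\<^sup>2)" for x
    by (simp only: P_def of_real_add of_real_1 complex_norm_square)
  have P0: "1 + (cmod (Zf x))\<^sup>2 > 0" for x by (smt (verit) zero_le_power2)
  have Pn: "P x \<noteq> 0" for x
    unfolding P of_real_eq_0_iff using P0[of x] by simp
  have dH: "(Hf has_derivative (\<lambda>d. deriv Hf x * d)) (at x)"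
    and dZ: "(Zf has_derivative (\<lambda>d. deriv Zf x * d)) (at x)" 
    and dZ': "(deriv Zf has_derivative (\<lambda>d. deriv (deriv Zf) x * d)) (at x)"
    and dL: "(L has_derivative (\<lambda>d. deriv L x * d)) (at x)" if "x \<in> W c b" for x
  proof -
    have "deriv Zf holomorphic_on W c b" "L holomorphic_on W c b"
      unfolding L_def using hol open_W Hn by (auto intro!: holomorphic_intros)
    then show "(Hf has_derivative (\<lambda>d. deriv Hf x * d)) (at x)" "(Zf has_derivative (\<lambda>d. deriv Zf x * d)) (at x)"
      "(deriv Zf has_derivative (\<lambda>d. deriv (deriv Zf) x * d)) (at x)" "(L has_derivative (\<lambda>d. deriv L x * d)) (at x)"
      using holomorphic_derivI[OF _ open_W that] hol by (auto simp: has_field_derivative_def)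
  qed
  have zbar: "wirtinger_zbar (\<lambda>y. complex_of_real (ln (g c (inv_coord c y)))) x
      = cnj (L x) + 2 * (Zf x * cnj (deriv Zf x)) / P x" if x: "x \<in> W c b" for x
  proof -
    \<comment> \<open>Chosen so that the real derivative of \<open>ln g\<close> is
      \<open>2 * Re (a * d)\<close>, whose \<open>zbar\<close> part is \<open>cnj a\<close>.\<close>
    define a where "a = L x + 2 * (cnj (Zf x) * deriv Zf x) / P x"
    have r1: "((\<lambda>y. (cmod (Hf y))\<^sup>2) has_derivative (\<lambda>d. 2 * Re (cnj (Hf x) * (deriv Hf x * d)))) (at x)"
      unfolding cmod_power2 using dH[OF x]
      by (auto intro!: derivative_eq_intros simp: algebra_simps)
    have r2: "((\<lambda>y. (cmod (Zf y))\<^sup>2) has_derivative (\<lambda>d. 2 * Re (cnj (Zf x) * (deriv Zf x * d)))) (at x)"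
      unfolding cmod_power2 using dZ[OF x]
      by (auto intro!: derivative_eq_intros simp: algebra_simps)
    have "((\<lambda>y. ln ((cmod (Hf y))\<^sup>2) + 2 * ln (1 + (cmod (Zf y))\<^sup>2) - ln 2) has_derivative
       (\<lambda>d. 2 * Re (cnj (Hf x) * (deriv Hf x * d)) / (cmod (Hf x))\<^sup>2
          + 2 * (2 * Re (cnj (Zf x) * (deriv Zf x * d)) / (1 + (cmod (Zf x))\<^sup>2)))) (at x)"
    proof -
      have r2': "((\<lambda>y. 1 + (cmod (Zf y))\<^sup>2) has_derivative (\<lambda>d. 2 * Re (cnj (Zf x) * (deriv Zf x * d)))) (at x)"
        using has_derivative_add[OF has_derivative_const r2] by simp
      have "0 < (cmod (Hf x))\<^sup>2" using Hn[OF x] by simp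
      from has_derivative_ln[OF this r1] has_derivative_ln[OF P0 r2'] show ?thesis
        unfolding divide_inverse
        by (intro has_derivative_diff[where g' = "\<lambda>_. 0", simplified] has_derivative_add has_derivative_mult_right has_derivative_const)
    qed
    moreover have "2 * Re (cnj (Hf x) * (deriv Hf x * d)) / (cmod (Hf x))\<^sup>2
          + 2 * (2 * Re (cnj (Zf x) * (deriv Zf x * d)) / (1 + (cmod (Zf x))\<^sup>2)) = 2 * Re (a * d)" for d
    proof -
      have "cnj (Hf x) * (deriv Hf x * d) / of_real ((cmod (Hf x))\<^sup>2) = L x * d"
        using Hn[OF x] unfolding L_def complex_norm_square by (simp add: field_simps)
      then have 1: "Re (cnj (Hf x) * (deriv Hf x * d)) / (cmod (Hf x))\<^sup>2 = Re (L x * d)"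
        by (metis Re_divide_of_real)
      have 2: "Re (cnj (Zf x) * (deriv Zf x * d)) / (1 + (cmod (Zf x))\<^sup>2) = Re (cnj (Zf x) * (deriv Zf x * d) / P x)"
        unfolding P by (rule Re_divide_of_real[symmetric])
      have "a * d = L x * d + of_real 2 * (cnj (Zf x) * (deriv Zf x * d) / P x)"
        by (simp add: a_def algebra_simps)
      then have "Re (a * d) = Re (L x * d) + 2 * Re (cnj (Zf x) * (deriv Zf x * d) / P x)"
        by (simp only: plus_complex.sel times_complex.sel Re_complex_of_real Im_complex_of_real)
      then show ?thesis unfolding times_divide_eq_right[symmetric] 1 2 by simp
    qed
    ultimately have "((\<lambda>y. ln ((cmod (Hf y))\<^sup>2) + 2 * ln (1 + (cmod (Zf y))\<^sup>2) - ln 2) has_derivative (\<lambda>d. 2 * Re (a * d))) (at x)"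
      by simp
    then have "((\<lambda>y. ln (g c (inv_coord c y))) has_derivative (\<lambda>d. 2 * Re (a * d))) (at x)"
    proof (rule has_derivative_transform_within_open[OF _ open_W x])
      fix y assume y: "y \<in> W c b"
      have "ln (g c (inv_coord c y)) = ln ((cmod (Hf y))\<^sup>2 * (1 + (cmod (Zf y))\<^sup>2)\<^sup>2) - ln 2"
        using Hn[OF y] P0[of y] unfolding metric_W[OF y] Hf_def[symmetric] Zf_def[symmetric]
        by (subst ln_div) auto
      also have "\<dots> = ln ((cmod (Hf y))\<^sup>2) + ln ((1 + (cmod (Zf y))\<^sup>2)\<^sup>2) - ln 2"
        using Hn[OF y] P0[of y] by (subst ln_mult) auto
      also have "ln ((1 + (cmod (Zf y))\<^sup>2)\<^sup>2) = 2 * ln (1 + (cmod (Zf y))\<^sup>2)"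
        using P0[of y] by (subst ln_realpow) auto
      finally show "ln ((cmod (Hf y))\<^sup>2) + 2 * ln (1 + (cmod (Zf y))\<^sup>2) - ln 2 = ln (g c (inv_coord c y))" by simp
    qed
    then have "((\<lambda>y. complex_of_real (ln (g c (inv_coord c y)))) has_derivative (\<lambda>d. of_real (2 * Re (a * d)))) (at x)"
      by (rule has_derivative_of_real)
    moreover have "of_real (2 * Re (a * d)) = a * d + cnj a * cnj d" for d
      using complex_add_cnj[of "a * d"] by simp
    ultimately have "((\<lambda>y. complex_of_real (ln (g c (inv_coord c y)))) has_derivative (\<lambda>d. a * d + cnj a * cnj d)) (at x)"
      by simp
    note fd = frechet_derivative_at[OF this, symmetric]
    have "wirtinger_zbar (\<lambda>y. complex_of_real (ln (g c (inv_coord c y)))) x = cnj a"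
      unfolding wirtinger_zbar_def fd by (simp add: algebra_simps)
    also have "cnj a = cnj (L x) + 2 * (Zf x * cnj (deriv Zf x)) / P x"
    proof -
      have "cnj (P x) = P x" unfolding P by simp
      then show ?thesis by (simp add: a_def)
    qed
    finally show ?thesis .
  qed
  have dP: "(P has_derivative (\<lambda>d. deriv Zf w * d * cnj (Zf w) + Zf w * cnj (deriv Zf w * d))) (at w)"
    unfolding P_def
    by (rule has_derivative_eq_rhs, (rule derivative_intros dZ[OF w] has_derivative_cnj)+) (simp add: algebra_simps)
  have "((\<lambda>x. cnj (L x) + 2 * (Zf x * cnj (deriv Zf x)) / P x) has_derivative
     (\<lambda>d. cnj (deriv L w * d) + (2 * (deriv Zf w * d * cnj (deriv Zf w) + Zf w * cnj (deriv (deriv Zf) w * d)) * P w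
         - 2 * (Zf w * cnj (deriv Zf w)) * (deriv Zf w * d * cnj (Zf w) + Zf w * cnj (deriv Zf w * d))) / (P w * P w))) (at w)"
    by (rule has_derivative_eq_rhs,
        (rule derivative_intros dZ[OF w] dZ'[OF w] dP dL[OF w] has_derivative_cnj Pn has_derivative_divide')+)
       (simp add: algebra_simps)
  then have "(wirtinger_zbar (\<lambda>y. complex_of_real (ln (g c (inv_coord c y)))) has_derivative
     (\<lambda>d. cnj (deriv L w * d) + (2 * (deriv Zf w * d * cnj (deriv Zf w) + Zf w * cnj (deriv (deriv Zf) w * d)) * P w
         - 2 * (Zf w * cnj (deriv Zf w)) * (deriv Zf w * d * cnj (Zf w) + Zf w * cnj (deriv Zf w * d))) / (P w * P w))) (at w)"
    by (rule has_derivative_transform_within_open[OF _ open_W w]) (simp add: zbar)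
  note fd = frechet_derivative_at[OF this, symmetric]
  \<comment> \<open>The antiholomorphic terms, among them \<open>cnj (L x)\<close>, drop out; the
    two that remain combine by \<open>P w - Z * cnj Z = 1\<close>.\<close>
  have "wirtinger_z (wirtinger_zbar (\<lambda>y. complex_of_real (ln (g c (inv_coord c y))))) w
    = (2 * (deriv Zf w * cnj (deriv Zf w)) * P w - 2 * (Zf w * cnj (deriv Zf w)) * (deriv Zf w * cnj (Zf w))) / (P w * P w)"
    unfolding wirtinger_z_def fd using Pn[of w] by (simp add: field_simps)
  also have "\<dots> = 2 * (deriv Zf w * cnj (deriv Zf w)) / (P w * P w)"
    by (simp add: P_def algebra_simps)
  also have "\<dots> = of_real (2 * (cmod (deriv Zf w))\<^sup>2 / (1 + (cmod (Zf w))\<^sup>2)\<^sup>2)"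
    by (simp add: P power2_eq_square flip: complex_norm_square)
  finally have "ddbar c (\<lambda>y. ln (g c y)) (inv_coord c w) = 2 * (cmod (deriv Zf w))\<^sup>2 / (1 + (cmod (Zf w))\<^sup>2)\<^sup>2"
    unfolding ddbar_def W_D(3)[OF w] by simp
  then show ?thesis
    unfolding gauss_curvature_def metric_W[OF w] Hf_def[symmetric] Zf_def[symmetric]
    using P0[of w] Hn[OF w] by (simp add: field_simps eval_nat_numeral)
qed

end

end

section \<open>The area measure\<close>

text \<open>The change of variables with determinants takes place in \<open>real^2\<close>; this
  transports its Lebesgue measure to the complex plane.\<close>

lemma distr_lborel_vec_complex:
  "distr (lborel :: (real^2) measure) borel (\<lambda>v. Complex (v $ 1) (v $ 2)) = lborel"
proof (rule lborel_eqI[symmetric])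
  have meas: "(\<lambda>v::real^2. Complex (v $ 1) (v $ 2)) \<in> borel_measurable borel"
    unfolding Complex_eq by (intro borel_measurable_continuous_onI continuous_intros)
  fix l u :: complex assume "\<And>b. b \<in> Basis \<Longrightarrow> l \<bullet> b \<le> u \<bullet> b"
  from this[of 1] this[of \<i>] have lu: "Re l \<le> Re u" "Im l \<le> Im u" by (auto simp: Basis_complex_def)
  define J :: "complex \<Rightarrow> real^2" where "J z = (\<chi> i. if i = 1 then Re z else Im z)" for z
  have J: "J z $ 1 = Re z" "J z $ 2 = Im z" for z by (simp_all add: J_def)
  have B: "Basis = {axis 1 1, axis 2 1 :: real^2}"
    by (auto simp: Basis_vec_def UNIV_2) 
  have ne: "axis 1 1 \<noteq> (axis 2 1 :: real^2)" by (simp add: axis_eq_axis)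
  have "(\<lambda>v::real^2. Complex (v $ 1) (v $ 2)) -` box l u = box (J l) (J u)"
    by (auto simp: box_def B Basis_complex_def inner_axis J)
  then have "emeasure (distr (lborel :: (real^2) measure) borel (\<lambda>v. Complex (v $ 1) (v $ 2))) (box l u)
    = emeasure lborel (box (J l) (J u))"
    using meas by (subst emeasure_distr) auto
  also have "\<dots> = (\<Prod>b\<in>Basis. (J u - J l) \<bullet> b)"
    using lu by (intro emeasure_lborel_box) (auto simp: B inner_axis J Basis_complex_def)
  also have "(\<Prod>b\<in>Basis. (J u - J l) \<bullet> b) = (\<Prod>b\<in>Basis. (u - l) \<bullet> b)"
    using ne by (simp add: B inner_axis J Basis_complex_def)
  finally show "emeasure (distr (lborel :: (real^2) measure) borel (\<lambda>v. Complex (v $ 1) (v $ 2))) (box l u)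
    = (\<Prod>b\<in>Basis. (u - l) \<bullet> b)" .
qed simp

text \<open>The same transport from \<open>real \<times> real\<close>, the space that contains the
  unit square.\<close>

lemma distr_lborel_prod_complex:
  "distr (lborel :: (real \<times> real) measure) borel (\<lambda>p. Complex (fst p) (snd p)) = lborel"
proof (rule lborel_eqI[symmetric])
  have meas: "(\<lambda>p::real\<times>real. Complex (fst p) (snd p)) \<in> borel_measurable borel"
    unfolding Complex_eq by (intro borel_measurable_continuous_onI continuous_intros)
  fix l u :: complex assume "\<And>b. b \<in> Basis \<Longrightarrow> l \<bullet> b \<le> u \<bullet> b"
  from this[of 1] this[of \<i>] have lu: "Re l \<le> Re u" "Im l \<le> Im u" by (auto simp: Basis_complex_def)
  have "(\<lambda>p::real\<times>real. Complex (fst p) (snd p)) -` box l u = box (Re l, Im l) (Re u, Im u)"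
    by (auto simp: box_def Basis_prod_def Basis_complex_def)
  then have "emeasure (distr (lborel :: (real \<times> real) measure) borel (\<lambda>p. Complex (fst p) (snd p))) (box l u)
    = emeasure lborel (box (Re l, Im l) (Re u, Im u))"
    using meas by (subst emeasure_distr) auto
  also have "\<dots> = (\<Prod>b\<in>Basis. ((Re u, Im u) - (Re l, Im l)) \<bullet> b)"
    using lu by (intro emeasure_lborel_box) (auto simp: Basis_prod_def Basis_complex_def)
  also have "(\<Prod>b\<in>Basis. ((Re u, Im u) - (Re l, Im l)) \<bullet> b) = (\<Prod>b\<in>Basis. (u - l) \<bullet> b)"
    by (simp add: Basis_prod_def Basis_complex_def)
  finally show "emeasure (distr (lborel :: (real \<times> real) measure) borel (\<lambda>p. Complex (fst p) (snd p))) (box l u)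
    = (\<Prod>b\<in>Basis. (u - l) \<bullet> b)" .
qed simp

text \<open>A complex derivative acts on the plane as a rotation with scaling, and its real
  determinant is the squared modulus.\<close>

lemma emeasure_holomorphic_image:
  assumes U: "open U" and hol: "\<Phi> holomorphic_on U" and inj: "inj_on \<Phi> U"
    and E: "E \<in> sets borel" "E \<subseteq> U" and im: "\<Phi> ` E \<in> sets borel"
  shows "emeasure lborel (\<Phi> ` E) = (\<integral>\<^sup>+z\<in>E. ennreal ((cmod (deriv \<Phi> z))\<^sup>2) \<partial>lborel)"
proof -
  define K :: "real^2 \<Rightarrow> complex" where "K v = Complex (v $ 1) (v $ 2)" for v
  define J :: "complex \<Rightarrow> real^2" where "J z = (\<chi> i. if i = 1 then Re z else Im z)" for z
  have KJ: "K (J z) = z" and JK: "J (K v) = v" for z v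
    by (auto simp: K_def J_def vec_eq_iff forall_2)
  have measK: "K \<in> borel_measurable borel"
    unfolding K_def Complex_eq by (intro borel_measurable_continuous_onI continuous_intros)
  have linK: "bounded_linear K"
    by (intro linear_conv_bounded_linear[THEN iffD1] linearI) (auto simp: K_def complex_eq_iff)
  have linJ: "bounded_linear J"
    by (intro linear_conv_bounded_linear[THEN iffD1] linearI) (auto simp: J_def vec_eq_iff)
  have vK: "K -` X \<in> sets borel" if "X \<in> sets borel" for X
    using measurable_sets[OF measK that] by simp
  define S where "S = K -` E"
  define f where "f = J \<circ> \<Phi> \<circ> K"
  have S: "S \<in> sets borel" using vK[OF E(1)] by (simp add: S_def)
  have fS: "f ` S = K -` (\<Phi> ` E)"
  proof -
    have "f ` S = J ` \<Phi> ` K ` S" by (simp add: f_def image_comp)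
    also have "K ` S = E" unfolding S_def using surjI[of K J, OF KJ] by (rule surj_image_vimage_eq)
    also have "J ` \<Phi> ` E = K -` (\<Phi> ` E)"
    proof (intro equalityI subsetI)
      fix v assume "v \<in> K -` (\<Phi> ` E)"
      then show "v \<in> J ` \<Phi> ` E" using JK[of v] by (metis imageI vimageE)
    qed (use KJ in force)
    finally show ?thesis .
  qed
  have eK: "emeasure lborel X = emeasure lborel (K -` X)" if "X \<in> sets borel" for X
    using distr_lborel_vec_complex that measK emeasure_distr[of K lborel borel X]
    by (simp add: K_def[abs_def])
  define f' where "f' = (\<lambda>v d. J (deriv \<Phi> (K v) * K d))"
  have der: "(f has_derivative f' v) (at v within S)" if "v \<in> S" for v
  proof -
    have "K v \<in> U" using that E by (auto simp: S_def)
    then have "(\<Phi> has_derivative (*) (deriv \<Phi> (K v))) (at (K v))"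
      using holomorphic_derivI[OF hol U] by (simp add: has_field_derivative_def)
    from has_derivative_compose[OF bounded_linear_imp_has_derivative[OF linK] this]
    have "((\<lambda>v. \<Phi> (K v)) has_derivative (\<lambda>d. deriv \<Phi> (K v) * K d)) (at v within S)" .
    from bounded_linear.has_derivative[OF linJ this] show ?thesis
      by (simp add: f_def f'_def o_def)
  qed
  have det: "\<bar>det (matrix (f' v))\<bar> = (cmod (deriv \<Phi> (K v)))\<^sup>2" for v
    unfolding det_2 matrix_def f'_def cmod_power2
    by (simp add: J_def K_def axis_def power2_eq_square)
  have inj': "inj_on f S"
  proof (rule inj_onI)
    fix v w assume "v \<in> S" "w \<in> S" "f v = f w"
    then have "\<Phi> (K v) = \<Phi> (K w)" "K v \<in> U" "K w \<in> U" using KJ E by (auto simp: f_def S_def) metis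
    then show "v = w" using inj JK by (metis inj_onD)
  qed
  have contd: "continuous_on E (\<lambda>z. (cmod (deriv \<Phi> z))\<^sup>2)"
    using holomorphic_on_imp_continuous_on[OF holomorphic_deriv[OF hol U]] E
    by (auto intro!: continuous_intros intro: continuous_on_subset)
  define D where "D = (\<lambda>z. indicator E z *\<^sub>R (cmod (deriv \<Phi> z))\<^sup>2)"
  have measD: "D \<in> borel_measurable borel" unfolding D_def
    by (rule borel_measurable_continuous_on_indicator[OF E(1) contd])
  have "(\<integral>\<^sup>+z\<in>E. ennreal ((cmod (deriv \<Phi> z))\<^sup>2) \<partial>lborel) = (\<integral>\<^sup>+z. ennreal (D z) \<partial>lborel)"
    by (intro nn_integral_cong) (auto simp: D_def indicator_def)
  also have "\<dots> = (\<integral>\<^sup>+z. ennreal (D z) \<partial>distr lborel borel K)"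
    by (simp add: distr_lborel_vec_complex K_def[abs_def])
  also have "\<dots> = (\<integral>\<^sup>+v. ennreal (D (K v)) \<partial>lborel)"
    using measK measD by (subst nn_integral_distr) auto
  finally have int: "(\<integral>\<^sup>+z\<in>E. ennreal ((cmod (deriv \<Phi> z))\<^sup>2) \<partial>lborel) = (\<integral>\<^sup>+v. ennreal (D (K v)) \<partial>lborel)" .
  have DK: "D (K v) = (if v \<in> S then \<bar>det (matrix (f' v))\<bar> else 0)" for v
    by (simp add: D_def det S_def)
  have measDK: "(\<lambda>v. D (K v)) \<in> borel_measurable borel" using measK measD by simp
  have Sl: "S \<in> sets lebesgue" using S by simp
  have iff: "f ` S \<in> lmeasurable \<and> measure lebesgue (f ` S) = m \<longleftrightarrow> ((\<lambda>v. \<bar>det (matrix (f' v))\<bar>) has_integral m) S" for m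
    by (rule has_measure_differentiable_image[OF Sl der inj'])
  have iff2: "((\<lambda>v. \<bar>det (matrix (f' v))\<bar>) has_integral m) S \<longleftrightarrow> ((\<lambda>v. D (K v)) has_integral m) UNIV" for m
    unfolding DK by (rule has_integral_restrict_UNIV[symmetric])
  have fSb: "f ` S \<in> sets borel" unfolding fS by (rule vK[OF im])
  have goal: "emeasure lborel (f ` S) = (\<integral>\<^sup>+v. ennreal (D (K v)) \<partial>lborel)"
  proof (cases "emeasure lborel (f ` S) = \<infinity>")
    case False
    then have "f ` S \<in> lmeasurable"
      using fSb by (intro fmeasurableI) (auto simp: less_top)
    then have "((\<lambda>v. D (K v)) has_integral measure lebesgue (f ` S)) UNIV" using iff iff2 by blast
    then have "(\<integral>\<^sup>+v. ennreal (D (K v)) \<partial>lborel) = ennreal (measure lebesgue (f ` S))"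
      by (intro nn_integral_has_integral_lborel measDK) (auto simp: D_def)
    also have "\<dots> = emeasure lborel (f ` S)"
      using False fSb by (simp add: emeasure_eq_ennreal_measure)
    finally show ?thesis by simp
  next
    \<comment> \<open>For an image of infinite measure the theorem is read backwards: a finite right
      side would give the image finite measure.\<close>
    case True
    have "(\<integral>\<^sup>+v. ennreal (D (K v)) \<partial>lborel) = \<infinity>"
    proof (rule ccontr)
      assume "(\<integral>\<^sup>+v. ennreal (D (K v)) \<partial>lborel) \<noteq> \<infinity>"
      then have "integrable lborel (\<lambda>v. D (K v))"
        using measDK by (intro integrableI_nonneg) (simp_all add: less_top, simp add: D_def)
      then have "((\<lambda>v. D (K v)) has_integral (integral\<^sup>L lborel (\<lambda>v. D (K v)))) UNIV"
        by (rule has_integral_integral_lborel)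
      then have "f ` S \<in> lmeasurable" using iff iff2 by blast
      then show False using True fSb by (simp add: fmeasurable_def)
    qed
    then show ?thesis using True by simp
  qed
  show ?thesis unfolding int goal[symmetric] fS by (rule eK[OF im])
qed

text \<open>Both sides integrate \<open>F\<close> against the same measure: the density
  \<open>D\<close> pushed forward by \<open>\<Phi>\<close> is Lebesgue measure restricted to the
  image. This is \<open>emeasure_holomorphic_image\<close> applied to Borel pieces of
  \<open>E\<close>.\<close>

lemma nn_integral_holomorphic_image:
  assumes U: "open U" and hol: "\<Phi> holomorphic_on U" and inj: "inj_on \<Phi> U"
    and E: "E \<in> sets borel" "E \<subseteq> U" and im: "\<Phi> ` E \<in> sets borel"
    and F: "F \<in> borel_measurable borel"
  shows "(\<integral>\<^sup>+w\<in>\<Phi> ` E. F w \<partial>lborel) = (\<integral>\<^sup>+z\<in>E. F (\<Phi> z) * ennreal ((cmod (deriv \<Phi> z))\<^sup>2) \<partial>lborel)"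
proof -
  define D where "D = (\<lambda>z. ennreal (indicator E z *\<^sub>R (cmod (deriv \<Phi> z))\<^sup>2))"
  have contd: "continuous_on E (\<lambda>z. (cmod (deriv \<Phi> z))\<^sup>2)" "continuous_on E \<Phi>"
    using holomorphic_on_imp_continuous_on[OF holomorphic_deriv[OF hol U]]
      holomorphic_on_imp_continuous_on[OF hol] E
    by (auto intro!: continuous_intros intro: continuous_on_subset)
  have measD: "D \<in> borel_measurable borel" unfolding D_def
    by (intro measurable_compose[OF _ measurable_ennreal] borel_measurable_continuous_on_indicator[OF E(1)] contd)
  \<comment> \<open>Set to 0 off \<open>E\<close> to be Borel on the whole plane; \<open>D\<close>
    vanishes there as well.\<close>
  define \<Psi> where "\<Psi> = (\<lambda>z. indicator E z *\<^sub>R \<Phi> z)"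
  have meas\<Psi>: "\<Psi> \<in> borel_measurable borel" unfolding \<Psi>_def
    by (rule borel_measurable_continuous_on_indicator[OF E(1) contd(2)])
  have "distr (density lborel D) borel \<Psi> = density lborel (indicator (\<Phi> ` E))"
  proof (rule measure_eqI)
    fix B assume "B \<in> sets (distr (density lborel D) borel \<Psi>)"
    then have B: "B \<in> sets borel" by simp
    define E' where "E' = E \<inter> \<Psi> -` B"
    have E': "E' \<in> sets borel" "E' \<subseteq> U"
      using E measurable_sets[OF meas\<Psi> B] by (auto simp: E'_def)
    have im': "\<Phi> ` E' = \<Phi> ` E \<inter> B" by (auto simp: E'_def \<Psi>_def)
    have "emeasure (distr (density lborel D) borel \<Psi>) B = (\<integral>\<^sup>+z. D z * indicator (\<Psi> -` B) z \<partial>lborel)"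
      using meas\<Psi> measD B measurable_sets[OF meas\<Psi> B] by (simp add: emeasure_distr emeasure_density)
    also have "\<dots> = (\<integral>\<^sup>+z\<in>E'. ennreal ((cmod (deriv \<Phi> z))\<^sup>2) \<partial>lborel)"
      by (intro nn_integral_cong) (auto simp: D_def E'_def indicator_def)
    also have "\<dots> = emeasure lborel (\<Phi> ` E')"
      using im B im' by (intro emeasure_holomorphic_image[OF U hol inj E', symmetric]) auto
    also have "\<dots> = emeasure (density lborel (indicator (\<Phi> ` E))) B"
      using im B unfolding im' by (subst emeasure_density) (auto simp: indicator_inter_arith[symmetric])
    finally show "emeasure (distr (density lborel D) borel \<Psi>) B = emeasure (density lborel (indicator (\<Phi> ` E))) B" .
  qed simp
  then have "(\<integral>\<^sup>+w. F w \<partial>distr (density lborel D) borel \<Psi>) = (\<integral>\<^sup>+w. F w \<partial>density lborel (indicator (\<Phi> ` E)))"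
    by simp
  moreover have "(\<integral>\<^sup>+w. F w \<partial>distr (density lborel D) borel \<Psi>) = (\<integral>\<^sup>+z. D z * F (\<Psi> z) \<partial>lborel)"
    using F meas\<Psi> measD by (simp add: nn_integral_distr nn_integral_density)
  moreover have "\<dots> = (\<integral>\<^sup>+z\<in>E. F (\<Phi> z) * ennreal ((cmod (deriv \<Phi> z))\<^sup>2) \<partial>lborel)"
    by (intro nn_integral_cong) (auto simp: D_def \<Psi>_def indicator_def mult.commute)
  moreover have "(\<integral>\<^sup>+w. F w \<partial>density lborel (indicator (\<Phi> ` E))) = (\<integral>\<^sup>+w\<in>\<Phi> ` E. F w \<partial>lborel)"
    using F im by (simp add: nn_integral_density mult.commute)
  ultimately show ?thesis by simp
qed

lemma chart_image_borel:
  assumes c: "is_chart c" and B: "B \<in> sets borel" "B \<subseteq> dom_of c"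
  shows "coord c ` B \<in> sets borel"
proof -
  have "inv_coord c \<in> borel_measurable (restrict_space borel (coord c ` dom_of c))"
    by (rule borel_measurable_continuous_on_restrict) (rule chart_simps(4)[OF c])
  from measurable_sets[OF this B(1)]
  have "inv_coord c -` B \<inter> coord c ` dom_of c \<in> sets (restrict_space borel (coord c ` dom_of c))"
    by (simp add: space_restrict_space)
  then have "inv_coord c -` B \<inter> coord c ` dom_of c \<in> sets borel"
    using chart_simps(2)[OF c] by (subst (asm) sets_restrict_space_iff) auto
  then show ?thesis unfolding chart_image[OF c B(2)] by (simp add: Int_commute)
qed

text \<open>\<open>inv_coord c\<close> is unspecified off the image of the chart, so it need not be measurable.\<close>

definition inv_coord_total :: "'a::topological_space chart \<Rightarrow> complex \<Rightarrow> 'a" where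
  "inv_coord_total c w = (if w \<in> coord c ` dom_of c then inv_coord c w else undefined)"

lemma measurable_inv_coord_total:
  assumes c: "is_chart c"
  shows "inv_coord_total c \<in> borel_measurable borel"
proof (rule measurableI)
  fix B :: "'a set" assume B: "B \<in> sets borel"
  have "inv_coord_total c -` B \<inter> space borel
     = coord c ` (B \<inter> dom_of c) \<union> (if undefined \<in> B then - (coord c ` dom_of c) else {})"
    unfolding chart_image[OF c Int_lower2] using chart_simps(7)[OF c] by (auto simp: inv_coord_total_def split: if_split_asm)
  moreover have "coord c ` (B \<inter> dom_of c) \<in> sets borel"
    using B chart_simps(1)[OF c] by (intro chart_image_borel c) auto
  ultimately show "inv_coord_total c -` B \<inter> space borel \<in> sets borel"
    using chart_simps(2)[OF c] by auto
qed simp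

section \<open>Existence and uniqueness of the area measure\<close>

context spinorial_pair
begin

lemma coord_dom_eq: "c \<in> A \<Longrightarrow> coord c ` dom_of c = (\<Union>b\<in>cp1_atlas. W c b)"
  unfolding W_def using cp1_chart_exists by blast

lemma continuous_metric:
  assumes c: "c \<in> A"
  shows "continuous_on (coord c ` dom_of c) (\<lambda>w. g c (inv_coord c w))"
  unfolding coord_dom_eq[OF c]
proof (rule continuous_on_open_UN)
  fix b assume b: "b \<in> cp1_atlas"
  show "open (W c b)" by (rule open_W[OF c b])
  have "continuous_on (W c b) (\<lambda>w. (cmod (H c b w))\<^sup>2 * (1 + (cmod (Z c b w))\<^sup>2)\<^sup>2 / 2)"
    by (intro continuous_intros holomorphic_on_imp_continuous_on holomorphic_HZ[OF c b]) simp
  then show "continuous_on (W c b) (\<lambda>w. g c (inv_coord c w))"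
    by (subst continuous_on_cong[OF refl metric_W[OF c b]])
qed

text \<open>Extended by zero beyond the image of the chart, where \<open>inv_coord\<close> carries
  no information; thus Borel on the plane.\<close>

definition area_density :: "'a chart \<Rightarrow> complex \<Rightarrow> ennreal" where
  "area_density c w = ennreal (indicator (coord c ` dom_of c) w *\<^sub>R (2 * g c (inv_coord c w)))"

lemma measurable_area_density: "c \<in> A \<Longrightarrow> area_density c \<in> borel_measurable borel"
  unfolding area_density_def
  using chart_simps(2)[OF chart, of c]
  by (intro measurable_compose[OF _ measurable_ennreal] borel_measurable_continuous_on_indicator
      continuous_intros continuous_metric) auto

lemma area_density_eq:
  "B \<subseteq> dom_of c \<Longrightarrow> (\<integral>\<^sup>+w\<in>coord c ` B. ennreal (2 * g c (inv_coord c w)) \<partial>lborel)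
     = (\<integral>\<^sup>+w\<in>coord c ` B. area_density c w \<partial>lborel)"
  by (intro nn_integral_cong) (auto simp: area_density_def indicator_def)

text \<open>The Jacobian of the transition map cancels the factor by which the metric coefficient
  changes in \<open>metric_transform\<close>.\<close>

lemma area_density_change:
  assumes c: "c \<in> A" "c' \<in> A" and B: "B \<in> sets borel" "B \<subseteq> dom_of c" "B \<subseteq> dom_of c'"
  shows "(\<integral>\<^sup>+w\<in>coord c' ` B. area_density c' w \<partial>lborel) = (\<integral>\<^sup>+w\<in>coord c ` B. area_density c w \<partial>lborel)"
proof -
  define \<Phi> where "\<Phi> = coord c' \<circ> inv_coord c"
  define U where "U = coord c ` (dom_of c' \<inter> dom_of c)"
  note cs = chart_simps[OF chart[OF c(1)]] and cs' = chart_simps[OF chart[OF c(2)]]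
  have U: "open U" unfolding U_def using cs(1) cs'(1) by (intro open_chart_image[OF chart[OF c(1)]]) auto
  have hol: "\<Phi> holomorphic_on U"
    using pair c unfolding vanishing_spinorial_pair_def riemann_surface_def \<Phi>_def U_def by blast
  have inj: "inj_on \<Phi> U"
  proof (rule inj_onI)
    fix w z assume "w \<in> U" "z \<in> U" "\<Phi> w = \<Phi> z"
    then obtain x y where xy: "x \<in> dom_of c" "y \<in> dom_of c" "x \<in> dom_of c'" "y \<in> dom_of c'"
        "w = coord c x" "z = coord c y" by (auto simp: U_def)
    then have "coord c' x = coord c' y" using \<open>\<Phi> w = \<Phi> z\<close> cs by (simp add: \<Phi>_def)
    then have "x = y" using cs'(5) xy by metis
    then show "w = z" using xy by simp
  qed
  have im: "\<Phi> ` coord c ` B = coord c' ` B"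
    unfolding image_image \<Phi>_def using B cs(5) by (intro image_cong) auto
  have E: "coord c ` B \<in> sets borel" "coord c ` B \<subseteq> U"
    using B chart_image_borel[OF chart[OF c(1)]] by (auto simp: U_def)
  have "(\<integral>\<^sup>+w\<in>coord c' ` B. area_density c' w \<partial>lborel)
    = (\<integral>\<^sup>+z\<in>coord c ` B. area_density c' (\<Phi> z) * ennreal ((cmod (deriv \<Phi> z))\<^sup>2) \<partial>lborel)"
    unfolding im[symmetric]
    by (rule nn_integral_holomorphic_image[OF U hol inj E])
       (use im chart_image_borel[OF chart[OF c(2)] B(1,3)] measurable_area_density[OF c(2)] in auto)
  also have "\<dots> = (\<integral>\<^sup>+w\<in>coord c ` B. area_density c w \<partial>lborel)"
  proof (intro nn_integral_cong)
    fix z :: complex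
    show "area_density c' (\<Phi> z) * ennreal ((cmod (deriv \<Phi> z))\<^sup>2) * indicator (coord c ` B) z
      = area_density c z * indicator (coord c ` B) z"
    proof (cases "z \<in> coord c ` B")
      case True
      then obtain x where x: "x \<in> B" "z = coord c x" by auto
      then have xd: "x \<in> dom_of c" "x \<in> dom_of c'" using B by auto
      have "g c x = (cmod (coord_deriv c' c x))\<^sup>2 * g c' x"
        by (rule metric_transform[OF c(2,1) xd(2,1)])
      moreover have "coord_deriv c' c x = deriv \<Phi> z" by (simp add: coord_deriv_def \<Phi>_def x)
      moreover have "\<Phi> z = coord c' x" using cs(5)[OF xd(1)] by (simp add: \<Phi>_def x)
      ultimately show ?thesis
        using True xd cs(5)[OF xd(1)] cs'(5)[OF xd(2)] metric_pos[OF c(2) xd(2)]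
        by (simp add: area_density_def x(2) mult_ac flip: ennreal_mult)
    qed simp
  qed
  finally show ?thesis .
qed

definition chart_measure :: "'a chart \<Rightarrow> 'a set \<Rightarrow> 'a measure" where
  "chart_measure c E = distr (density lborel (\<lambda>w. area_density c w * indicator (coord c ` E) w)) borel (inv_coord_total c)"

lemma emeasure_chart_measure:
  assumes c: "c \<in> A" and E: "E \<in> sets borel" "E \<subseteq> dom_of c" and B: "B \<in> sets borel"
  shows "emeasure (chart_measure c E) B = (\<integral>\<^sup>+w\<in>coord c ` (E \<inter> B). area_density c w \<partial>lborel)"
proof -
  have m: "inv_coord_total c \<in> borel_measurable borel" by (rule measurable_inv_coord_total[OF chart[OF c]])
  have mE: "coord c ` E \<in> sets borel" by (rule chart_image_borel[OF chart[OF c] E])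
  have "emeasure (chart_measure c E) B
    = (\<integral>\<^sup>+w. area_density c w * indicator (coord c ` E) w * indicator (inv_coord_total c -` B) w \<partial>lborel)"
    unfolding chart_measure_def
    using m mE B measurable_area_density[OF c] measurable_sets[OF m B]
    by (simp add: emeasure_distr emeasure_density)
  also have "\<dots> = (\<integral>\<^sup>+w\<in>coord c ` (E \<inter> B). area_density c w \<partial>lborel)"
  proof (intro nn_integral_cong)
    fix w :: complex
    have "w \<in> coord c ` (E \<inter> B) \<longleftrightarrow> w \<in> coord c ` E \<and> inv_coord_total c w \<in> B"
    proof -
      have inv: "inv_coord_total c (coord c x) = x" if "x \<in> E" for x
        using that E(2) chart_simps(5)[OF chart[OF c]] by (simp add: inv_coord_total_def subset_iff)
      show ?thesis
      proof
        assume "w \<in> coord c ` (E \<inter> B)"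
        then obtain x where "x \<in> E" "x \<in> B" "w = coord c x" by blast
        then show "w \<in> coord c ` E \<and> inv_coord_total c w \<in> B" using inv by simp
      next
        assume w: "w \<in> coord c ` E \<and> inv_coord_total c w \<in> B"
        then obtain x where "x \<in> E" "w = coord c x" by blast
        then show "w \<in> coord c ` (E \<inter> B)" using inv w by simp
      qed
    qed
    then show "area_density c w * indicator (coord c ` E) w * indicator (inv_coord_total c -` B) w
      = area_density c w * indicator (coord c ` (E \<inter> B)) w"
      by (auto simp: indicator_def)
  qed
  finally show ?thesis .
qed

text \<open>The defining property of the area measure speaks only of sets inside one chart. A finite
  Borel partition subordinate to the charts, available by compactness, reduces existence and
  uniqueness to such sets.\<close>

lemma finite_disjoint_cover:
  obtains C S where "finite C" "C \<subseteq> A" "\<And>c. c \<in> C \<Longrightarrow> S c \<in> sets borel" "\<And>c. c \<in> C \<Longrightarrow> S c \<subseteq> dom_of c"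
    "(\<Union>c\<in>C. S c) = UNIV" "disjoint_family_on S C"
proof -
  obtain C where C: "C \<subseteq> A" "finite C" "UNIV \<subseteq> (\<Union>c\<in>C. dom_of c)"
  proof (rule compactE_image[OF compact])
    show "\<And>c. c \<in> A \<Longrightarrow> open (dom_of c)" using chart chart_simps(1) by blast
    show "UNIV \<subseteq> (\<Union>c\<in>A. dom_of c)" using cover by simp
  qed blast
  obtain i :: "'a chart \<Rightarrow> nat" where i: "inj_on i C"
    using finite_imp_inj_to_nat_seg[OF C(2)] by blast
  define S where "S = (\<lambda>c. dom_of c - (\<Union>c'\<in>{c'\<in>C. i c' < i c}. dom_of c'))"
  show ?thesis
  proof (rule that[OF C(2,1)])
    fix c assume "c \<in> C"
    then have "open (dom_of c)" "open (\<Union>c'\<in>{c'\<in>C. i c' < i c}. dom_of c')"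
      using C(1) chart chart_simps(1) by blast+
    then show "S c \<in> sets borel" unfolding S_def by (intro sets.Diff borel_open)
    show "S c \<subseteq> dom_of c" by (auto simp: S_def)
  next
    have "x \<in> (\<Union>c\<in>C. S c)" for x
    proof -
      obtain c where c: "c \<in> C \<and> x \<in> dom_of c" using C(3) by blast
      define d where "d = arg_min i (\<lambda>c. c \<in> C \<and> x \<in> dom_of c)"
      have d: "d \<in> C \<and> x \<in> dom_of d" "\<And>c. c \<in> C \<and> x \<in> dom_of c \<Longrightarrow> i d \<le> i c"
        using arg_min_nat_lemma[of "\<lambda>c. c \<in> C \<and> x \<in> dom_of c" c i] c unfolding d_def by blast+
      then have "x \<in> S d" using leD by (fastforce simp: S_def)
      then show ?thesis using d by blast
    qed
    then show "(\<Union>c\<in>C. S c) = UNIV" by blast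
    show "disjoint_family_on S C"
      unfolding disjoint_family_on_def
    proof (intro ballI impI)
      fix c d assume "c \<in> C" "d \<in> C" "c \<noteq> d"
      then have "i c < i d \<or> i d < i c" using i by (meson inj_onD linorder_neqE_nat)
      then show "S c \<inter> S d = {}" using \<open>c \<in> C\<close> \<open>d \<in> C\<close> unfolding S_def by blast
    qed
  qed
qed

definition is_area_measure :: "'a measure \<Rightarrow> bool" where
  "is_area_measure M \<longleftrightarrow> sets M = sets borel \<and>
     (\<forall>c\<in>A. \<forall>B\<in>sets borel. B \<subseteq> dom_of c \<longrightarrow>
        emeasure M B = (\<integral>\<^sup>+ w \<in> coord c ` B. ennreal (2 * g c (inv_coord c w)) \<partial>lborel))"

text \<open>The measure is the sum of the chart measures of the pieces. For a set inside the chart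
  \<open>c\<close>, the contributions computed in other charts are rewritten in \<open>c\<close> by
  \<open>area_density_change\<close>.\<close>

lemma is_area_measure_exists: "\<exists>M. is_area_measure M"
proof -
  obtain C S where C: "finite C" "C \<subseteq> A" and S: "\<And>c. c \<in> C \<Longrightarrow> S c \<in> sets borel" "\<And>c. c \<in> C \<Longrightarrow> S c \<subseteq> dom_of c"
    "(\<Union>c\<in>C. S c) = UNIV" "disjoint_family_on S C"
    by (rule finite_disjoint_cover) (rule that, assumption+)
  define \<mu> where "\<mu> B = (\<Sum>c\<in>C. emeasure (chart_measure c (S c)) B)" for B
  define M where "M = measure_of UNIV (sets borel) \<mu>"
  have sigma: "sigma_algebra UNIV (sets (borel :: 'a measure))"
    using sets.sigma_algebra_axioms[of "borel :: 'a measure"] by simp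
  have sets: "sets M = sets borel"
    unfolding M_def using sigma_algebra.sets_measure_of_eq[OF sigma] by simp
  have em: "emeasure M B = \<mu> B" if "B \<in> sets borel" for B
  proof (rule emeasure_measure_of[OF M_def])
    show "positive (sets M) \<mu>" by (simp add: positive_def \<mu>_def)
    show "countably_additive (sets M) \<mu>"
    proof (rule countably_additiveI)
      fix F :: "nat \<Rightarrow> 'a set" assume F: "range F \<subseteq> sets M" "disjoint_family F"
      have "range F \<subseteq> sets (chart_measure c (S c))" for c using F(1) sets by (simp add: chart_measure_def)
      then have "(\<Sum>i. emeasure (chart_measure c (S c)) (F i)) = emeasure (chart_measure c (S c)) (\<Union>i. F i)" for c
        using F(2) by (intro suminf_emeasure)
      then show "(\<Sum>i. \<mu> (F i)) = \<mu> (\<Union>i. F i)"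
        unfolding \<mu>_def by (subst suminf_sum) auto
    qed
  qed (use that sets in \<open>auto dest: sets.sets_into_space\<close>)
  have "is_area_measure M"
    unfolding is_area_measure_def
  proof (intro conjI ballI impI sets)
    fix c B assume c: "c \<in> A" and B: "B \<in> sets borel" "B \<subseteq> dom_of c"
    have "emeasure M B = (\<Sum>d\<in>C. \<integral>\<^sup>+w\<in>coord d ` (S d \<inter> B). area_density d w \<partial>lborel)"
      unfolding em[OF B(1)] \<mu>_def using C S B by (intro sum.cong refl emeasure_chart_measure) auto
    also have "\<dots> = (\<Sum>d\<in>C. \<integral>\<^sup>+w\<in>coord c ` (S d \<inter> B). area_density c w \<partial>lborel)"
    proof (intro sum.cong refl area_density_change c)
      fix d assume d: "d \<in> C"
      show "d \<in> A" using d C by auto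
      show "S d \<inter> B \<in> sets borel" using S(1)[OF d] B by auto
      show "S d \<inter> B \<subseteq> dom_of c" "S d \<inter> B \<subseteq> dom_of d" using S(2)[OF d] B by auto
    qed
    also have "\<dots> = (\<integral>\<^sup>+w. (\<Sum>d\<in>C. area_density c w * indicator (coord c ` (S d \<inter> B)) w) \<partial>lborel)"
    proof (rule nn_integral_sum[symmetric])
      fix d assume d: "d \<in> C"
      have "coord c ` (S d \<inter> B) \<in> sets borel"
        using S(1)[OF d] B by (intro chart_image_borel chart c) auto
      then show "(\<lambda>w. area_density c w * indicator (coord c ` (S d \<inter> B)) w) \<in> borel_measurable lborel"
        using measurable_area_density[OF c] by simp
    qed
    also have "\<dots> = (\<integral>\<^sup>+w\<in>coord c ` B. area_density c w \<partial>lborel)"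
    proof (intro nn_integral_cong)
      fix w :: complex
      have "disjoint_family_on (\<lambda>d. coord c ` (S d \<inter> B)) C"
        unfolding disjoint_family_on_def
      proof (intro ballI impI)
        fix d e assume "d \<in> C" "e \<in> C" "d \<noteq> e"
        then have "S d \<inter> S e = {}" using S(4) by (auto simp: disjoint_family_on_def)
        moreover have "inj_on (coord c) B" using B(2) chart_simps(5)[OF chart[OF c]] by (metis inj_onI subsetD)
        ultimately show "coord c ` (S d \<inter> B) \<inter> coord c ` (S e \<inter> B) = {}"
          by (subst inj_on_image_Int[symmetric, of _ B]) auto
      qed
      then have "(\<Sum>d\<in>C. indicator (coord c ` (S d \<inter> B)) w) = (indicator (\<Union>d\<in>C. coord c ` (S d \<inter> B)) w :: ennreal)"
        using C(1) by (intro indicator_UN_disjoint[symmetric])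
      also have "(\<Union>d\<in>C. coord c ` (S d \<inter> B)) = coord c ` B" using S(3) by blast
      finally show "(\<Sum>d\<in>C. area_density c w * indicator (coord c ` (S d \<inter> B)) w) = area_density c w * indicator (coord c ` B) w"
        by (simp add: sum_distrib_left[symmetric])
    qed
    also have "\<dots> = (\<integral>\<^sup>+ w \<in> coord c ` B. ennreal (2 * g c (inv_coord c w)) \<partial>lborel)"
      by (rule area_density_eq[OF B(2), symmetric])
    finally show "emeasure M B = (\<integral>\<^sup>+ w \<in> coord c ` B. ennreal (2 * g c (inv_coord c w)) \<partial>lborel)" .
  qed
  then show ?thesis by blast
qed

lemma is_area_measure_unique:
  assumes M: "is_area_measure M" and N: "is_area_measure N"
  shows "M = N"
proof -
  obtain C S where C: "finite C" "C \<subseteq> A" and S: "\<And>c. c \<in> C \<Longrightarrow> S c \<in> sets borel" "\<And>c. c \<in> C \<Longrightarrow> S c \<subseteq> dom_of c"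
    "(\<Union>c\<in>C. S c) = UNIV" "disjoint_family_on S C"
    by (rule finite_disjoint_cover) (rule that, assumption+)
  show ?thesis
  proof (rule measure_eqI)
    show "sets M = sets N" using M N by (simp add: is_area_measure_def)
    fix B assume "B \<in> sets M"
    then have B: "B \<in> sets borel" using M by (simp add: is_area_measure_def)
    have dec: "emeasure L B = (\<Sum>c\<in>C. emeasure L (S c \<inter> B))" if "sets L = sets borel" for L
    proof -
      have "disjoint_family_on (\<lambda>c. S c \<inter> B) C"
        using S(4) unfolding disjoint_family_on_def by blast
      moreover have "(\<lambda>c. S c \<inter> B) ` C \<subseteq> sets L"
        unfolding that using S(1) B by (intro image_subsetI sets.Int)
      ultimately have "emeasure L (\<Union>c\<in>C. S c \<inter> B) = (\<Sum>c\<in>C. emeasure L (S c \<inter> B))"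
        using C(1) by (intro sum_emeasure[symmetric])
      moreover have "(\<Union>c\<in>C. S c \<inter> B) = B" using S(3) by blast
      ultimately show ?thesis by simp
    qed
    have "emeasure M (S c \<inter> B) = emeasure N (S c \<inter> B)" if c: "c \<in> C" for c
    proof -
      have "c \<in> A" "S c \<inter> B \<in> sets borel" "S c \<inter> B \<subseteq> dom_of c" using c C(2) S(1,2)[OF c] B by auto
      then show ?thesis using M N unfolding is_area_measure_def by metis
    qed
    then show "emeasure M B = emeasure N B"
      using dec M N by (simp add: is_area_measure_def)
  qed
qed

text \<open>\<open>area_measure\<close> is a definite description, so existence and uniqueness
  together give it its defining property.\<close>

lemma is_area_measure: "is_area_measure (area_measure A g)"
proof -
  obtain M where M: "is_area_measure M" using is_area_measure_exists by blast
  have "area_measure A g = (THE M. is_area_measure M)"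
    unfolding area_measure_def is_area_measure_def ..
  then show ?thesis using theI[of is_area_measure, OF M is_area_measure_unique[OF _ M]] by simp
qed

lemma sets_area_measure [measurable_cong, simp]: "sets (area_measure A g) = sets borel"
  using is_area_measure by (simp add: is_area_measure_def)

text \<open>Passes from sets to functions by identifying the area measure restricted to
  \<open>E\<close> with \<open>chart_measure c E\<close>.\<close>

lemma nn_integral_area_measure:
  assumes c: "c \<in> A" and E: "E \<in> sets borel" "E \<subseteq> dom_of c" and F: "F \<in> borel_measurable borel"
  shows "(\<integral>\<^sup>+x\<in>E. F x \<partial>area_measure A g) = (\<integral>\<^sup>+w\<in>coord c ` E. F (inv_coord c w) * ennreal (2 * g c (inv_coord c w)) \<partial>lborel)"
proof -
  have m: "inv_coord_total c \<in> borel_measurable borel" by (rule measurable_inv_coord_total[OF chart[OF c]])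
  have mE: "coord c ` E \<in> sets borel" by (rule chart_image_borel[OF chart[OF c] E])
  have "density (area_measure A g) (indicator E) = chart_measure c E"
  proof (rule measure_eqI)
    show "sets (density (area_measure A g) (indicator E)) = sets (chart_measure c E)"
      by (simp add: chart_measure_def)
    fix B assume "B \<in> sets (density (area_measure A g) (indicator E))"
    then have B: "B \<in> sets borel" by simp
    have "emeasure (density (area_measure A g) (indicator E)) B = emeasure (area_measure A g) (E \<inter> B)"
      using B E by (subst emeasure_density) (auto simp: indicator_inter_arith[symmetric])
    also have "\<dots> = (\<integral>\<^sup>+ w \<in> coord c ` (E \<inter> B). ennreal (2 * g c (inv_coord c w)) \<partial>lborel)"
      using is_area_measure c E B unfolding is_area_measure_def by (auto simp: le_infI1)
    also have "\<dots> = emeasure (chart_measure c E) B"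
      unfolding emeasure_chart_measure[OF c E B] using E by (intro area_density_eq) auto
    finally show "emeasure (density (area_measure A g) (indicator E)) B = emeasure (chart_measure c E) B" .
  qed
  then have "(\<integral>\<^sup>+x. F x \<partial>density (area_measure A g) (indicator E)) = (\<integral>\<^sup>+x. F x \<partial>chart_measure c E)" by simp
  moreover have "(\<integral>\<^sup>+x. F x \<partial>density (area_measure A g) (indicator E)) = (\<integral>\<^sup>+x\<in>E. F x \<partial>area_measure A g)"
    using E F by (subst nn_integral_density) (auto simp: mult.commute)
  moreover have "(\<integral>\<^sup>+x. F x \<partial>chart_measure c E)
     = (\<integral>\<^sup>+w. area_density c w * indicator (coord c ` E) w * F (inv_coord_total c w) \<partial>lborel)"
    unfolding chart_measure_def using m mE F measurable_area_density[OF c]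
    by (simp add: nn_integral_distr nn_integral_density)
  moreover have "\<dots> = (\<integral>\<^sup>+w\<in>coord c ` E. F (inv_coord c w) * ennreal (2 * g c (inv_coord c w)) \<partial>lborel)"
    using E by (intro nn_integral_cong) (auto simp: indicator_def area_density_def inv_coord_total_def mult.commute)
  ultimately show ?thesis by simp
qed

end

section \<open>The flow in coordinate squares\<close>

lemma Ck_on_cmod_square:
  assumes "F holomorphic_on S" "open S"
  shows "Ck_on k S (\<lambda>w. (cmod (F w))\<^sup>2)"
proof -
  have "Ck_on k S (\<lambda>w. Re (F w))" "Ck_on k S (\<lambda>w. Im (F w))"
    by (intro Ck_on_bounded_linear[OF Ck_on_holomorphic[OF assms]] bounded_linear_Re bounded_linear_Im)+
  then have "Ck_on k S (\<lambda>w. Re (F w) * Re (F w) + Im (F w) * Im (F w))"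
    by (intro Ck_on_add Ck_on_mult)
  then show ?thesis unfolding cmod_power2 by (simp add: power2_eq_square)
qed

text \<open>Used to identify the derivative of \<open>v\<close> supplied by smoothness with the one
  computed from \<open>u\<close> and \<open>q\<close> by the quotient rule.\<close>

lemma partial_x_unique:
  assumes "partial_x F F1" "partial_x F F2" "p \<in> unit_square"
  shows "F1 p = F2 p"
proof -
  obtain x y where p: "p = (x, y)" by (cases p)
  have "((\<lambda>s. F (s, y)) has_vector_derivative F1 p) (at x within {-1..1})"
    "((\<lambda>s. F (s, y)) has_vector_derivative F2 p) (at x within {-1..1})" "x \<in> {-1..1}"
    using assms unfolding partial_x_def p unit_square_iff
    by (auto simp: has_real_derivative_iff_has_vector_derivative)
  then show ?thesis using vector_derivative_unique_within_closed_interval[of "-1" 1 x] by fastforce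
qed

lemma partial_y_unique:
  assumes "partial_y F F1" "partial_y F F2" "p \<in> unit_square"
  shows "F1 p = F2 p"
proof -
  obtain x y where p: "p = (x, y)" by (cases p)
  have "((\<lambda>s. F (x, s)) has_vector_derivative F1 p) (at y within {-1..1})"
    "((\<lambda>s. F (x, s)) has_vector_derivative F2 p) (at y within {-1..1})" "y \<in> {-1..1}"
    using assms unfolding partial_y_def p unit_square_iff
    by (auto simp: has_real_derivative_iff_has_vector_derivative)
  then show ?thesis using vector_derivative_unique_within_closed_interval[of "-1" 1 y] by fastforce
qed

lemma bounded_on_unit_square:
  fixes F :: "real \<times> real \<Rightarrow> real"
  assumes "continuous_on unit_square F"
  obtains M where "\<And>p. p \<in> unit_square \<Longrightarrow> \<bar>F p\<bar> \<le> M"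
proof -
  have "bounded (F ` unit_square)"
    using assms by (intro compact_imp_bounded compact_continuous_image) (auto simp: unit_square_def)
  then show ?thesis using that by (auto simp: bounded_iff)
qed

lemma partial_minus_div:
  assumes u: "partial_x u ux" "partial_y u uy" and q: "partial_x q qx" "partial_y q qy"
    and pos: "\<And>p. p \<in> unit_square \<Longrightarrow> u p \<noteq> 0"
  shows "partial_x (\<lambda>p. u p - q p / u p) (\<lambda>p. (1 + q p / (u p)\<^sup>2) * ux p - qx p / u p)"
    "partial_y (\<lambda>p. u p - q p / u p) (\<lambda>p. (1 + q p / (u p)\<^sup>2) * uy p - qy p / u p)"
proof -
  have "u (x, y) \<noteq> 0" if "x \<in> {-1..1}" "y \<in> {-1..1}" for x y using pos that by (simp add: unit_square_iff)
  then show "partial_x (\<lambda>p. u p - q p / u p) (\<lambda>p. (1 + q p / (u p)\<^sup>2) * ux p - qx p / u p)"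
    "partial_y (\<lambda>p. u p - q p / u p) (\<lambda>p. (1 + q p / (u p)\<^sup>2) * uy p - qy p / u p)"
    using u q unfolding partial_x_def partial_y_def
    by (auto intro!: continuous_intros derivative_eq_intros simp: pos unit_square_iff field_simps power2_eq_square)
qed

text \<open>\<open>d\<close> stands for the integral of \<open>cutoff * u^(5*m-2)\<close> times the
  squared gradient of \<open>u\<close>. Retaining only this number and two inequalities for it
  separates the iteration from all spatial derivatives.\<close>

definition energy_bounds ::
  "(real \<times> real \<Rightarrow> real) \<Rightarrow> real \<Rightarrow> (real \<times> real \<Rightarrow> real) \<Rightarrow> (real \<times> real \<Rightarrow> real) \<Rightarrow> nat \<Rightarrow> real \<Rightarrow> bool" where
  "energy_bounds G q0 u ut m d \<longleftrightarrow> 0 \<le> d \<and>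
     integral unit_square (\<lambda>p. cutoff p * G p * (real (5*m) * u p ^ (5*m-1) * ut p))
       \<le> - d + 45 * (real (5*m))\<^sup>2 * q0\<^sup>2 * (4 + integral unit_square (\<lambda>p. u p ^ (5*m))) \<and>
     integral unit_square (\<lambda>p. (cutoff p)\<^sup>2 * u p ^ (6*m))
       \<le> 32 * (real m)\<^sup>2 * integral unit_square (\<lambda>p. u p ^ m) * (d + integral unit_square (\<lambda>p. u p ^ (5*m)))"

definition energy_solution ::
  "(real \<times> real \<Rightarrow> real) \<Rightarrow> real \<Rightarrow> real \<Rightarrow> (real \<Rightarrow> real \<times> real \<Rightarrow> real) \<Rightarrow> bool" where
  "energy_solution G q0 T u \<longleftrightarrow>
     (\<exists>ut. continuous_on ({0..<T} \<times> unit_square) (\<lambda>(t, p). u t p) \<and>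
        continuous_on ({0..<T} \<times> unit_square) (\<lambda>(t, p). ut t p) \<and>
        (\<forall>t\<in>{0..<T}. \<forall>p\<in>unit_square. ((\<lambda>s. u s p) has_real_derivative ut t p) (at t within {0..<T})) \<and>
        (\<forall>t\<in>{0..<T}. \<forall>m\<ge>1. \<exists>d. energy_bounds G q0 (u t) (ut t) m d))"

section \<open>The flow on a single coordinate square\<close>

context spinorial_pair
begin

context
  fixes c b z0 r
  assumes c: "c \<in> A" and b: "b \<in> cp1_atlas" and r: "r > 0"
    and sub: "square_map z0 r ` unit_square \<subseteq> W c b"
begin

definition "K w = gauss_curvature g c (inv_coord c w)"

text \<open>By \<open>curvature_W\<close> the curvature is a rational expression in squared moduli
  of holomorphic functions, with positive denominator.\<close>

lemma Ck_on_K: "Ck_on k (W c b) K"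
proof -
  note hol = holomorphic_HZ[OF c b] and op = open_W[OF c b]
  have pos: "1 + (cmod (Z c b w))\<^sup>2 \<noteq> 0" for w by (smt (verit) zero_le_power2)
  have 1: "Ck_on k (W c b) (\<lambda>w. inverse (1 + (cmod (Z c b w))\<^sup>2))"
    using pos by (intro Ck_on_inverse Ck_on_add Ck_on_const Ck_on_cmod_square hol op) auto
  have 2: "Ck_on k (W c b) (\<lambda>w. inverse ((cmod (H c b w))\<^sup>2))"
    using H_nonzero[OF c b] by (intro Ck_on_inverse Ck_on_cmod_square hol op) auto
  have 3: "Ck_on k (W c b) (\<lambda>w. (cmod (deriv (Z c b) w))\<^sup>2)"
    by (intro Ck_on_cmod_square holomorphic_deriv hol op)
  have "Ck_on k (W c b) (\<lambda>w. - 4 * ((cmod (deriv (Z c b) w))\<^sup>2 * (inverse ((cmod (H c b w))\<^sup>2)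
    * (inverse (1 + (cmod (Z c b w))\<^sup>2) * inverse (1 + (cmod (Z c b w))\<^sup>2)
      * (inverse (1 + (cmod (Z c b w))\<^sup>2) * inverse (1 + (cmod (Z c b w))\<^sup>2))))))"
    by (intro Ck_on_mult Ck_on_const 1 2 3)
  moreover have "K w = - 4 * ((cmod (deriv (Z c b) w))\<^sup>2 * (inverse ((cmod (H c b w))\<^sup>2)
    * (inverse (1 + (cmod (Z c b w))\<^sup>2) * inverse (1 + (cmod (Z c b w))\<^sup>2)
      * (inverse (1 + (cmod (Z c b w))\<^sup>2) * inverse (1 + (cmod (Z c b w))\<^sup>2)))))" if "w \<in> W c b" for w
    unfolding K_def curvature_W[OF c b that] power4_eq_xxxx divide_inverse inverse_mult_distrib by simp
  ultimately show ?thesis using Ck_on_cong[of "W c b" K _ k] by simp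
qed

lemma K_nonpos: "w \<in> W c b \<Longrightarrow> K w \<le> 0"
  unfolding K_def by (subst curvature_W[OF c b]) auto

definition "P p = inv_coord c (square_map z0 r p)"
text \<open>In the variables of the square the Laplacian is \<open>4 * r^2\<close> times
  \<open>ddbar\<close>, so multiplying the flow equation by \<open>G\<close> leaves the plain sum
  \<open>vxx + vyy\<close>.\<close>

definition "G p = 4 * r\<^sup>2 * g c (P p)"

lemma W_square: "p \<in> unit_square \<Longrightarrow> square_map z0 r p \<in> W c b"
  using sub by auto

lemma P_dom: "p \<in> unit_square \<Longrightarrow> P p \<in> dom_of c" "p \<in> unit_square \<Longrightarrow> coord c (P p) = square_map z0 r p"
  using W_square W_D[OF c b] by (auto simp: P_def)

lemma continuous_P: "continuous_on unit_square P"
  unfolding P_def using sub W_D(4)[OF c b]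
  by (intro continuous_on_compose2[OF chart_simps(4)[OF chart[OF c]]] continuous_intros) auto

lemma continuous_G: "continuous_on unit_square G"
  unfolding G_def P_def using sub W_D(4)[OF c b]
  by (intro continuous_on_compose2[OF continuous_metric[OF c]] continuous_intros) auto

lemma G_pos: "p \<in> unit_square \<Longrightarrow> G p > 0"
  unfolding G_def using metric_pos[OF c P_dom(1)] r by simp

text \<open>The time derivative is the Frechet derivative in the direction \<open>(0, 1)\<close>,
  taken within the half-open interval and hence one-sided at \<open>t = 0\<close>.\<close>

lemma patch_time_regularity:
  assumes smooth: "smooth_on_spacetime A T f"
  obtains ut where
    "continuous_on ({0..<T} \<times> unit_square) (\<lambda>(t, p). exp (f (P p) t))"
    "continuous_on ({0..<T} \<times> unit_square) (\<lambda>(t, p). ut t p)"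
    "\<And>t p. t \<in> {0..<T} \<Longrightarrow> p \<in> unit_square \<Longrightarrow>
       ((\<lambda>s. exp (f (P p) s)) has_real_derivative ut t p) (at t within {0..<T})"
proof -
  define D where "D = coord c ` dom_of c"
  have "Ck_on (Suc 0) (D \<times> {0..<T}) (\<lambda>(w, t). f (inv_coord c w) t)"
    using smooth c unfolding smooth_on_spacetime_def smooth_on_def D_def by blast
  then obtain F' where F': "\<And>x. x \<in> D \<times> {0..<T} \<Longrightarrow> ((\<lambda>(w, t). f (inv_coord c w) t) has_derivative F' x) (at x within D \<times> {0..<T})"
    "\<And>v. Ck_on 0 (D \<times> {0..<T}) (\<lambda>x. F' x v)" by (rule Ck_on_SucE) blast
  have c0: "continuous_on (D \<times> {0..<T}) (\<lambda>(w, t). f (inv_coord c w) t)"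
    using smooth c unfolding smooth_on_spacetime_def smooth_on_def D_def using Ck_on.simps(1) by blast
  have c1: "continuous_on (D \<times> {0..<T}) (\<lambda>x. F' x (0, 1))" using F'(2) by simp
  have inD: "square_map z0 r p \<in> D" if "p \<in> unit_square" for p
    using W_square[OF that] W_D(4)[OF c b] by (auto simp: D_def)
  have csm: "continuous_on ({0..<T} \<times> unit_square) (\<lambda>y. (square_map z0 r (snd y), fst y))"
    by (intro continuous_on_Pair continuous_on_compose2[OF continuous_on_square_map[of UNIV] continuous_on_snd[OF continuous_on_id]]
        continuous_on_fst[OF continuous_on_id]) auto
  have im: "(\<lambda>y. (square_map z0 r (snd y), fst y)) ` ({0..<T} \<times> unit_square) \<subseteq> D \<times> {0..<T}"
    using inD by fastforce
  have cu: "continuous_on ({0..<T} \<times> unit_square) (\<lambda>y. f (P (snd y)) (fst y))"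
    using continuous_on_compose2[OF c0 csm im] by (simp add: P_def)
  have cF: "continuous_on ({0..<T} \<times> unit_square) (\<lambda>y. F' (square_map z0 r (snd y), fst y) (0, 1))"
    using continuous_on_compose2[OF c1 csm im] .
  show ?thesis
  proof (rule that[of "\<lambda>t p. exp (f (P p) t) * F' (square_map z0 r p, t) (0, 1)"])
    show "continuous_on ({0..<T} \<times> unit_square) (\<lambda>(t, p). exp (f (P p) t))"
      "continuous_on ({0..<T} \<times> unit_square) (\<lambda>(t, p). exp (f (P p) t) * F' (square_map z0 r p, t) (0, 1))"
      unfolding case_prod_beta by (intro continuous_intros cu cF)+
    fix t p assume t: "t \<in> {0..<T}" and p: "p \<in> unit_square"
    define w where "w = square_map z0 r p"
    have w: "(w, t) \<in> D \<times> {0..<T}" using t inD[OF p] by (simp add: w_def)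
    have "((\<lambda>s. (w, s)) has_derivative (\<lambda>s. (0, s))) (at t within {0..<T})"
      by (auto intro!: derivative_eq_intros)
    from has_derivative_in_compose2[OF F'(1) _ t this]
    have "((\<lambda>s. f (inv_coord c w) s) has_derivative (\<lambda>s. F' (w, t) (0, s))) (at t within {0..<T})"
      using w by (auto simp: split_def)
    moreover have "(\<lambda>s. F' (w, t) (0, s)) = (*) (F' (w, t) (0, 1))"
    proof
      fix s
      show "F' (w, t) (0, s) = F' (w, t) (0, 1) * s"
        using linear_cmul[OF has_derivative_linear[OF F'(1)[OF w]], of s "(0, 1)"] by (simp add: mult.commute)
    qed
    ultimately have "((\<lambda>s. f (inv_coord c w) s) has_real_derivative F' (w, t) (0, 1)) (at t within {0..<T})"
      by (simp only: has_field_derivative_def)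
    then show "((\<lambda>s. exp (f (P p) s)) has_real_derivative exp (f (P p) t) * F' (square_map z0 r p, t) (0, 1)) (at t within {0..<T})"
      by (auto intro!: derivative_eq_intros simp: P_def w_def)
  qed
qed

text \<open>The second derivatives of \<open>v\<close> come from the regularity of \<open>V\<close>,
  the formulas for \<open>vx\<close> and \<open>vy\<close> from the quotient rule; uniqueness of
  derivatives joins the two.\<close>

lemma patch_equation:
  assumes smooth: "smooth_on_spacetime A T f" and flow: "flow_equation A g \<alpha> T f"
    and t: "t \<in> {0..<T}"
    and q: "partial_x (\<lambda>p. - (\<alpha> / 2 * K (square_map z0 r p))) qx" "partial_y (\<lambda>p. - (\<alpha> / 2 * K (square_map z0 r p))) qy"
    and ut: "\<And>p. p \<in> unit_square \<Longrightarrow>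
       ((\<lambda>s. exp (f (P p) s)) has_real_derivative ut p) (at t within {0..<T})"
  obtains ux uy vx vy vxx vyy where
    "partial_x (\<lambda>p. exp (f (P p) t)) ux" "partial_y (\<lambda>p. exp (f (P p) t)) uy"
    "partial_x vx vxx" "partial_y vy vyy"
    "\<And>p. p \<in> unit_square \<Longrightarrow> vx p = (1 + - (\<alpha> / 2 * K (square_map z0 r p)) / (exp (f (P p) t))\<^sup>2) * ux p - qx p / exp (f (P p) t)"
    "\<And>p. p \<in> unit_square \<Longrightarrow> vy p = (1 + - (\<alpha> / 2 * K (square_map z0 r p)) / (exp (f (P p) t))\<^sup>2) * uy p - qy p / exp (f (P p) t)"
    "\<And>p. p \<in> unit_square \<Longrightarrow> G p * ut p = vxx p + vyy p
        + G p * (- K (square_map z0 r p)) * (exp (f (P p) t) - - (\<alpha> / 2 * K (square_map z0 r p)) / exp (f (P p) t))"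
proof -
  define D where "D = coord c ` dom_of c"
  have WD: "W c b \<subseteq> D" using W_D(4)[OF c b] by (simp add: D_def)
  have "Ck_on 2 (D \<times> {0..<T}) (\<lambda>(w, t). f (inv_coord c w) t)"
    using smooth c unfolding smooth_on_spacetime_def smooth_on_def D_def by blast
  then have "Ck_on 2 (W c b) (\<lambda>w. (\<lambda>(w, t). f (inv_coord c w) t) ((0, t) + (w, 0)))"
    by (rule Ck_on_compose_affine) (use WD t in \<open>auto intro!: bounded_linear_intros bounded_linear_Pair bounded_linear_ident bounded_linear_zero\<close>)
  then have Cf: "Ck_on 2 (W c b) (\<lambda>w. f (inv_coord c w) t)" by simp
  then have Cu: "Ck_on 2 (W c b) (\<lambda>w. exp (f (inv_coord c w) t))" by (rule Ck_on_exp)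
  have "Ck_on 2 (W c b) (\<lambda>w. inverse (exp (f (inv_coord c w) t)))" by (rule Ck_on_inverse[OF Cu]) simp
  then have Ci: "Ck_on 2 (W c b) (\<lambda>w. exp (- f (inv_coord c w) t))" by (simp add: exp_minus)
  define V where "V = (\<lambda>w. exp (f (inv_coord c w) t) + \<alpha> / 2 * gauss_curvature g c (inv_coord c w) * exp (- f (inv_coord c w) t))"
  have CV: "Ck_on 2 (W c b) V"
    unfolding V_def K_def[symmetric] by (intro Ck_on_add Ck_on_mult Ck_on_const Cu Ci Ck_on_K)
  obtain ux uy uxx uyy where u: "partial_x (\<lambda>p. exp (f (P p) t)) ux" "partial_y (\<lambda>p. exp (f (P p) t)) uy"
    unfolding P_def by (rule partial_laplacian[OF open_W[OF c b] sub Cu]) blast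
  obtain vx vy vxx vyy where v: "partial_x (\<lambda>p. V (square_map z0 r p)) vx" "partial_y (\<lambda>p. V (square_map z0 r p)) vy"
    "partial_x vx vxx" "partial_y vy vyy"
    "\<And>p. p \<in> unit_square \<Longrightarrow> vxx p + vyy p
       = 4 * r\<^sup>2 * Re (wirtinger_z (wirtinger_zbar (\<lambda>w. complex_of_real (V w))) (square_map z0 r p))"
    by (rule partial_laplacian[OF open_W[OF c b] sub CV]) blast
  have V: "V (square_map z0 r p) = exp (f (P p) t) - - (\<alpha> / 2 * K (square_map z0 r p)) / exp (f (P p) t)" for p
    by (simp only: V_def K_def P_def exp_minus divide_inverse mult_minus_left diff_minus_eq_add)
  have vv: "partial_x (\<lambda>p. V (square_map z0 r p)) (\<lambda>p. (1 + - (\<alpha> / 2 * K (square_map z0 r p)) / (exp (f (P p) t))\<^sup>2) * ux p - qx p / exp (f (P p) t))"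
    "partial_y (\<lambda>p. V (square_map z0 r p)) (\<lambda>p. (1 + - (\<alpha> / 2 * K (square_map z0 r p)) / (exp (f (P p) t))\<^sup>2) * uy p - qy p / exp (f (P p) t))"
    unfolding V by (rule partial_minus_div[OF u q]; simp)+
  show ?thesis
  proof (rule that[OF u v(3,4)])
    fix p assume p: "p \<in> unit_square"
    show "vx p = (1 + - (\<alpha> / 2 * K (square_map z0 r p)) / (exp (f (P p) t))\<^sup>2) * ux p - qx p / exp (f (P p) t)"
      by (rule partial_x_unique[OF v(1) vv(1) p])
    show "vy p = (1 + - (\<alpha> / 2 * K (square_map z0 r p)) / (exp (f (P p) t))\<^sup>2) * uy p - qy p / exp (f (P p) t)"
      by (rule partial_y_unique[OF v(2) vv(2) p])
    define d where "d = ddbar c (\<lambda>y. exp (f y t) + \<alpha> / 2 * gauss_curvature g c y * exp (- f y t)) (P p)"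
    have lap: "vxx p + vyy p = 4 * r\<^sup>2 * d"
      unfolding v(5)[OF p] d_def ddbar_def P_dom(2)[OF p] V_def ..
    have "((\<lambda>s. exp (f (P p) s)) has_real_derivative
        inverse (g c (P p)) * d - gauss_curvature g c (P p) * (exp (f (P p) t) + \<alpha> / 2 * gauss_curvature g c (P p) * exp (- f (P p) t)))
        (at t within {0..<T})"
      using flow c P_dom(1)[OF p] t unfolding flow_equation_def laplacian_def d_def by blast
    \<comment> \<open>The derivative given by the flow equation agrees with \<open>ut\<close>
      because \<open>t\<close> is a limit point of the interval, also for
      \<open>t = 0\<close>.\<close>
    moreover have "at t within {0..<T} \<noteq> bot"
      using t islimpt_Ico[of 0 T t] by (simp add: trivial_limit_within)
    ultimately have utp: "ut p = inverse (g c (P p)) * d - gauss_curvature g c (P p) * V (square_map z0 r p)"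
      using has_field_derivative_unique[OF ut[OF p]] unfolding V_def P_def by blast
    have k: "K (square_map z0 r p) = gauss_curvature g c (P p)" by (simp add: K_def P_def)
    have "G p * ut p = 4 * r\<^sup>2 * d + G p * (- K (square_map z0 r p)) * V (square_map z0 r p)"
      unfolding utp G_def k using metric_pos[OF c P_dom(1)[OF p]] by (simp add: field_simps)
    then show "G p * ut p = vxx p + vyy p
        + G p * (- K (square_map z0 r p)) * (exp (f (P p) t) - - (\<alpha> / 2 * K (square_map z0 r p)) / exp (f (P p) t))"
      unfolding lap V .
  qed
qed

text \<open>\<open>q0\<close> precedes \<open>T\<close> and \<open>f\<close>: it bounds the
  curvature, \<open>q\<close> with its gradient, and the weight \<open>G\<close>, all of which
  depend only on the square and on \<open>\<alpha>\<close>.\<close>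

lemma patch_estimates:
  assumes alpha: "\<alpha> > 0"
  obtains q0 where "q0 \<ge> 1" "\<And>p. p \<in> unit_square \<Longrightarrow> G p \<le> q0"
    "\<And>T f. smooth_on_spacetime A T f \<Longrightarrow> flow_equation A g \<alpha> T f \<Longrightarrow>
      energy_solution G q0 T (\<lambda>t p. exp (f (P p) t))"
proof -
  have "Ck_on 2 (W c b) (\<lambda>w. (- (\<alpha> / 2)) * K w)" by (intro Ck_on_mult Ck_on_const Ck_on_K)
  then have Cq: "Ck_on 2 (W c b) (\<lambda>w. - (\<alpha> / 2 * K w))" by simp
  obtain qx qy where q: "partial_x (\<lambda>p. - (\<alpha> / 2 * K (square_map z0 r p))) qx" "partial_y (\<lambda>p. - (\<alpha> / 2 * K (square_map z0 r p))) qy"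
    by (rule partial_laplacian[OF open_W[OF c b] sub Cq]) blast
  have ck: "continuous_on unit_square (\<lambda>p. K (square_map z0 r p))"
    using sub by (intro continuous_on_compose2[OF Ck_on_imp_continuous_on[OF Ck_on_K]] continuous_intros) auto
  obtain M1 M2 M3 M4 where M: "\<And>p. p \<in> unit_square \<Longrightarrow> \<bar>K (square_map z0 r p)\<bar> \<le> M1"
    "\<And>p. p \<in> unit_square \<Longrightarrow> \<bar>qx p\<bar> \<le> M2" "\<And>p. p \<in> unit_square \<Longrightarrow> \<bar>qy p\<bar> \<le> M3"
    "\<And>p. p \<in> unit_square \<Longrightarrow> \<bar>G p\<bar> \<le> M4"
    using bounded_on_unit_square[OF ck] bounded_on_unit_square[OF continuous_G]
      bounded_on_unit_square[of qx] bounded_on_unit_square[of qy] q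
    unfolding partial_x_def partial_y_def by metis
  define q0 where "q0 = Max {1, M1, \<alpha> / 2 * M1, M2, M3, M4}"
  have q0: "1 \<le> q0" "M1 \<le> q0" "\<alpha> / 2 * M1 \<le> q0" "M2 \<le> q0" "M3 \<le> q0" "M4 \<le> q0"
    unfolding q0_def by (auto intro: Max_ge)
  have bK: "0 \<le> - K (square_map z0 r p) \<and> - K (square_map z0 r p) \<le> q0" if "p \<in> unit_square" for p
    using M(1)[OF that] K_nonpos[OF W_square[OF that]] q0 by auto
  have bq: "0 \<le> - (\<alpha> / 2 * K (square_map z0 r p)) \<and> - (\<alpha> / 2 * K (square_map z0 r p)) \<le> q0" if "p \<in> unit_square" for p
  proof -
    have "\<alpha> / 2 * (- K (square_map z0 r p)) \<le> \<alpha> / 2 * M1"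
      using alpha M(1)[OF that] by (intro mult_left_mono) auto
    moreover have "0 \<le> \<alpha> / 2 * (- K (square_map z0 r p))" using bK[OF that] alpha by (intro mult_nonneg_nonneg) auto
    ultimately show ?thesis using q0 by simp
  qed
  have bG: "0 < G p \<and> G p \<le> q0" if "p \<in> unit_square" for p
    using G_pos[OF that] M(4)[OF that] q0 by auto
  have bx: "\<bar>qx p\<bar> \<le> q0" "\<bar>qy p\<bar> \<le> q0" if "p \<in> unit_square" for p
    using M(2,3)[OF that] q0 by auto
  show ?thesis
  proof (rule that[OF q0(1)])
    show "p \<in> unit_square \<Longrightarrow> G p \<le> q0" for p using bG by blast
    fix T f assume smooth: "smooth_on_spacetime A T f" and flow: "flow_equation A g \<alpha> T f"
    obtain ut where ut: "continuous_on ({0..<T} \<times> unit_square) (\<lambda>(t, p). exp (f (P p) t))"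
      "continuous_on ({0..<T} \<times> unit_square) (\<lambda>(t, p). ut t p)"
      "\<And>t p. t \<in> {0..<T} \<Longrightarrow> p \<in> unit_square \<Longrightarrow>
       ((\<lambda>s. exp (f (P p) s)) has_real_derivative ut t p) (at t within {0..<T})"
      by (rule patch_time_regularity[OF smooth]) (rule that, assumption+)
    have est: "\<exists>d. energy_bounds G q0 (\<lambda>p. exp (f (P p) t)) (ut t) m d" if t: "t \<in> {0..<T}" and m: "m \<ge> 1" for t m
    proof -
      define u where "u = (\<lambda>p. exp (f (P p) t))"
      have upos: "u p > 0" and uexp: "exp (f (P p) t) = u p" for p by (simp_all add: u_def)
      obtain ux uy vx vy vxx vyy where
        u: "partial_x u ux" "partial_y u uy" "partial_x vx vxx" "partial_y vy vyy"
        and v: "\<And>p. p \<in> unit_square \<Longrightarrow> vx p = (1 + - (\<alpha> / 2 * K (square_map z0 r p)) / (u p)\<^sup>2) * ux p - qx p / u p"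
        "\<And>p. p \<in> unit_square \<Longrightarrow> vy p = (1 + - (\<alpha> / 2 * K (square_map z0 r p)) / (u p)\<^sup>2) * uy p - qy p / u p"
        "\<And>p. p \<in> unit_square \<Longrightarrow> G p * ut t p = vxx p + vyy p
          + G p * (- K (square_map z0 r p)) * (u p - - (\<alpha> / 2 * K (square_map z0 r p)) / u p)"
        by (rule patch_equation[OF smooth flow t q ut(3)[OF t], unfolded uexp]) (assumption, rule that, assumption+)
      have cut: "continuous_on unit_square (ut t)"
      proof -
        have "continuous_on unit_square (\<lambda>p. (\<lambda>(t, p). ut t p) (t, p))"
          by (rule continuous_on_compose2[OF ut(2) continuous_on_Pair[OF continuous_on_const continuous_on_id]])
             (use t in auto)
        then show ?thesis by simp
      qed
      have cu: "continuous_on unit_square u" "continuous_on unit_square ux" "continuous_on unit_square uy" "continuous_on unit_square cutoff"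
        using u partial_cutoff by (auto simp: partial_x_def partial_y_def)
      define d where "d = integral unit_square (\<lambda>p. cutoff p * u p ^ (5*m - 2) * ((ux p)\<^sup>2 + (uy p)\<^sup>2))"
      have "0 \<le> d"
        unfolding d_def using cutoff_bounds(1) less_imp_le[OF upos]
        by (intro integral_nonneg integrable_unit_square continuous_intros cu) simp
      moreover have "integral unit_square (\<lambda>p. cutoff p * G p * (real (5*m) * u p ^ (5*m-1) * ut t p))
            \<le> - d + 45 * (real (5*m))\<^sup>2 * q0\<^sup>2 * (4 + integral unit_square (\<lambda>p. u p ^ (5*m)))"
      proof -
        \<comment> \<open>The energy estimate is used with \<open>n = 5 * m - 1\<close>; its
          restriction \<open>n \<ge> 4\<close> is met from \<open>m = 1\<close> on.\<close>
        have e: "5 * m - 1 + 1 = 5 * m" "5 * m - 1 - 1 = 5 * m - 2" and m4: "5 * m - 1 \<ge> 4" using m by auto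
        show ?thesis
          unfolding d_def
          by (rule energy_estimate[OF upos u bq bx q0(1) m4 v(1,2) continuous_G cut bG bK v(3), unfolded e])
      qed
      moreover have "integral unit_square (\<lambda>p. (cutoff p)\<^sup>2 * u p ^ (6*m))
            \<le> 32 * (real m)\<^sup>2 * integral unit_square (\<lambda>p. u p ^ m) * (d + integral unit_square (\<lambda>p. u p ^ (5*m)))"
        unfolding d_def by (rule sobolev_power[OF upos u(1,2) m])
      ultimately have "energy_bounds G q0 u (ut t) m d" unfolding energy_bounds_def by (intro conjI)
      then show ?thesis unfolding u_def by (rule exI)
    qed
    show "energy_solution G q0 T (\<lambda>t p. exp (f (P p) t))"
      unfolding energy_solution_def by (intro exI[of _ ut] conjI ballI allI impI ut est)
  qed
qed

end

end

section \<open>From energy and Sobolev bounds to a differential inequality\<close>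

lemma continuous_time_slice:
  assumes "continuous_on (J \<times> unit_square) (\<lambda>(t, p). w t p)" "t \<in> J"
  shows "continuous_on unit_square (w t)"
proof -
  have "continuous_on unit_square (\<lambda>p. (\<lambda>(t, p). w t p) (t, p))"
    by (rule continuous_on_compose2[OF assms(1) continuous_on_Pair[OF continuous_on_const continuous_on_id]])
       (use assms(2) in auto)
  then show ?thesis by simp
qed

lemma continuous_cutoff: "continuous_on S cutoff"
  unfolding cutoff_def bump_def by (intro continuous_intros)

text \<open>For \<open>X \<le> l\<close> the first term suffices, otherwise the second.\<close>

lemma power_interpolation:
  fixes X l :: real
  assumes "X > 0" "l > 0"
  shows "X ^ 5 \<le> l ^ 4 * X + X ^ 6 / l"
proof (cases "X \<le> l")
  case True
  then have "X ^ 4 * X \<le> l ^ 4 * X" using assms by (intro mult_right_mono power_mono) auto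
  moreover have "X ^ 4 * X = X ^ 5" by (simp add: numeral_eq_Suc)
  moreover have "X ^ 6 / l \<ge> 0" using assms by simp
  ultimately show ?thesis by linarith
next
  case False
  then have "X ^ 5 * l \<le> X ^ 5 * X" using assms by (intro mult_left_mono) auto
  moreover have "X ^ 5 * X = X ^ 6" by (simp add: numeral_eq_Suc)
  ultimately have "X ^ 5 * l \<le> X ^ 6" by (simp only:)
  then have "X ^ 5 \<le> X ^ 6 / l" using assms by (simp add: pos_le_divide_eq)
  moreover have "l ^ 4 * X \<ge> 0" using assms by simp
  ultimately show ?thesis by linarith
qed

text \<open>Eliminates the Dirichlet term: the Sobolev bound and the interpolation give
  \<open>D \<ge> (l * Y5 - l^5 * Y1) / (a * m * Y1) - c * Y5\<close>. If the numerator is not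
  positive, \<open>D\<close> is discarded; otherwise \<open>a\<close> may be enlarged to
  \<open>K\<close>.\<close>

lemma moser_coefficient:
  fixes Y1 Y5 Y6 D E a b c K :: real
  assumes pos: "Y1 > 0" "Y5 \<ge> 0" "D \<ge> 0" and coef: "a \<ge> 1" "b \<ge> 0" "c \<ge> 0" and m: "m \<ge> 1"
    and K: "K \<ge> a" "K \<ge> b + c"
    and E: "E \<le> - D + b * m * (Y5 + 1)"
    and sob: "Y6 \<le> a * m * Y1 * (D + c * Y5)"
    and l: "l > 0" and int: "Y5 \<le> l ^ 4 * Y1 + Y6 / l"
  shows "E \<le> - (l * Y5 - l ^ 5 * Y1) / (K * m * Y1) + K * m * (Y5 + 1)"
proof (cases "l * Y5 - l ^ 5 * Y1 \<le> 0")
  case True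
  then have "0 \<le> - (l * Y5 - l ^ 5 * Y1) / (K * m * Y1)"
    using pos coef m K by (intro divide_nonneg_nonneg) auto
  moreover have "b * m * (Y5 + 1) \<le> K * m * (Y5 + 1)"
    using pos coef m K by (intro mult_right_mono) auto
  ultimately show ?thesis using E pos by linarith
next
  case False
  have "l * Y5 \<le> l * (l ^ 4 * Y1 + Y6 / l)" using int l by (intro mult_left_mono) auto
  also have "\<dots> = l ^ 5 * Y1 + Y6" using l by (simp add: field_simps numeral_eq_Suc)
  finally have "l * Y5 - l ^ 5 * Y1 \<le> a * m * Y1 * (D + c * Y5)" using sob by simp
  then have "(l * Y5 - l ^ 5 * Y1) / (a * m * Y1) \<le> D + c * Y5"
    using pos coef m by (simp add: pos_divide_le_eq mult_ac)
  moreover have "(l * Y5 - l ^ 5 * Y1) / (K * m * Y1) \<le> (l * Y5 - l ^ 5 * Y1) / (a * m * Y1)"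
    using False pos coef m K by (intro divide_left_mono mult_right_mono mult_pos_pos) auto
  moreover have "c * Y5 + b * m * (Y5 + 1) \<le> K * m * (Y5 + 1)"
  proof -
    have "c * Y5 \<le> (c * m) * (Y5 + 1)"
      using coef m pos mult_left_mono[of 1 m c] by (intro mult_mono) auto
    then have "c * Y5 + b * m * (Y5 + 1) \<le> (b + c) * m * (Y5 + 1)" by (simp add: algebra_simps)
    also have "\<dots> \<le> K * m * (Y5 + 1)" using K m pos by (intro mult_right_mono) auto
    finally show ?thesis .
  qed
  ultimately show ?thesis unfolding minus_divide_left[symmetric] using E by linarith
qed

text \<open>The factor \<open>e\<close> is lost in roots of growing order, as when norms with
  exponent \<open>p\<close> tend to the supremum: \<open>(a / L)^n\<close> would exceed
  \<open>1 / e\<close> if \<open>a > L\<close>.\<close>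

lemma power_bound_imp_le:
  fixes a L e :: real
  assumes "e > 0" "L > 0" and le: "\<And>k. e * a ^ (5 ^ Suc k) \<le> L ^ (5 ^ Suc k)"
  shows "a \<le> L"
proof (rule ccontr)
  assume "\<not> a \<le> L"
  then have "1 < a / L" using assms by simp
  then obtain n where n: "1 / e < (a / L) ^ n" using real_arch_pow by blast
  have "n \<le> 5 ^ Suc n"
  proof (induction n)
    case (Suc n)
    have "1 \<le> (5::nat) ^ n" by simp
    then show ?case using Suc unfolding power_Suc by linarith
  qed simp
  then have "(a / L) ^ n \<le> (a / L) ^ (5 ^ Suc n)" using \<open>1 < a / L\<close> by (intro power_increasing) auto
  with n have "1 / e < a ^ (5 ^ Suc n) / L ^ (5 ^ Suc n)" by (simp add: power_divide)
  then have "L ^ (5 ^ Suc n) < e * a ^ (5 ^ Suc n)"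
    using assms by (simp add: field_simps del: power_Suc)
  with le[of n] show False by simp
qed

section \<open>The iteration for a finite family of squares\<close>

definition half_square :: "(real \<times> real) set" where
  "half_square = cbox (-1/2, -1/2) (1/2, 1/2)"

text \<open>\<open>\<gamma>\<close> and \<open>q0\<close> pinch the weights, and
  \<open>\<kappa>\<close> will compare an integral over one full square with the cut off integrals
  over all squares. None of these data involves the solution, which enters in
  \<open>patch_solution\<close>.\<close>

locale patch_family =
  fixes I :: "'i set" and G :: "'i \<Rightarrow> real \<times> real \<Rightarrow> real" and q0 \<gamma> \<kappa> :: real
  assumes I: "finite I" "I \<noteq> {}" and q0: "q0 \<ge> 1" and \<gamma>: "\<gamma> > 0" and \<kappa>: "\<kappa> \<ge> 0"
    and contG: "\<And>i. i \<in> I \<Longrightarrow> continuous_on unit_square (G i)"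
    and G: "\<And>i p. i \<in> I \<Longrightarrow> p \<in> unit_square \<Longrightarrow> \<gamma> \<le> G i p \<and> G i p \<le> q0"

locale patch_solution = patch_family I G q0 \<gamma> \<kappa>
  for I :: "'i set" and G q0 \<gamma> \<kappa> +
  fixes T :: real and u ut :: "'i \<Rightarrow> real \<Rightarrow> real \<times> real \<Rightarrow> real"
  assumes contu: "\<And>i. i \<in> I \<Longrightarrow> continuous_on ({0..<T} \<times> unit_square) (\<lambda>(t, p). u i t p)"
    and contut: "\<And>i. i \<in> I \<Longrightarrow> continuous_on ({0..<T} \<times> unit_square) (\<lambda>(t, p). ut i t p)"
    and du: "\<And>i t p. i \<in> I \<Longrightarrow> t \<in> {0..<T} \<Longrightarrow> p \<in> unit_square \<Longrightarrow>
       ((\<lambda>s. u i s p) has_real_derivative ut i t p) (at t within {0..<T})"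
    and upos: "\<And>i t p. u i t p > 0"
    and energy: "\<And>i t m. i \<in> I \<Longrightarrow> t \<in> {0..<T} \<Longrightarrow> m \<ge> 1 \<Longrightarrow> \<exists>d. energy_bounds (G i) q0 (u i t) (ut i t) m d"
    and comparison: "\<And>i t m. i \<in> I \<Longrightarrow> t \<in> {0..<T} \<Longrightarrow>
       integral unit_square (\<lambda>p. u i t p ^ m) \<le> \<kappa> * (\<Sum>j\<in>I. integral unit_square (\<lambda>p. (cutoff p)\<^sup>2 * u j t p ^ m))"
begin

text \<open>The weight \<open>G\<close> is included so that differentiation in time yields exactly
  the left sides of the energy estimates.\<close>

definition "Y m t = (\<Sum>i\<in>I. integral unit_square (\<lambda>p. cutoff p * G i p * u i t p ^ m))"

definition "Y' m t = (\<Sum>i\<in>I. integral unit_square (\<lambda>p. cutoff p * G i p * (real m * u i t p ^ (m-1) * ut i t p)))"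

definition "compare_const = \<kappa> / \<gamma>"

lemma cont_ui: "i \<in> I \<Longrightarrow> t \<in> {0..<T} \<Longrightarrow> continuous_on unit_square (u i t)"
  by (rule continuous_time_slice[OF contu])

lemma compare_const: "compare_const \<ge> 0" using \<gamma> \<kappa> by (simp add: compare_const_def)

lemma square_le_Y:
  assumes t: "t \<in> {0..<T}"
  shows "(\<Sum>j\<in>I. integral unit_square (\<lambda>p. (cutoff p)\<^sup>2 * u j t p ^ m)) \<le> Y m t / \<gamma>"
  unfolding Y_def sum_divide_distrib
proof (rule sum_mono)
  fix j assume j: "j \<in> I"
  note [continuous_intros] = cont_ui[OF j t] contG[OF j] continuous_cutoff
  have "integral unit_square (\<lambda>p. (cutoff p)\<^sup>2 * u j t p ^ m) \<le> integral unit_square (\<lambda>p. cutoff p * G j p * u j t p ^ m / \<gamma>)"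
  proof (intro integral_le integrable_unit_square continuous_intros)
    fix p assume p: "p \<in> unit_square"
    note cb = cutoff_bounds[OF p]
    have "(cutoff p)\<^sup>2 * \<gamma> \<le> cutoff p * G j p"
      using cb G[OF j p] \<gamma> unfolding power2_eq_square mult.assoc
      by (intro mult_left_mono) (auto intro: order_trans[OF mult_left_le_one_le])
    then have "(cutoff p)\<^sup>2 * \<gamma> * u j t p ^ m \<le> cutoff p * G j p * u j t p ^ m"
      using upos[of j t p] by (intro mult_right_mono) auto
    then show "(cutoff p)\<^sup>2 * u j t p ^ m \<le> cutoff p * G j p * u j t p ^ m / \<gamma>"
      using \<gamma> by (simp add: field_simps)
  qed (use \<gamma> in auto)
  also have "\<dots> = integral unit_square (\<lambda>p. cutoff p * G j p * u j t p ^ m) / \<gamma>" by simp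
  finally show "integral unit_square (\<lambda>p. (cutoff p)\<^sup>2 * u j t p ^ m)
    \<le> integral unit_square (\<lambda>p. cutoff p * G j p * u j t p ^ m) / \<gamma>" .
qed

lemma patch_le_Y:
  assumes "i \<in> I" "t \<in> {0..<T}"
  shows "integral unit_square (\<lambda>p. u i t p ^ m) \<le> compare_const * Y m t"
proof -
  have "\<kappa> * (\<Sum>j\<in>I. integral unit_square (\<lambda>p. (cutoff p)\<^sup>2 * u j t p ^ m)) \<le> \<kappa> * (Y m t / \<gamma>)"
    by (rule mult_left_mono[OF square_le_Y[OF assms(2)] \<kappa>])
  then show ?thesis using comparison[OF assms, of m] by (simp add: compare_const_def)
qed

lemma Y_le_square:
  assumes t: "t \<in> {0..<T}"
  shows "Y m t \<le> q0 * real (card I) * \<kappa> * (\<Sum>j\<in>I. integral unit_square (\<lambda>p. (cutoff p)\<^sup>2 * u j t p ^ m))"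
proof -
  define R where "R = (\<Sum>j\<in>I. integral unit_square (\<lambda>p. (cutoff p)\<^sup>2 * u j t p ^ m))"
  have "Y m t \<le> (\<Sum>i\<in>I. q0 * (\<kappa> * R))"
    unfolding Y_def
  proof (rule sum_mono)
    fix i assume i: "i \<in> I"
    note [continuous_intros] = cont_ui[OF i t] contG[OF i] continuous_cutoff
    have "integral unit_square (\<lambda>p. cutoff p * G i p * u i t p ^ m) \<le> integral unit_square (\<lambda>p. q0 * u i t p ^ m)"
    proof (intro integral_le integrable_unit_square continuous_intros)
      fix p assume p: "p \<in> unit_square"
      have "cutoff p * G i p \<le> 1 * q0" using cutoff_bounds[OF p] G[OF i p] \<gamma> by (intro mult_mono) auto
      then show "cutoff p * G i p * u i t p ^ m \<le> q0 * u i t p ^ m"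
        using upos[of i t p] by (intro mult_right_mono) auto
    qed
    also have "\<dots> = q0 * integral unit_square (\<lambda>p. u i t p ^ m)" by simp
    also have "\<dots> \<le> q0 * (\<kappa> * R)" unfolding R_def using q0 by (intro mult_left_mono comparison i t) auto
    finally show "integral unit_square (\<lambda>p. cutoff p * G i p * u i t p ^ m) \<le> q0 * (\<kappa> * R)" .
  qed
  then show ?thesis by (simp add: R_def mult_ac)
qed

text \<open>The weight of \<open>Y\<close> vanishes on the edges of the squares, so positivity is
  drawn from the integral over a full square by \<open>patch_le_Y\<close>.\<close>

lemma Y_pos:
  assumes t: "t \<in> {0..<T}"
  shows "Y m t > 0"
proof -
  obtain i where i: "i \<in> I" using I by blast
  have "compact unit_square" by (simp add: unit_square_def)
  moreover have "unit_square \<noteq> {}" using unit_square_iff[of 0 0] by auto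
  ultimately obtain p0 where p0: "\<And>p. p \<in> unit_square \<Longrightarrow> u i t p0 \<le> u i t p"
    using continuous_attains_inf[OF _ _ cont_ui[OF i t]] by blast
  have "0 < 4 * u i t p0 ^ m" using upos by simp
  also have "\<dots> = integral unit_square (\<lambda>p. u i t p0 ^ m)"
    using integral_unique[OF has_integral_unit_square_const[of "u i t p0 ^ m"]] by simp
  also have "\<dots> \<le> integral unit_square (\<lambda>p. u i t p ^ m)"
    by (intro integral_le integrable_unit_square continuous_intros cont_ui i t power_mono p0) (auto intro: less_imp_le upos)
  also have "\<dots> \<le> compare_const * Y m t" by (rule patch_le_Y[OF i t])
  finally show ?thesis using compare_const by (simp add: zero_less_mult_iff)
qed

lemma Y_derivative:
  assumes t: "t \<in> {0..<T}"
  shows "(Y m has_real_derivative Y' m t) (at t within {0..<T})"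
  unfolding Y_def[abs_def] Y'_def
proof (rule DERIV_sum)
  fix i assume i: "i \<in> I"
  have cs: "continuous_on ({0..<T} \<times> unit_square) (\<lambda>x. u i (fst x) (snd x))"
    "continuous_on ({0..<T} \<times> unit_square) (\<lambda>x. ut i (fst x) (snd x))"
    using contu[OF i] contut[OF i] by (simp_all add: case_prod_beta')
  have cg: "continuous_on ({0..<T} \<times> unit_square) (\<lambda>x. G i (snd x))"
    "continuous_on ({0..<T} \<times> unit_square) (\<lambda>x. cutoff (snd x))"
    by (auto intro!: continuous_on_compose2[OF contG[OF i]] continuous_on_compose2[OF continuous_cutoff[of UNIV]] continuous_intros)
  show "((\<lambda>t. integral unit_square (\<lambda>p. cutoff p * G i p * u i t p ^ m)) has_real_derivative
      integral unit_square (\<lambda>p. cutoff p * G i p * (real m * u i t p ^ (m-1) * ut i t p))) (at t within {0..<T})"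
    unfolding unit_square_def
  proof (rule leibniz_rule_field_derivative, unfold unit_square_def[symmetric])
    fix s p assume s: "s \<in> {0..<T}" and p: "p \<in> unit_square"
    show "((\<lambda>t. cutoff p * G i p * u i t p ^ m) has_real_derivative cutoff p * G i p * (real m * u i s p ^ (m-1) * ut i s p)) (at s within {0..<T})"
      by (auto intro!: derivative_eq_intros du[OF i s p])
  next
    fix s assume "s \<in> {0..<T}"
    then show "(\<lambda>p. cutoff p * G i p * u i s p ^ m) integrable_on unit_square"
      by (intro integrable_unit_square continuous_intros cont_ui contG i continuous_cutoff)
  next
    show "continuous_on ({0..<T} \<times> unit_square) (\<lambda>(t, p). cutoff p * G i p * (real m * u i t p ^ (m-1) * ut i t p))"
      unfolding case_prod_beta' by (intro continuous_intros cs cg)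
  qed (use t in auto)
qed

lemma Y_interpolation:
  assumes t: "t \<in> {0..<T}" and l: "l > 0"
  shows "Y (5*m) t \<le> l ^ 4 * Y m t + Y (6*m) t / l"
  unfolding Y_def sum_divide_distrib sum_distrib_left sum.distrib[symmetric]
proof (rule sum_mono)
  fix i assume i: "i \<in> I"
  note [continuous_intros] = cont_ui[OF i t] contG[OF i] continuous_cutoff
  have "integral unit_square (\<lambda>p. cutoff p * G i p * u i t p ^ (5*m))
    \<le> integral unit_square (\<lambda>p. l ^ 4 * (cutoff p * G i p * u i t p ^ m) + cutoff p * G i p * u i t p ^ (6*m) / l)"
  proof (intro integral_le integrable_unit_square continuous_intros)
    fix p assume p: "p \<in> unit_square"
    have "(u i t p ^ m) ^ 5 \<le> l ^ 4 * u i t p ^ m + (u i t p ^ m) ^ 6 / l"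
      using upos[of i t p] l by (intro power_interpolation) auto
    then have "u i t p ^ (5*m) \<le> l ^ 4 * u i t p ^ m + u i t p ^ (6*m) / l"
      by (simp add: mult.commute flip: power_mult)
    then have "cutoff p * G i p * u i t p ^ (5*m) \<le> cutoff p * G i p * (l ^ 4 * u i t p ^ m + u i t p ^ (6*m) / l)"
      using cutoff_bounds[OF p] G[OF i p] \<gamma> by (intro mult_left_mono) auto
    then show "cutoff p * G i p * u i t p ^ (5*m) \<le> l ^ 4 * (cutoff p * G i p * u i t p ^ m) + cutoff p * G i p * u i t p ^ (6*m) / l"
      by (simp add: algebra_simps)
  qed (use l in auto)
  also have "\<dots> = l ^ 4 * integral unit_square (\<lambda>p. cutoff p * G i p * u i t p ^ m) + integral unit_square (\<lambda>p. cutoff p * G i p * u i t p ^ (6*m)) / l"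
    by (rule integral_unique) (intro has_integral_unit_square_intros has_integral_divide continuous_intros)
  finally show "integral unit_square (\<lambda>p. cutoff p * G i p * u i t p ^ (5*m))
    \<le> l ^ 4 * integral unit_square (\<lambda>p. cutoff p * G i p * u i t p ^ m) + integral unit_square (\<lambda>p. cutoff p * G i p * u i t p ^ (6*m)) / l" .
qed

definition "N = real (card I)"
text \<open>The three groups of summands are the coefficients \<open>a\<close>, \<open>b\<close> and
  \<open>c\<close> of \<open>moser_coefficient\<close>, in this order; 1125 is 45 times
  \<open>5^2\<close>.\<close>

definition "moser_const = 1 + 32 * (q0 * N * \<kappa>) * compare_const + 1125 * q0\<^sup>2 * N * (4 + compare_const) + N * compare_const"

lemma N: "N \<ge> 1" using I by (simp add: N_def Suc_le_eq card_gt_0_iff)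

text \<open>The sum of the Dirichlet terms of all squares plays the role of \<open>D\<close>; each
  full square integral on the right is replaced by \<open>compare_const * Y\<close>.\<close>

lemma Y_inequality:
  assumes t: "t \<in> {0..<T}" and m: "m \<ge> 1" and l: "l > 0"
  shows "Y' (5*m) t \<le> - (l * Y (5*m) t - l^5 * Y m t) / (moser_const * (real m)\<^sup>2 * Y m t) + moser_const * (real m)\<^sup>2 * (Y (5*m) t + 1)"
proof -
  have "\<forall>i\<in>I. \<exists>d. energy_bounds (G i) q0 (u i t) (ut i t) m d" using energy t m by blast
  then obtain d where d: "\<And>i. i \<in> I \<Longrightarrow> energy_bounds (G i) q0 (u i t) (ut i t) m (d i)" by metis
  define D where "D = (\<Sum>i\<in>I. d i)"
  have d0: "d i \<ge> 0" if "i \<in> I" for i using d[OF that] by (simp add: energy_bounds_def)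
  have D0: "D \<ge> 0" unfolding D_def using d0 by (intro sum_nonneg) auto
  have dD: "d i \<le> D" if "i \<in> I" for i
    unfolding D_def using that I(1) d0 by (intro member_le_sum) auto
  have Y5: "Y (5*m) t > 0" and Y1: "Y m t > 0" using Y_pos[OF t] by auto
  have m2: "(real m)\<^sup>2 \<ge> 1" using m by simp
  define e where "e = (\<lambda>i. integral unit_square (\<lambda>p. cutoff p * G i p * (real (5*m) * u i t p ^ (5*m-1) * ut i t p)))"
  have E: "Y' (5*m) t \<le> - D + (1125 * q0\<^sup>2 * N * (4 + compare_const)) * (real m)\<^sup>2 * (Y (5*m) t + 1)"
  proof -
    have "Y' (5*m) t \<le> (\<Sum>i\<in>I. - d i + 45 * (real (5*m))\<^sup>2 * q0\<^sup>2 * ((4 + compare_const) * (Y (5*m) t + 1)))"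
      unfolding Y'_def
    proof (rule sum_mono)
      fix i assume i: "i \<in> I"
      have "4 + integral unit_square (\<lambda>p. u i t p ^ (5*m)) \<le> (4 + compare_const) * (Y (5*m) t + 1)"
        using patch_le_Y[OF i t, of "5*m"] Y5 compare_const by (simp add: algebra_simps)
      then have "45 * (real (5*m))\<^sup>2 * q0\<^sup>2 * (4 + integral unit_square (\<lambda>p. u i t p ^ (5*m)))
         \<le> 45 * (real (5*m))\<^sup>2 * q0\<^sup>2 * ((4 + compare_const) * (Y (5*m) t + 1))" by (intro mult_left_mono) auto
      then show "integral unit_square (\<lambda>p. cutoff p * G i p * (real (5*m) * u i t p ^ (5*m-1) * ut i t p))
        \<le> - d i + 45 * (real (5*m))\<^sup>2 * q0\<^sup>2 * ((4 + compare_const) * (Y (5*m) t + 1))"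
        using d[OF i] unfolding energy_bounds_def by linarith
    qed
    also have "\<dots> = - D + N * (45 * (real (5*m))\<^sup>2 * q0\<^sup>2 * ((4 + compare_const) * (Y (5*m) t + 1)))"
      unfolding sum.distrib D_def N_def by (simp add: sum_negf)
    also have "\<dots> = - D + (1125 * q0\<^sup>2 * N * (4 + compare_const)) * (real m)\<^sup>2 * (Y (5*m) t + 1)"
      by (simp add: power_mult_distrib)
    finally show ?thesis .
  qed
  have S: "Y (6*m) t \<le> (1 + 32 * (q0 * N * \<kappa>) * compare_const) * (real m)\<^sup>2 * Y m t * (D + N * compare_const * Y (5*m) t)"
  proof -
    have "Y (6*m) t \<le> q0 * N * \<kappa> * (\<Sum>j\<in>I. integral unit_square (\<lambda>p. (cutoff p)\<^sup>2 * u j t p ^ (6*m)))"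
      unfolding N_def by (rule Y_le_square[OF t])
    also have "\<dots> \<le> q0 * N * \<kappa> * (\<Sum>j\<in>I. 32 * (real m)\<^sup>2 * (compare_const * Y m t) * (d j + compare_const * Y (5*m) t))"
    proof (intro mult_left_mono sum_mono)
      fix j assume j: "j \<in> I"
      have U0: "integral unit_square (\<lambda>p. u j t p ^ n) \<ge> 0" for n
        by (intro integral_nonneg integrable_unit_square continuous_intros cont_ui j t) (simp add: upos less_imp_le)
      have "integral unit_square (\<lambda>p. (cutoff p)\<^sup>2 * u j t p ^ (6*m))
        \<le> 32 * (real m)\<^sup>2 * integral unit_square (\<lambda>p. u j t p ^ m) * (d j + integral unit_square (\<lambda>p. u j t p ^ (5*m)))"
        using d[OF j] unfolding energy_bounds_def by blast
      also have "\<dots> \<le> 32 * (real m)\<^sup>2 * (compare_const * Y m t) * (d j + compare_const * Y (5*m) t)"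
        using patch_le_Y[OF j t] U0 d0[OF j] compare_const Y1
        by (intro mult_mono add_mono mult_nonneg_nonneg add_nonneg_nonneg) auto
      finally show "integral unit_square (\<lambda>p. (cutoff p)\<^sup>2 * u j t p ^ (6*m)) \<le> 32 * (real m)\<^sup>2 * (compare_const * Y m t) * (d j + compare_const * Y (5*m) t)" .
    qed (use q0 N \<kappa> in auto)
    also have "(\<Sum>j\<in>I. 32 * (real m)\<^sup>2 * (compare_const * Y m t) * (d j + compare_const * Y (5*m) t))
      = 32 * (real m)\<^sup>2 * (compare_const * Y m t) * (D + N * compare_const * Y (5*m) t)"
      unfolding sum_distrib_left[symmetric] sum.distrib by (simp add: D_def N_def)
    also have "q0 * N * \<kappa> * \<dots> = (32 * (q0 * N * \<kappa>) * compare_const) * ((real m)\<^sup>2 * Y m t * (D + N * compare_const * Y (5*m) t))" by simp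
    also have "\<dots> \<le> (1 + 32 * (q0 * N * \<kappa>) * compare_const) * ((real m)\<^sup>2 * Y m t * (D + N * compare_const * Y (5*m) t))"
      using Y1 Y5 D0 N compare_const by (intro mult_right_mono mult_nonneg_nonneg add_nonneg_nonneg) auto
    finally show ?thesis by (simp add: mult.assoc)
  qed
  have c0: "0 \<le> q0 * N * \<kappa> * compare_const" "0 \<le> q0\<^sup>2 * N * (4 + compare_const)" "0 \<le> N * compare_const" using q0 N \<kappa> compare_const by auto
  show ?thesis
  proof (rule moser_coefficient[OF Y1 less_imp_le[OF Y5] D0 _ _ c0(3) m2 _ _ E S l Y_interpolation[OF t l]])
    show "1 \<le> 1 + 32 * (q0 * N * \<kappa>) * compare_const" "0 \<le> 1125 * q0\<^sup>2 * N * (4 + compare_const)"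
      using q0 N \<kappa> compare_const by auto
    then show "1 + 32 * (q0 * N * \<kappa>) * compare_const \<le> moser_const" "1125 * q0\<^sup>2 * N * (4 + compare_const) + N * compare_const \<le> moser_const"
      unfolding moser_const_def using c0(3) by linarith+
  qed
qed

lemma moser_const: "moser_const \<ge> 1"
proof -
  have "0 \<le> 32 * (q0 * N * \<kappa>) * compare_const" "0 \<le> 1125 * q0\<^sup>2 * N * (4 + compare_const)" "0 \<le> N * compare_const" using q0 N \<kappa> compare_const by auto
  then show ?thesis by (simp add: moser_const_def)
qed

text \<open>If \<open>a\<close> lies below the value of \<open>u\<close> at the point, then
  \<open>u > a\<close> on a small box on which the weight is bounded below. Hence \<open>Y m\<close>
  is at least a fixed multiple of \<open>a^m\<close>, and \<open>power_bound_imp_le\<close> removes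
  the multiple.\<close>

lemma sup_bound:
  assumes T0: "0 < T0" "T0 \<le> t" "t < T" and B: "B \<ge> 1"
    and init: "\<And>s. s \<in> {0..<T} \<Longrightarrow> integral {0..s} (\<lambda>s. Y 1 s + 1) \<le> B"
    and i: "i \<in> I" and p0: "p0 \<in> half_square"
  shows "u i t p0 \<le> 25 * (1 + exp (moser_const * T0) * (8*moser_const)^4 * (2/T0)^9 * (1 + T0)) * B"
proof -
  define L where "L = 25 * (1 + exp (moser_const * T0) * (8*moser_const)^4 * (2/T0)^9 * (1 + T0)) * B"
  have t: "t \<in> {0..<T}" using T0 by auto
  have YL: "Y (5 ^ Suc k) t \<le> L ^ (5 ^ Suc k)" for k
    by (rule moser_iteration[where Y = Y and Y' = Y', OF T0(1) moser_const B Y_derivative Y_pos Y_inequality init L_def T0(2,3)])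
  have "0 < exp (moser_const * T0) * (8*moser_const)^4 * (2/T0)^9 * (1 + T0)" using moser_const T0 by auto
  then have "0 < 1 + exp (moser_const * T0) * (8*moser_const)^4 * (2/T0)^9 * (1 + T0)" by linarith
  then have L: "L > 0" unfolding L_def using B by (intro mult_pos_pos) linarith+
  have "a \<le> L" if a: "a < u i t p0" "0 < a" for a
  proof -
    have p0Q: "p0 \<in> unit_square" using p0 by (cases p0) (auto simp: half_square_def unit_square_iff cbox_Pair_iff cbox_interval)
    have "continuous_on unit_square (u i t)" by (rule cont_ui[OF i t])
    then obtain \<delta> where \<delta>: "\<delta> > 0" "\<And>p. p \<in> unit_square \<Longrightarrow> dist p p0 < \<delta> \<Longrightarrow> dist (u i t p) (u i t p0) < u i t p0 - a"
      using p0Q a unfolding continuous_on_iff by (metis diff_gt_0_iff_gt)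
    \<comment> \<open>Centred in the half square, a box of radius 1/4 stays where both coordinates
      are at most 3/4 in modulus, and there \<open>cutoff\<close> is at least 1/256. The bound
      \<open>\<delta> / 4\<close> makes the sum of the coordinate distances less than
      \<open>\<delta>\<close>.\<close>
    define r where "r = min (1/4) (\<delta> / 4)"
    have r: "0 < r" "r \<le> 1/4" "r \<le> \<delta> / 4" using \<delta> by (auto simp: r_def)
    obtain x0 y0 where xy: "p0 = (x0, y0)" by (cases p0)
    have x0: "x0 \<in> {-1/2..1/2}" "y0 \<in> {-1/2..1/2}" using p0 by (auto simp: half_square_def xy cbox_Pair_iff cbox_interval)
    define S where "S = cbox (x0 - r, y0 - r) (x0 + r, y0 + r)"
    have S: "x \<in> {-3/4..3/4}" "y \<in> {-3/4..3/4}" "\<bar>x - x0\<bar> \<le> r" "\<bar>y - y0\<bar> \<le> r" if "(x, y) \<in> S" for x y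
      using that r x0 by (auto simp: S_def cbox_Pair_iff cbox_interval)
    have SQ: "S \<subseteq> unit_square"
    proof
      fix p assume "p \<in> S"
      moreover obtain x y where "p = (x, y)" by (cases p)
      ultimately show "p \<in> unit_square" using S(1,2)[of x y] by (simp add: unit_square_iff)
    qed
    have bump: "bump s \<ge> 1/16" if "s \<in> {-3/4..3/4}" for s
    proof -
      have "\<bar>s\<bar> \<le> 3/4" using that by auto
      then have "s\<^sup>2 \<le> (3/4)\<^sup>2" by (metis abs_ge_zero power2_abs power_mono)
      then have "1/4 \<le> 1 - s\<^sup>2" by (simp add: power2_eq_square)
      then have "(1/4)\<^sup>2 \<le> (1 - s\<^sup>2)\<^sup>2" by (intro power_mono) auto
      then show ?thesis by (simp add: bump_def power2_eq_square)
    qed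
    have lower: "1/256 * \<gamma> * a ^ m \<le> cutoff p * G i p * u i t p ^ m" if p: "p \<in> S" for p m
    proof -
      obtain x y where pxy: "p = (x, y)" by (cases p)
      have pQ: "p \<in> unit_square" using SQ p by blast
      have "1/16 * (1/16) \<le> cutoff p" unfolding cutoff_def pxy fst_conv snd_conv
        using S[of x y] p pxy by (intro mult_mono bump) (auto simp: bump_def)
      then have c: "1/256 * \<gamma> \<le> cutoff p * G i p" using G[OF i pQ] \<gamma> by (intro mult_mono) auto
      have "dist p p0 \<le> \<bar>x - x0\<bar> + \<bar>y - y0\<bar>"
        unfolding pxy xy dist_Pair_Pair dist_real_def using sqrt_sum_squares_le_sum_abs[of "\<bar>x - x0\<bar>" "\<bar>y - y0\<bar>"] by simp
      also have "\<dots> < \<delta>" using S[of x y] p pxy r \<delta>(1) by simp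
      finally have "a < u i t p" using \<delta>(2)[OF pQ] by (simp add: dist_real_def)
      then have "a ^ m \<le> u i t p ^ m" using a by (intro power_mono) auto
      then show ?thesis
        by (rule mult_mono[OF c]) (use a \<gamma> cutoff_bounds(1)[OF pQ] G[OF i pQ] in auto)
    qed
    show "a \<le> L"
    proof (rule power_bound_imp_le[OF _ L])
      show "0 < 1/256 * \<gamma> * (4 * r\<^sup>2)" using \<gamma> r by simp
      fix k
      define m where "m = (5::nat) ^ Suc k"
      have cI: "continuous_on unit_square (\<lambda>p. cutoff p * G j p * u j t p ^ m)" if "j \<in> I" for j
        by (intro continuous_intros cont_ui contG continuous_cutoff that t)
      have "1/256 * \<gamma> * (4 * r\<^sup>2) * a ^ m = integral S (\<lambda>_. 1/256 * \<gamma> * a ^ m)"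
        using r by (simp add: S_def content_Pair power2_eq_square)
      also have "\<dots> \<le> integral S (\<lambda>p. cutoff p * G i p * u i t p ^ m)"
        using lower continuous_on_subset[OF cI[OF i] SQ] unfolding S_def
        by (intro integral_le integrable_continuous) auto
      also have "\<dots> \<le> integral unit_square (\<lambda>p. cutoff p * G i p * u i t p ^ m)"
      proof (rule integral_subset_le[OF SQ])
        show "(\<lambda>p. cutoff p * G i p * u i t p ^ m) integrable_on S"
          using continuous_on_subset[OF cI[OF i] SQ] unfolding S_def by (rule integrable_continuous)
        show "(\<lambda>p. cutoff p * G i p * u i t p ^ m) integrable_on unit_square"
          by (rule integrable_unit_square[OF cI[OF i]])
        show "\<forall>p\<in>unit_square. 0 \<le> cutoff p * G i p * u i t p ^ m"
        proof
          fix p assume p: "p \<in> unit_square"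
          have "0 \<le> G i p" using G[OF i p] \<gamma> by linarith
          then show "0 \<le> cutoff p * G i p * u i t p ^ m"
            using cutoff_bounds(1)[OF p] less_imp_le[OF upos[of i t p]] by simp
        qed
      qed
      also have "\<dots> \<le> Y m t"
        unfolding Y_def
      proof (rule member_le_sum[OF i _ I(1)])
        fix j assume "j \<in> I - {i}"
        then have j: "j \<in> I" by simp
        show "0 \<le> integral unit_square (\<lambda>p. cutoff p * G j p * u j t p ^ m)"
        proof (rule integral_nonneg[OF integrable_unit_square[OF cI[OF j]]])
          fix p assume p: "p \<in> unit_square"
          have "0 \<le> G j p" using G[OF j p] \<gamma> by linarith
          then show "0 \<le> cutoff p * G j p * u j t p ^ m"
            using cutoff_bounds(1)[OF p] less_imp_le[OF upos[of j t p]] by simp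
        qed
      qed
      also have "\<dots> \<le> L ^ m" unfolding m_def by (rule YL)
      finally show "1/256 * \<gamma> * (4 * r\<^sup>2) * a ^ 5 ^ Suc k \<le> L ^ 5 ^ Suc k" by (simp only: m_def)
    qed
  qed
  then show ?thesis unfolding L_def[symmetric]
    using dense_le_bounded[of 0 "u i t p0" L] upos by blast
qed

end

section \<open>Integrals over squares and cutoff bounds\<close>

lemma nn_integral_square_map:
  assumes r: "r > 0" and E: "compact E" and h: "h \<in> borel_measurable borel"
  shows "(\<integral>\<^sup>+w\<in>square_map z0 r ` E. h w \<partial>lborel) = (\<integral>\<^sup>+p\<in>E. h (square_map z0 r p) * ennreal (r\<^sup>2) \<partial>lborel)"
proof -
  define k where "k w = h w * indicator (square_map z0 r ` E) w" for w
  have "compact (square_map z0 r ` E)" by (intro compact_continuous_image continuous_intros E)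
  then have "square_map z0 r ` E \<in> sets borel" by (intro borel_closed compact_imp_closed)
  then have k: "k \<in> borel_measurable borel" unfolding k_def using h by simp
  have sq: "square_map z0 r p = z0 + r *\<^sub>R Complex (fst p) (snd p)" for p
    by (simp add: square_map_def scaleR_conv_of_real)
  have inj: "square_map z0 r p = square_map z0 r q \<longleftrightarrow> p = q" for p q
    using r by (auto simp: sq complex_eq_iff prod_eq_iff)
  have m1: "(\<lambda>w. z0 + r *\<^sub>R w) \<in> borel_measurable (borel :: complex measure)"
    by (intro borel_measurable_continuous_onI continuous_intros)
  have m2: "(\<lambda>p::real\<times>real. Complex (fst p) (snd p)) \<in> borel_measurable borel"
    unfolding Complex_eq by (intro borel_measurable_continuous_onI continuous_intros)
  have m3: "(\<lambda>w. k (z0 + r *\<^sub>R w)) \<in> borel_measurable (borel :: complex measure)"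
    using measurable_compose[OF m1 k] .
  have "(\<integral>\<^sup>+w. k w \<partial>lborel) = (\<integral>\<^sup>+w. k w \<partial>density (distr lborel borel (\<lambda>w. z0 + r *\<^sub>R w)) (\<lambda>_. ennreal (\<bar>r\<bar> ^ DIM(complex))))"
    using lborel_affine[of r z0] r by simp
  also have "\<dots> = (\<integral>\<^sup>+w. ennreal (r\<^sup>2) * k (z0 + r *\<^sub>R w) \<partial>lborel)"
    using m1 k by (subst nn_integral_density) (auto simp: nn_integral_distr)
  also have "\<dots> = (\<integral>\<^sup>+w. ennreal (r\<^sup>2) * k (z0 + r *\<^sub>R w) \<partial>distr lborel borel (\<lambda>p::real\<times>real. Complex (fst p) (snd p)))"
    by (simp only: distr_lborel_prod_complex)
  also have "\<dots> = (\<integral>\<^sup>+p. ennreal (r\<^sup>2) * k (square_map z0 r p) \<partial>lborel)"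
    using m2 m3 by (subst nn_integral_distr) (auto simp: sq)
  also have "\<dots> = (\<integral>\<^sup>+p\<in>E. h (square_map z0 r p) * ennreal (r\<^sup>2) \<partial>lborel)"
    by (intro nn_integral_cong) (auto simp: k_def indicator_def inj image_iff mult.commute)
  finally show ?thesis by (simp add: k_def)
qed

lemma nn_integral_unit_square:
  assumes "continuous_on unit_square F" "\<And>p. p \<in> unit_square \<Longrightarrow> F p \<ge> 0"
  shows "(\<integral>\<^sup>+p\<in>unit_square. ennreal (F p) \<partial>lborel) = ennreal (integral unit_square F)"
  by (rule nn_integral_has_integral_lebesgue'[OF assms(2) has_integral_unit_square[OF assms(1)]])

lemma half_square_iff: "(x, y) \<in> half_square \<longleftrightarrow> x \<in> {-1/2..1/2} \<and> y \<in> {-1/2..1/2}"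
  by (auto simp: half_square_def cbox_Pair_iff cbox_interval)

lemma half_square_subset: "half_square \<subseteq> unit_square"
  by (auto simp: half_square_def unit_square_def cbox_Pair_iff cbox_interval)

lemma cutoff_half_square:
  assumes "p \<in> half_square"
  shows "1/16 \<le> (cutoff p)\<^sup>2"
proof -
  obtain x y where p: "p = (x, y)" by (cases p)
  have bump: "bump s \<ge> 1/2" if "s \<in> {-1/2..1/2}" for s
  proof -
    have "\<bar>s\<bar> \<le> 1/2" using that by auto
    then have "s\<^sup>2 \<le> (1/2)\<^sup>2" by (metis abs_ge_zero power2_abs power_mono)
    then have "3/4 \<le> 1 - s\<^sup>2" by (simp add: power2_eq_square)
    then have "(3/4)\<^sup>2 \<le> (1 - s\<^sup>2)\<^sup>2" by (intro power_mono) auto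
    then show ?thesis by (simp add: bump_def power2_eq_square)
  qed
  have "x \<in> {-1/2..1/2}" "y \<in> {-1/2..1/2}" using assms by (auto simp: half_square_def p cbox_Pair_iff cbox_interval)
  then have "1/2 * (1/2) \<le> cutoff p" unfolding cutoff_def p fst_conv snd_conv
    by (intro mult_mono bump) (auto simp: bump_def)
  then have "(1/4)\<^sup>2 \<le> (cutoff p)\<^sup>2" by (intro power_mono) auto
  then show ?thesis by (simp add: power2_eq_square)
qed

text \<open>Permits a common constant, the maximum over the finitely many squares.\<close>

lemma energy_bounds_mono:
  assumes e: "energy_bounds G q u ut m d" and q: "0 \<le> q" "q \<le> q'"
    and u: "continuous_on unit_square u" "\<And>p. u p > 0"
  shows "energy_bounds G q' u ut m d"
proof -
  have "q\<^sup>2 \<le> q'\<^sup>2" using q by (intro power_mono) auto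
  moreover have "0 \<le> integral unit_square (\<lambda>p. u p ^ (5*m))"
    by (intro integral_nonneg integrable_unit_square continuous_intros u) (simp add: u less_imp_le)
  ultimately have "45 * (real (5*m))\<^sup>2 * q\<^sup>2 * (4 + integral unit_square (\<lambda>p. u p ^ (5*m)))
     \<le> 45 * (real (5*m))\<^sup>2 * q'\<^sup>2 * (4 + integral unit_square (\<lambda>p. u p ^ (5*m)))"
    by (intro mult_right_mono mult_left_mono) auto
  then show ?thesis using e unfolding energy_bounds_def by linarith
qed

section \<open>A finite cover of the surface by squares\<close>

context spinorial_pair
begin

definition patch :: "'a chart \<times> cp1 chart \<times> complex \<times> real \<Rightarrow> bool" where
  "patch = (\<lambda>(c, b, z0, r). c \<in> A \<and> b \<in> cp1_atlas \<and> r > 0 \<and> square_map z0 r ` unit_square \<subseteq> W c b)"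

definition patch_map :: "'a chart \<times> cp1 chart \<times> complex \<times> real \<Rightarrow> real \<times> real \<Rightarrow> 'a" where
  "patch_map = (\<lambda>(c, b, z0, r). P c z0 r)"

definition patch_weight :: "'a chart \<times> cp1 chart \<times> complex \<times> real \<Rightarrow> real \<times> real \<Rightarrow> real" where
  "patch_weight = (\<lambda>(c, b, z0, r). G c z0 r)"

lemma patch_continuous:
  assumes "patch i"
  shows "continuous_on unit_square (patch_map i)" "continuous_on unit_square (patch_weight i)"
    "\<And>p. p \<in> unit_square \<Longrightarrow> patch_weight i p > 0"
  using assms continuous_P continuous_G G_pos
  unfolding patch_def patch_map_def patch_weight_def by (auto split: prod.splits)

lemma patch_cover:
  obtains I where "finite I" "I \<noteq> {}" "\<And>i. i \<in> I \<Longrightarrow> patch i" "(\<Union>i\<in>I. patch_map i ` half_square) = UNIV"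
proof -
  have "\<exists>i N. patch i \<and> open N \<and> x \<in> N \<and> N \<subseteq> patch_map i ` half_square" for x
  proof -
    obtain c where c: "c \<in> A" "x \<in> dom_of c" using cover by blast
    obtain b where b: "b \<in> cp1_atlas" "\<phi> x \<in> dom_of b" using cp1_chart_exists by blast
    define z0 where "z0 = coord c x"
    note cs = chart_simps[OF chart[OF c(1)]]
    have "z0 \<in> W c b" using c b by (auto simp: W_def z0_def)
    then obtain e where e: "e > 0" "ball z0 e \<subseteq> W c b"
      using open_W[OF c(1) b(1)] open_contains_ball by blast
    \<comment> \<open>Points of the unit square have modulus at most 2 by the sum of their
      coordinates, and \<open>2 * e / 3 < e\<close>.\<close>
    define r where "r = e / 3"
    have r: "r > 0" using e by (simp add: r_def)
    have sub: "square_map z0 r ` unit_square \<subseteq> W c b"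
    proof
      fix w assume "w \<in> square_map z0 r ` unit_square"
      then obtain p q where pq: "w = square_map z0 r (p, q)" "p \<in> {-1..1}" "q \<in> {-1..1}"
        by (auto simp: unit_square_iff)
      have "cmod (Complex p q) \<le> \<bar>p\<bar> + \<bar>q\<bar>" using cmod_le[of "Complex p q"] by simp
      also have "\<dots> \<le> 2" using pq by auto
      finally have "r * cmod (Complex p q) \<le> r * 2" using r by (intro mult_left_mono) auto
      also have "\<dots> < e" using e by (simp add: r_def)
      finally have "dist z0 w < e" using r by (simp add: pq dist_norm square_map_def norm_mult)
      then show "w \<in> W c b" using e by auto
    qed
    define i where "i = (c, b, z0, r)"
    have pi: "patch i" using c b r sub by (simp add: patch_def i_def)
    define V where "V = {w. \<bar>Re (w - z0)\<bar> < r / 2} \<inter> {w. \<bar>Im (w - z0)\<bar> < r / 2}"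
    have "open V" unfolding V_def by (intro open_Int open_Collect_less continuous_intros)
    then have "open (coord c -` V \<inter> dom_of c)"
      using cs(3) continuous_on_open_vimage[OF cs(1)] by blast
    moreover have "x \<in> coord c -` V \<inter> dom_of c" using c r by (simp add: V_def z0_def)
    moreover have "coord c -` V \<inter> dom_of c \<subseteq> patch_map i ` half_square"
    proof
      fix y assume y: "y \<in> coord c -` V \<inter> dom_of c"
      define p where "p = (Re (coord c y - z0) / r, Im (coord c y - z0) / r)"
      have "square_map z0 r p = coord c y"
        using r by (simp add: square_map_def p_def complex_eq_iff)
      then have "patch_map i p = y" using y cs(5) by (simp add: patch_map_def i_def P_def[OF c(1) b(1) r sub])
      moreover have scale: "a / r \<in> {-1/2..1/2}" if "\<bar>a\<bar> < r / 2" for a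
        using that r by (auto simp: field_simps abs_less_iff)
      have "p \<in> half_square"
        unfolding p_def half_square_iff using y by (intro conjI scale) (auto simp: V_def)
      ultimately show "y \<in> patch_map i ` half_square" by blast
    qed
    ultimately show ?thesis using pi by blast
  qed
  then obtain i N where iN: "\<And>x. patch (i x)" "\<And>x. open (N x)" "\<And>x. x \<in> N x" "\<And>x. N x \<subseteq> patch_map (i x) ` half_square"
    by metis
  obtain C where C: "finite C" "UNIV \<subseteq> (\<Union>x\<in>C. N x)"
    using compactE_image[OF compact, of UNIV N] iN(2,3) by (metis UNIV_I UN_I subsetI)
  show ?thesis
  proof (rule that[of "i ` C"])
    show "finite (i ` C)" using C by simp
    show "i ` C \<noteq> {}" using C by auto
    show "\<And>j. j \<in> i ` C \<Longrightarrow> patch j" using iN by auto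
    show "(\<Union>j\<in>i ` C. patch_map j ` half_square) = UNIV" using C(2) iN(4) by blast
  qed
qed

text \<open>In the variables of the square the area element is \<open>2 * g * r^2\<close>, which is
  half of \<open>patch_weight\<close>.\<close>

lemma nn_integral_patch:
  assumes i: "patch i" and E: "compact E" "E \<subseteq> unit_square" and F: "continuous_on UNIV F" "\<And>x. F x \<ge> 0"
  shows "(\<integral>\<^sup>+x\<in>patch_map i ` E. ennreal (F x) \<partial>area_measure A g)
    = (\<integral>\<^sup>+p\<in>E. ennreal (F (patch_map i p) * patch_weight i p / 2) \<partial>lborel)"
    and "patch_map i ` E \<in> sets borel"
proof -
  obtain c b z0 r where ie: "i = (c, b, z0, r)" by (cases i) auto
  have c: "c \<in> A" "b \<in> cp1_atlas" "r > 0" "square_map z0 r ` unit_square \<subseteq> W c b"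
    using i by (auto simp: patch_def ie)
  note cs = chart_simps[OF chart[OF c(1)]]
  have "compact (patch_map i ` E)"
    by (intro compact_continuous_image continuous_on_subset[OF patch_continuous(1)[OF i]] E)
  then show b: "patch_map i ` E \<in> sets borel" by (intro borel_closed compact_imp_closed)
  have dom: "patch_map i ` E \<subseteq> dom_of c" using P_dom(1)[OF c] E by (auto simp: patch_map_def ie)
  have im: "coord c ` patch_map i ` E = square_map z0 r ` E"
    unfolding image_image patch_map_def ie using P_dom(2)[OF c] E by (intro image_cong) auto
  define h where "h = (\<lambda>w. ennreal (indicator (coord c ` dom_of c) w *\<^sub>R (F (inv_coord c w) * (2 * g c (inv_coord c w)))))"
  have h: "h \<in> borel_measurable borel" unfolding h_def
    using cs(2,4) by (intro measurable_compose[OF _ measurable_ennreal] borel_measurable_continuous_on_indicator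
        continuous_intros continuous_metric c continuous_on_compose2[OF F(1)]) auto
  have "(\<integral>\<^sup>+x\<in>patch_map i ` E. ennreal (F x) \<partial>area_measure A g)
    = (\<integral>\<^sup>+w\<in>coord c ` patch_map i ` E. ennreal (F (inv_coord c w)) * ennreal (2 * g c (inv_coord c w)) \<partial>lborel)"
    by (rule nn_integral_area_measure[OF c(1) b dom]) (intro measurable_compose[OF _ measurable_ennreal] borel_measurable_continuous_onI F)
  also have "\<dots> = (\<integral>\<^sup>+w\<in>coord c ` patch_map i ` E. h w \<partial>lborel)"
  proof (intro nn_integral_cong)
    fix w :: complex
    show "ennreal (F (inv_coord c w)) * ennreal (2 * g c (inv_coord c w)) * indicator (coord c ` patch_map i ` E) w
      = h w * indicator (coord c ` patch_map i ` E) w"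
    proof (cases "w \<in> coord c ` patch_map i ` E")
      case True
      then have "w \<in> coord c ` dom_of c" using dom by blast
      then have gp: "0 \<le> 2 * g c (inv_coord c w)" and "h w = ennreal (F (inv_coord c w) * (2 * g c (inv_coord c w)))"
        using metric_pos[OF c(1) cs(7)] by (auto simp: h_def intro: less_imp_le)
      then show ?thesis by (simp only: ennreal_mult[OF F(2) gp])
    qed simp
  qed
  also have "\<dots> = (\<integral>\<^sup>+p\<in>E. h (square_map z0 r p) * ennreal (r\<^sup>2) \<partial>lborel)"
    unfolding im by (rule nn_integral_square_map[OF c(3) E(1) h])
  also have "\<dots> = (\<integral>\<^sup>+p\<in>E. ennreal (F (patch_map i p) * patch_weight i p / 2) \<partial>lborel)"
  proof (intro nn_integral_cong)
    fix p :: "real \<times> real"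
    show "h (square_map z0 r p) * ennreal (r\<^sup>2) * indicator E p
      = ennreal (F (patch_map i p) * patch_weight i p / 2) * indicator E p"
    proof (cases "p \<in> E")
      case True
      then have p: "p \<in> unit_square" using E by auto
      have "square_map z0 r p \<in> coord c ` dom_of c"
        using W_square[OF c p] W_D(4)[OF c(1,2)] by blast
      then have "h (square_map z0 r p) = ennreal (F (P c z0 r p) * (2 * g c (P c z0 r p)))"
        by (simp add: h_def P_def[OF c])
      moreover have "0 \<le> F (P c z0 r p) * (2 * g c (P c z0 r p))"
        using F(2) less_imp_le[OF metric_pos[OF c(1) P_dom(1)[OF c p]]] by simp
      ultimately have "h (square_map z0 r p) * ennreal (r\<^sup>2) = ennreal (F (P c z0 r p) * (2 * g c (P c z0 r p)) * r\<^sup>2)"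
        by (simp only: ennreal_mult[OF _ zero_le_power2])
      also have "F (P c z0 r p) * (2 * g c (P c z0 r p)) * r\<^sup>2 = F (P c z0 r p) * G c z0 r p / 2"
        by (simp add: G_def[OF c])
      finally show ?thesis using True by (simp add: patch_map_def patch_weight_def ie)
    qed simp
  qed
  finally show "(\<integral>\<^sup>+x\<in>patch_map i ` E. ennreal (F x) \<partial>area_measure A g)
    = (\<integral>\<^sup>+p\<in>E. ennreal (F (patch_map i p) * patch_weight i p / 2) \<partial>lborel)" .
qed

lemma patch_integral_le:
  assumes i: "patch i" and F: "continuous_on UNIV F" "\<And>x. F x \<ge> 0"
  shows "ennreal (integral unit_square (\<lambda>p. F (patch_map i p) * patch_weight i p / 2))
    \<le> (\<integral>\<^sup>+x. ennreal (F x) \<partial>area_measure A g)"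
proof -
  have cont: "continuous_on unit_square (\<lambda>p. F (patch_map i p) * patch_weight i p / 2)"
    by (intro continuous_intros continuous_on_compose2[OF F(1)] patch_continuous i) auto
  have "ennreal (integral unit_square (\<lambda>p. F (patch_map i p) * patch_weight i p / 2))
    = (\<integral>\<^sup>+p\<in>unit_square. ennreal (F (patch_map i p) * patch_weight i p / 2) \<partial>lborel)"
    using F(2) patch_continuous(3)[OF i] by (intro nn_integral_unit_square[symmetric] cont) (simp add: less_imp_le)
  also have "\<dots> = (\<integral>\<^sup>+x\<in>patch_map i ` unit_square. ennreal (F x) \<partial>area_measure A g)"
    by (rule nn_integral_patch(1)[OF i _ _ F, symmetric]) (auto simp: unit_square_def)
  also have "\<dots> \<le> (\<integral>\<^sup>+x. ennreal (F x) \<partial>area_measure A g)"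
    by (intro nn_integral_mono) (auto simp: indicator_def)
  finally show ?thesis .
qed

text \<open>The integral over one square is at most \<open>2 / \<gamma>\<close> times that over the
  surface, which is at most the sum over the half squares, and on these
  \<open>1 \<le> 16 * (cutoff p)^2\<close>. With the density at most \<open>q0 / 2\<close> this
  gives \<open>16 * q0 / \<gamma>\<close>.\<close>

lemma patch_comparison:
  assumes I: "finite I" "\<And>j. j \<in> I \<Longrightarrow> patch j" "(\<Union>j\<in>I. patch_map j ` half_square) = UNIV"
    and G: "\<And>j p. j \<in> I \<Longrightarrow> p \<in> unit_square \<Longrightarrow> \<gamma> \<le> patch_weight j p \<and> patch_weight j p \<le> q0" and \<gamma>: "\<gamma> > 0" and q0: "q0 \<ge> 1"
    and F: "continuous_on UNIV F" "\<And>x. F x \<ge> 0" and i: "i \<in> I"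
  shows "integral unit_square (\<lambda>p. F (patch_map i p))
    \<le> (16 * q0 / \<gamma>) * (\<Sum>j\<in>I. integral unit_square (\<lambda>p. (cutoff p)\<^sup>2 * F (patch_map j p)))"
proof -
  have cF: "continuous_on unit_square (\<lambda>p. F (patch_map j p))" if "j \<in> I" for j
    by (intro continuous_on_compose2[OF F(1)] patch_continuous I(2) that) auto
  have cw: "continuous_on unit_square (patch_weight j)" if "j \<in> I" for j
    by (intro patch_continuous I(2) that)
  have nn: "0 \<le> integral unit_square (\<lambda>p. (cutoff p)\<^sup>2 * F (patch_map j p))" if "j \<in> I" for j
    using F(2) by (intro integral_nonneg integrable_unit_square continuous_intros continuous_cutoff cF that) auto
  have "(\<gamma> / 2) * integral unit_square (\<lambda>p. F (patch_map i p)) = integral unit_square (\<lambda>p. (\<gamma> / 2) * F (patch_map i p))" by simp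
  also have "\<dots> \<le> integral unit_square (\<lambda>p. F (patch_map i p) * patch_weight i p / 2)"
  proof (intro integral_le integrable_unit_square continuous_intros cF cw i)
    fix p assume p: "p \<in> unit_square"
    have "F (patch_map i p) * \<gamma> \<le> F (patch_map i p) * patch_weight i p"
      using F(2) G[OF i p] by (intro mult_left_mono) auto
    then show "(\<gamma> / 2) * F (patch_map i p) \<le> F (patch_map i p) * patch_weight i p / 2" by (simp add: mult.commute)
  qed auto
  finally have "ennreal ((\<gamma> / 2) * integral unit_square (\<lambda>p. F (patch_map i p)))
    \<le> ennreal (integral unit_square (\<lambda>p. F (patch_map i p) * patch_weight i p / 2))" by (rule ennreal_leI)
  also have "\<dots> \<le> (\<integral>\<^sup>+x. ennreal (F x) \<partial>area_measure A g)" by (rule patch_integral_le[OF I(2)[OF i] F])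
  also have "\<dots> \<le> (\<integral>\<^sup>+x. (\<Sum>j\<in>I. ennreal (F x) * indicator (patch_map j ` half_square) x) \<partial>area_measure A g)"
  proof (intro nn_integral_mono)
    fix x
    obtain j where j: "j \<in> I" "x \<in> patch_map j ` half_square" using I(3) by blast
    have "ennreal (F x) = ennreal (F x) * indicator (patch_map j ` half_square) x" using j by simp
    also have "\<dots> \<le> (\<Sum>j\<in>I. ennreal (F x) * indicator (patch_map j ` half_square) x)"
      using j I(1) by (intro member_le_sum) auto
    finally show "ennreal (F x) \<le> (\<Sum>j\<in>I. ennreal (F x) * indicator (patch_map j ` half_square) x)" .
  qed
  also have "\<dots> = (\<Sum>j\<in>I. \<integral>\<^sup>+x\<in>patch_map j ` half_square. ennreal (F x) \<partial>area_measure A g)"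
  proof (rule nn_integral_sum)
    fix j assume j: "j \<in> I"
    have "F \<in> borel_measurable (area_measure A g)"
      by (subst measurable_cong_sets[OF sets_area_measure refl]) (rule borel_measurable_continuous_onI[OF F(1)])
    moreover have "patch_map j ` half_square \<in> sets (area_measure A g)"
      using nn_integral_patch(2)[OF I(2)[OF j] _ half_square_subset F] by (simp add: half_square_def)
    ultimately show "(\<lambda>x. ennreal (F x) * indicator (patch_map j ` half_square) x) \<in> borel_measurable (area_measure A g)"
      by measurable
  qed
  also have "\<dots> \<le> (\<Sum>j\<in>I. ennreal (8 * q0 * integral unit_square (\<lambda>p. (cutoff p)\<^sup>2 * F (patch_map j p))))"
  proof (rule sum_mono)
    fix j assume j: "j \<in> I"
    have "(\<integral>\<^sup>+x\<in>patch_map j ` half_square. ennreal (F x) \<partial>area_measure A g)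
      = (\<integral>\<^sup>+p\<in>half_square. ennreal (F (patch_map j p) * patch_weight j p / 2) \<partial>lborel)"
      by (rule nn_integral_patch(1)[OF I(2)[OF j] _ half_square_subset F]) (simp add: half_square_def)
    also have "\<dots> \<le> (\<integral>\<^sup>+p\<in>unit_square. ennreal (8 * q0 * ((cutoff p)\<^sup>2 * F (patch_map j p))) \<partial>lborel)"
    proof (intro nn_integral_mono)
      fix p :: "real \<times> real"
      show "ennreal (F (patch_map j p) * patch_weight j p / 2) * indicator half_square p
        \<le> ennreal (8 * q0 * ((cutoff p)\<^sup>2 * F (patch_map j p))) * indicator unit_square p"
      proof (cases "p \<in> half_square")
        case True
        then have p: "p \<in> unit_square" using half_square_subset by blast
        have "F (patch_map j p) * patch_weight j p \<le> F (patch_map j p) * q0"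
          using F(2) G[OF j p] by (intro mult_left_mono) auto
        also have "\<dots> \<le> (16 * (cutoff p)\<^sup>2) * (F (patch_map j p) * q0)"
          using mult_right_mono[of 1 "16 * (cutoff p)\<^sup>2" "F (patch_map j p) * q0"] cutoff_half_square[OF True] F(2) q0 by simp
        finally have "F (patch_map j p) * patch_weight j p / 2 \<le> 8 * q0 * ((cutoff p)\<^sup>2 * F (patch_map j p))" by (simp add: mult_ac)
        then show ?thesis using True p by (simp add: ennreal_leI)
      qed simp
    qed
    also have "\<dots> = ennreal (integral unit_square (\<lambda>p. 8 * q0 * ((cutoff p)\<^sup>2 * F (patch_map j p))))"
      using F(2) q0 by (intro nn_integral_unit_square continuous_intros continuous_cutoff cF j) auto
    finally show "(\<integral>\<^sup>+x\<in>patch_map j ` half_square. ennreal (F x) \<partial>area_measure A g)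
      \<le> ennreal (8 * q0 * integral unit_square (\<lambda>p. (cutoff p)\<^sup>2 * F (patch_map j p)))" by simp
  qed
  also have "\<dots> = ennreal (\<Sum>j\<in>I. 8 * q0 * integral unit_square (\<lambda>p. (cutoff p)\<^sup>2 * F (patch_map j p)))"
    using nn q0 by (intro sum_ennreal) auto
  finally have "(\<gamma> / 2) * integral unit_square (\<lambda>p. F (patch_map i p))
    \<le> (\<Sum>j\<in>I. 8 * q0 * integral unit_square (\<lambda>p. (cutoff p)\<^sup>2 * F (patch_map j p)))"
    using nn q0 by (subst (asm) ennreal_le_iff) (auto intro!: sum_nonneg)
  then have "(\<gamma> / 2) * integral unit_square (\<lambda>p. F (patch_map i p))
    \<le> 8 * q0 * (\<Sum>j\<in>I. integral unit_square (\<lambda>p. (cutoff p)\<^sup>2 * F (patch_map j p)))"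
    by (simp add: sum_distrib_left)
  then show ?thesis using \<gamma> by (simp add: field_simps)
qed

section \<open>The estimate on the whole surface\<close>

lemma smooth_continuous:
  assumes smooth: "smooth_on_spacetime A T f" and t: "t \<in> {0..<T}"
  shows "continuous_on UNIV (\<lambda>x. f x t)"
  unfolding cover[symmetric]
proof (rule continuous_on_open_UN)
  fix c assume c: "c \<in> A"
  note cs = chart_simps[OF chart[OF c]]
  show "open (dom_of c)" by (rule cs(1))
  have "continuous_on (coord c ` dom_of c \<times> {0..<T}) (\<lambda>(w, t). f (inv_coord c w) t)"
    using smooth c unfolding smooth_on_spacetime_def smooth_on_def using Ck_on.simps(1) by blast
  then have "continuous_on (dom_of c) (\<lambda>x. (\<lambda>(w, t). f (inv_coord c w) t) (coord c x, t))"
    by (rule continuous_on_compose2[OF _ continuous_on_Pair[OF cs(3) continuous_on_const]]) (use t in auto)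
  then show "continuous_on (dom_of c) (\<lambda>x. f x t)"
    by (rule continuous_on_eq) (simp add: cs(5))
qed

lemma sup_bound_flow:
  assumes alpha: "\<alpha> > 0" and T0: "0 < T0" "T0 < T"
  shows "\<exists>C::real. 0 < C \<and>
    (\<forall>f :: 'a \<Rightarrow> real \<Rightarrow> real.
       smooth_on_spacetime A T f \<longrightarrow> flow_equation A g \<alpha> T f \<longrightarrow>
       (SUP (x, t) \<in> UNIV \<times> {T0..<T}. ennreal (exp (f x t)))
         \<le> ennreal C *
            max 1 (\<integral>\<^sup>+ t \<in> {0..<T}.
                     (\<integral>\<^sup>+ x. ennreal (exp (f x t)) \<partial>area_measure A g) \<partial>lborel))"
proof -
  obtain I where I: "finite I" "I \<noteq> {}" "\<And>i. i \<in> I \<Longrightarrow> patch i" "(\<Union>i\<in>I. patch_map i ` half_square) = UNIV"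
    by (rule patch_cover) (rule that, assumption+)
  \<comment> \<open>Collects what holds on one square, quantified over all \<open>T\<close> and
    \<open>f\<close>, so that \<open>q i\<close> is chosen before the solution.\<close>
  define est where "est i q \<longleftrightarrow> q \<ge> 1 \<and> (\<forall>p\<in>unit_square. patch_weight i p \<le> q) \<and>
    (\<forall>T f. smooth_on_spacetime A T f \<longrightarrow> flow_equation A g \<alpha> T f \<longrightarrow>
      energy_solution (patch_weight i) q T (\<lambda>t p. exp (f (patch_map i p) t)))" for i q
  have "\<exists>q. est i q" if i: "i \<in> I" for i
  proof -
    obtain c b z0 r where ie: "i = (c, b, z0, r)" by (cases i) auto
    have c: "c \<in> A" "b \<in> cp1_atlas" "r > 0" "square_map z0 r ` unit_square \<subseteq> W c b"
      using I(3)[OF i] by (auto simp: patch_def ie)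
    have PG: "patch_map i = P c z0 r" "patch_weight i = G c z0 r" by (simp_all add: patch_map_def patch_weight_def ie)
    show ?thesis
      unfolding est_def PG
      by (rule patch_estimates[OF c alpha], rule exI, intro conjI ballI allI impI) assumption+
  qed
  then obtain q where q: "\<And>i. i \<in> I \<Longrightarrow> est i (q i)" by metis
  have q1: "q i \<ge> 1" and qW: "\<And>p. p \<in> unit_square \<Longrightarrow> patch_weight i p \<le> q i" if "i \<in> I" for i
    using q[OF that] unfolding est_def by blast+
  define q0 where "q0 = Max (q ` I)"
  have qq0: "q i \<le> q0" if "i \<in> I" for i unfolding q0_def using I(1) that by (intro Max_ge) auto
  have q01: "q0 \<ge> 1"
  proof -
    obtain i where "i \<in> I" using I(2) by blast
    then show ?thesis using qq0[of i] q1[of i] by linarith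
  qed
  have "\<exists>\<gamma>>0. \<forall>p\<in>unit_square. \<gamma> \<le> patch_weight i p" if i: "i \<in> I" for i
  proof -
    have "compact unit_square" by (simp add: unit_square_def)
    moreover have "unit_square \<noteq> {}" using unit_square_iff[of 0 0] by auto
    ultimately obtain p0 where "p0 \<in> unit_square" "\<forall>p\<in>unit_square. patch_weight i p0 \<le> patch_weight i p"
      using continuous_attains_inf[OF _ _ patch_continuous(2)[OF I(3)[OF i]]] by blast
    then show ?thesis using patch_continuous(3)[OF I(3)[OF i]] by blast
  qed
  then obtain \<gamma>' where \<gamma>': "\<And>i. i \<in> I \<Longrightarrow> \<gamma>' i > 0 \<and> (\<forall>p\<in>unit_square. \<gamma>' i \<le> patch_weight i p)" by metis
  define \<gamma> where "\<gamma> = Min (\<gamma>' ` I)"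
  have \<gamma>: "\<gamma> > 0" unfolding \<gamma>_def using I(1,2) \<gamma>' by (subst Min_gr_iff) auto
  have G: "\<gamma> \<le> patch_weight i p \<and> patch_weight i p \<le> q0" if i: "i \<in> I" and p: "p \<in> unit_square" for i p
  proof -
    have "\<gamma> \<le> \<gamma>' i" unfolding \<gamma>_def using I(1) i by (intro Min_le) auto
    moreover have "\<gamma>' i \<le> patch_weight i p" using \<gamma>'[OF i] p by blast
    ultimately show ?thesis using qW[OF i p] qq0[OF i] by linarith
  qed
  define \<kappa> where "\<kappa> = 16 * q0 / \<gamma>"
  interpret fam: patch_family I patch_weight q0 \<gamma> \<kappa>
    by unfold_locales (use I q01 \<gamma> G patch_continuous(2) in \<open>auto simp: \<kappa>_def\<close>)
  \<comment> \<open>Written out in the parameters of the cover, so that the constant precedes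
    \<open>f\<close>; \<open>const_eq\<close> identifies it with the constant of
    \<open>patch_solution\<close>.\<close>
  define moser_const where "moser_const = 1 + 32 * (q0 * real (card I) * \<kappa>) * (\<kappa> / \<gamma>) + 1125 * q0\<^sup>2 * real (card I) * (4 + \<kappa> / \<gamma>) + real (card I) * (\<kappa> / \<gamma>)"
  define C1 where "C1 = 25 * (1 + exp (moser_const * T0) * (8*moser_const)^4 * (2/T0)^9 * (1 + T0))"
  \<comment> \<open>The second factor arises from bounding the time integral of
    \<open>Y 1 + 1\<close> by \<open>2 * card I * I0 + T\<close>.\<close>
  define C where "C = C1 * (2 * real (card I) + T)"
  have moser_const_nonneg: "moser_const \<ge> 0" unfolding moser_const_def \<kappa>_def using q01 \<gamma> by (intro add_nonneg_nonneg mult_nonneg_nonneg) auto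
  have C1: "C1 > 0" unfolding C1_def using moser_const_nonneg T0 by (intro mult_pos_pos add_pos_nonneg mult_nonneg_nonneg) auto
  have card1: "real (card I) \<ge> 1" using I(1,2) by (simp add: Suc_le_eq card_gt_0_iff)
  have C: "C > 0" unfolding C_def using C1 T0 card1 by (intro mult_pos_pos) auto
  show ?thesis
  proof (intro exI[of _ C] conjI C allI impI)
    fix f assume smooth: "smooth_on_spacetime A T f" and flow: "flow_equation A g \<alpha> T f"
    define J where "J t = (\<integral>\<^sup>+ x. ennreal (exp (f x t)) \<partial>area_measure A g)" for t
    define Jint where "Jint = (\<integral>\<^sup>+ t \<in> {0..<T}. J t \<partial>lborel)"
    define u where "u i t p = exp (f (patch_map i p) t)" for i t p
    have "energy_solution (patch_weight i) (q i) T (u i)" if "i \<in> I" for i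
      using q[OF that] smooth flow unfolding est_def u_def by blast
    then obtain ut where ut: "\<And>i. i \<in> I \<Longrightarrow> continuous_on ({0..<T} \<times> unit_square) (\<lambda>(t, p). u i t p) \<and>
        continuous_on ({0..<T} \<times> unit_square) (\<lambda>(t, p). ut i t p) \<and>
        (\<forall>t\<in>{0..<T}. \<forall>p\<in>unit_square. ((\<lambda>s. u i s p) has_real_derivative ut i t p) (at t within {0..<T})) \<and>
        (\<forall>t\<in>{0..<T}. \<forall>m\<ge>1. \<exists>d. energy_bounds (patch_weight i) (q i) (u i t) (ut i t) m d)"
      unfolding energy_solution_def by metis
    have cf: "continuous_on UNIV (\<lambda>x. exp (f x t))" if "t \<in> {0..<T}" for t
      by (intro continuous_intros smooth_continuous[OF smooth that])
    have cu: "continuous_on unit_square (u i t)" if "i \<in> I" "t \<in> {0..<T}" for i t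
      unfolding u_def by (rule continuous_on_compose2[OF cf[OF that(2)] patch_continuous(1)[OF I(3)[OF that(1)]]]) simp
    interpret sol: patch_solution I patch_weight q0 \<gamma> \<kappa> T u ut
    proof
      fix i t and m :: nat assume i: "i \<in> I" and t: "t \<in> {0..<T}"
      show "integral unit_square (\<lambda>p. u i t p ^ m) \<le> \<kappa> * (\<Sum>j\<in>I. integral unit_square (\<lambda>p. (cutoff p)\<^sup>2 * u j t p ^ m))"
        unfolding \<kappa>_def u_def
        by (rule patch_comparison[OF I(1,3,4) G \<gamma> q01 _ _ i, where F = "\<lambda>x. exp (f x t) ^ m"])
           (auto intro!: continuous_intros cf t)
      assume m: "m \<ge> 1"
      obtain d where "energy_bounds (patch_weight i) (q i) (u i t) (ut i t) m d"
        using ut[OF i] t m by blast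
      moreover have "0 \<le> q i" using q1[OF i] by simp
      ultimately have "energy_bounds (patch_weight i) q0 (u i t) (ut i t) m d"
        by (rule energy_bounds_mono[OF _ _ qq0[OF i] cu[OF i t]]) (simp add: u_def)
      then show "\<exists>d. energy_bounds (patch_weight i) q0 (u i t) (ut i t) m d" by blast
    qed (use ut in \<open>auto simp: u_def\<close>)
    have const_eq: "sol.moser_const = moser_const" by (simp add: sol.moser_const_def sol.N_def sol.compare_const_def moser_const_def)
    \<comment> \<open>Each summand of \<open>Y 1\<close> is at most \<open>2 * J t\<close>, since
      \<open>patch_weight\<close> is twice the area density and the cutoff is at most 1. Only the
      largest summand is compared with \<open>J t\<close>, which keeps the sum itself in the
      reals.\<close>
    have YJ: "ennreal (sol.Y 1 t / (2 * real (card I))) \<le> J t" if t: "t \<in> {0..<T}" for t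
    proof -
      define a where "a i = integral unit_square (\<lambda>p. exp (f (patch_map i p) t) * patch_weight i p / 2)" for i
      have aJ: "ennreal (a i) \<le> J t" if "i \<in> I" for i
        unfolding a_def J_def by (rule patch_integral_le[OF I(3)[OF that] cf[OF t]]) simp
      define b where "b = Max (a ` I)"
      have ab: "a i \<le> b" if "i \<in> I" for i unfolding b_def using I(1) that by (intro Max_ge) auto
      have "b \<in> a ` I" unfolding b_def using I(1,2) by (intro Max_in) auto
      then have bJ: "ennreal b \<le> J t" using aJ by auto
      have "sol.Y 1 t \<le> (\<Sum>i\<in>I. 2 * b)"
        unfolding sol.Y_def
      proof (rule sum_mono)
        fix i assume i: "i \<in> I"
        note [continuous_intros] = cu[OF i t] patch_continuous(2)[OF I(3)[OF i]] continuous_cutoff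
        have "integral unit_square (\<lambda>p. cutoff p * patch_weight i p * u i t p ^ 1)
          \<le> integral unit_square (\<lambda>p. 2 * (u i t p * patch_weight i p / 2))"
        proof (intro integral_le integrable_unit_square continuous_intros)
          fix p assume p: "p \<in> unit_square"
          have "cutoff p * (patch_weight i p * u i t p) \<le> 1 * (patch_weight i p * u i t p)"
            using cutoff_bounds[OF p] patch_continuous(3)[OF I(3)[OF i] p] by (intro mult_right_mono) (auto simp: u_def)
          then show "cutoff p * patch_weight i p * u i t p ^ 1 \<le> 2 * (u i t p * patch_weight i p / 2)"
            by (simp add: mult_ac)
        qed auto
        also have "\<dots> = 2 * a i" unfolding a_def u_def by (rule integral_mult_right)
        also have "\<dots> \<le> 2 * b" using ab[OF i] by simp
        finally show "integral unit_square (\<lambda>p. cutoff p * patch_weight i p * u i t p ^ 1) \<le> 2 * b" .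
      qed
      then have "sol.Y 1 t / (2 * real (card I)) \<le> b" using card1 by (simp add: divide_le_eq mult_ac)
      then show ?thesis using bJ ennreal_leI order_trans by blast
    qed
    have main: "ennreal (exp (f x t)) \<le> ennreal C * max 1 Jint" if t: "t \<in> {T0..<T}" for x t
    proof (cases "Jint = \<infinity>")
      case True
      then show ?thesis using C by (simp add: ennreal_mult_top max_def)
    next
      case False
      define I0 where "I0 = enn2real Jint"
      have I0: "Jint = ennreal I0" "I0 \<ge> 0" using False by (auto simp: I0_def less_top)
      define B where "B = (2 * real (card I) + T) * max 1 I0"
      have init: "integral {0..s} (\<lambda>s. sol.Y 1 s + 1) \<le> B" if s: "s \<in> {0..<T}" for s
      proof -
        have contY: "continuous_on {0..s} (sol.Y 1)"
          by (rule continuous_on_subset[OF DERIV_continuous_on[OF sol.Y_derivative]]) (use s in auto)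
        have Ypos: "sol.Y 1 r > 0" if "r \<in> {0..s}" for r using that s by (intro sol.Y_pos) auto
        have hi: "((\<lambda>r. sol.Y 1 r / (2 * real (card I))) has_integral integral {0..s} (sol.Y 1) / (2 * real (card I))) {0..s}"
          by (intro has_integral_divide integrable_integral integrable_continuous_real contY)
        have "ennreal (integral {0..s} (sol.Y 1) / (2 * real (card I)))
          = (\<integral>\<^sup>+r\<in>{0..s}. ennreal (sol.Y 1 r / (2 * real (card I))) \<partial>lborel)"
          using Ypos by (intro nn_integral_has_integral_lebesgue'[OF _ hi, symmetric]) (simp add: less_imp_le)
        also have "\<dots> \<le> Jint"
          unfolding Jint_def
        proof (intro nn_integral_mono)
          fix r :: real
          show "ennreal (sol.Y 1 r / (2 * real (card I))) * indicator {0..s} r \<le> J r * indicator {0..<T} r"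
            using YJ[of r] s by (auto simp: indicator_def)
        qed
        finally have "integral {0..s} (sol.Y 1) / (2 * real (card I)) \<le> I0"
          using I0 by (simp add: ennreal_le_iff)
        then have "integral {0..s} (sol.Y 1) \<le> 2 * real (card I) * I0" using card1 by (simp add: divide_le_eq mult_ac)
        moreover have "integral {0..s} (\<lambda>r. sol.Y 1 r + 1) = integral {0..s} (sol.Y 1) + s"
          by (subst integral_add[OF integrable_continuous_real[OF contY]]) (use s in auto)
        moreover have "2 * real (card I) * I0 + s \<le> 2 * real (card I) * max 1 I0 + T * max 1 I0"
        proof (rule add_mono)
          show "2 * real (card I) * I0 \<le> 2 * real (card I) * max 1 I0" by (intro mult_left_mono) auto
          have "T * 1 \<le> T * max 1 I0" using T0 by (intro mult_left_mono) auto
          moreover have "s \<le> T" using s by simp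
          ultimately show "s \<le> T * max 1 I0" by linarith
        qed
        ultimately show ?thesis by (simp add: B_def algebra_simps)
      qed
      have B1: "B \<ge> 1"
      proof -
        have "1 * 1 \<le> (2 * real (card I) + T) * max 1 I0" using card1 T0 by (intro mult_mono) auto
        then show ?thesis by (simp add: B_def)
      qed
      obtain j p where j: "j \<in> I" and p: "p \<in> half_square" and x: "x = patch_map j p" using I(4) by blast
      have "u j t p \<le> C1 * B"
        using sol.sup_bound[OF T0(1) _ _ B1 init j p, of t] t unfolding const_eq C1_def by simp
      then have "exp (f x t) \<le> C * max 1 I0" by (simp add: u_def x C_def B_def mult_ac)
      then have "ennreal (exp (f x t)) \<le> ennreal (C * max 1 I0)" by (rule ennreal_leI)
      also have "\<dots> = ennreal C * max 1 Jint"
        using C I0 by (simp add: ennreal_mult max_def)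
      finally show ?thesis .
    qed
    show "(SUP (x, t) \<in> UNIV \<times> {T0..<T}. ennreal (exp (f x t)))
         \<le> ennreal C * max 1 (\<integral>\<^sup>+ t \<in> {0..<T}. (\<integral>\<^sup>+ x. ennreal (exp (f x t)) \<partial>area_measure A g) \<partial>lborel)"
      unfolding J_def[symmetric] Jint_def[symmetric] using main by (intro SUP_least) auto
  qed
qed

end

theorem proposition3p5:
  fixes A :: "'a::t2_space chart set"
    and \<phi> :: "'a \<Rightarrow> cp1"
    and h :: "'a chart \<Rightarrow> cp1 chart \<Rightarrow> 'a \<Rightarrow> complex"
    and g :: "'a chart \<Rightarrow> 'a \<Rightarrow> real"
    and \<alpha> T T\<^sub>0 :: real
  assumes pair: "vanishing_spinorial_pair A \<phi> h"
    and metric: "g = spinorial_metric \<phi> h"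
    and normalized: "emeasure (area_measure A g) UNIV = 1"
    and alpha: "0 < \<alpha>"
    and times: "0 < T\<^sub>0" "T\<^sub>0 < T"
  shows "\<exists>C::real. 0 < C \<and>
    (\<forall>f :: 'a \<Rightarrow> real \<Rightarrow> real.
       smooth_on_spacetime A T f \<longrightarrow> flow_equation A g \<alpha> T f \<longrightarrow>
       (SUP (x, t) \<in> UNIV \<times> {T\<^sub>0..<T}. ennreal (exp (f x t)))
         \<le> ennreal C *
            max 1 (\<integral>\<^sup>+ t \<in> {0..<T}.
                     (\<integral>\<^sup>+ x. ennreal (exp (f x t)) \<partial>area_measure A g) \<partial>lborel))"
proof -
  interpret spinorial_pair A \<phi> h by unfold_locales (rule pair)
  show ?thesis unfolding metric by (rule sup_bound_flow[OF alpha times])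
qed

end
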